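(* The reallocation problem restricted to instances in which the product size is uniform (${\it size}(p)$ is the same for all $p\in P$) and the transit time is uniform ($\tau(p)$ is the same for all $p\in P$), with arbitrary capacities $c,d^+,d^-$, can be solved (i.e., a feasible schedule of minimum completion time can be computed) in ${\mathrm O}(mn\log m)$ time, where $m=|P|$ and $n=|W|$.
   Context: Reallocation problem. An instance consists of a finite set $W$ of warehouses ($n=|W|$) and a finite set $P$ of products ($m=|P|$). Each product $p$ has a size ${\it size}(p)\ge 0$, a source warehouse $s(p)\in W$ and a sink warehouse $t(p)\in W$ with $s(p)\ne t(p)$, and a transit time $\tau(p)\in\mathbb{Z}_{>0}$. Each warehouse $w$ has a warehouse capacity $c(w)$, a carry-out capacity $d^+(w)$ and a carry-in capacity $d^-(w)$, each a nonnegative real or $+\infty$ (meaning the constraint is vacuous). Let $P^+(w)=\{p: s(p)=w\}$, $P^-(w)=\{p: t(p)=w\}$. Standing assumptions: ${\it size}(p)\le d^+(w)$ for $p\in P^+(w)$, ${\it size}(p)\le d^-(w)$ for $p\in P^-(w)$, $\sum_{p\in P^+(w)}{\it size}(p)\le c(w)$ and $\sum_{p\in P^-(w)}{\it size}(p)\le c(w)$ for all $w$. A schedule is a map $\varphi:P\to\mathbb{Z}_{\ge0}$ ($p$ departs at $\varphi(p)$, arrives at $\varphi(p)+\tau(p)$). It is feasible if for all $\theta\in\mathbb{Z}_{\ge0}$, $w\in W$: (i) $\sum_{p\in P^+(w):\varphi(p)=\theta}{\it size}(p)\le d^+(w)$; (ii) $\sum_{p\in P^-(w):\varphi(p)=\theta-\tau(p)}{\it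 size}(p)\le d^-(w)$; (iii) $\sum_{p\in P^+(w):\varphi(p)\ge\theta}{\it size}(p)+\sum_{p\in P^-(w):\varphi(p)\le\theta-\tau(p)}{\it size}(p)\le c(w)$. The completion time is $\max_{p}(\varphi(p)+\tau(p))$; the problem asks for a feasible schedule of minimum completion time. *)

theory Defs
  imports "HOL-Library.Extended_Real"
begin

section \<open>The reallocation problem\<close>

record ('w, 'p) reallocation =
  warehouses :: "'w set"
  products :: "'p set"
  psize :: "'p \<Rightarrow> real"
  source :: "'p \<Rightarrow> 'w"
  sink :: "'p \<Rightarrow> 'w"
  transit :: "'p \<Rightarrow> nat"
  capacity :: "'w \<Rightarrow> ereal"
  carry_out :: "'w \<Rightarrow> ereal"
  carry_in :: "'w \<Rightarrow> ereal"

definition out_products :: "('w, 'p) reallocation \<Rightarrow> 'w \<Rightarrow> 'p set" where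
  "out_products I w = {p \<in> products I. source I p = w}"

definition in_products :: "('w, 'p) reallocation \<Rightarrow> 'w \<Rightarrow> 'p set" where
  "in_products I w = {p \<in> products I. sink I p = w}"

definition reallocation_instance :: "('w, 'p) reallocation \<Rightarrow> bool" where
  "reallocation_instance I \<longleftrightarrow>
     finite (warehouses I) \<and> finite (products I) \<and>
     (\<forall>p \<in> products I.
        0 \<le> psize I p \<and> source I p \<in> warehouses I \<and> sink I p \<in> warehouses I \<and>
        source I p \<noteq> sink I p \<and> 0 < transit I p) \<and>
     (\<forall>w \<in> warehouses I.
        0 \<le> capacity I w \<and> 0 \<le> carry_out I w \<and> 0 \<le> carry_in I w \<and>
        (\<forall>p \<in> out_products I w. ereal (psize I p) \<le> carry_out I w) \<and>
        (\<forall>p \<in> in_products I w. ereal (psize I p) \<le> carry_in I w) \<and>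
        ereal (\<Sum>p \<in> out_products I w. psize I p) \<le> capacity I w \<and>
        ereal (\<Sum>p \<in> in_products I w. psize I p) \<le> capacity I w)"

definition uniform_size :: "('w, 'p) reallocation \<Rightarrow> bool" where
  "uniform_size I \<longleftrightarrow> (\<exists>\<sigma>. \<forall>p \<in> products I. psize I p = \<sigma>)"

definition uniform_transit :: "('w, 'p) reallocation \<Rightarrow> bool" where
  "uniform_transit I \<longleftrightarrow> (\<exists>\<tau>. \<forall>p \<in> products I. transit I p = \<tau>)"

text \<open>Arrival conditions are written additively: subtraction on \<^typ>\<open>nat\<close> truncates, so
  the condition that the departure time equals \<open>\<theta> - transit I p\<close> would be wrong for small \<open>\<theta>\<close>.\<close>

definition feasible :: "('w, 'p) reallocation \<Rightarrow> ('p \<Rightarrow> nat) \<Rightarrow> bool" where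
  "feasible I \<phi> \<longleftrightarrow> (\<forall>\<theta>. \<forall>w \<in> warehouses I.
     ereal (\<Sum>p | p \<in> out_products I w \<and> \<phi> p = \<theta>. psize I p) \<le> carry_out I w \<and>
     ereal (\<Sum>p | p \<in> in_products I w \<and> \<phi> p + transit I p = \<theta>. psize I p) \<le> carry_in I w \<and>
     ereal ((\<Sum>p | p \<in> out_products I w \<and> \<theta> \<le> \<phi> p. psize I p) +
            (\<Sum>p | p \<in> in_products I w \<and> \<phi> p + transit I p \<le> \<theta>. psize I p)) \<le> capacity I w)"

definition completion_time :: "('w, 'p) reallocation \<Rightarrow> ('p \<Rightarrow> nat) \<Rightarrow> nat" where
  "completion_time I \<phi> = Max ((\<lambda>p. \<phi> p + transit I p) ` products I)"

definition optimal_schedule :: "('w, 'p) reallocation \<Rightarrow> ('p \<Rightarrow> nat) \<Rightarrow> bool" where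
  "optimal_schedule I \<phi> \<longleftrightarrow> feasible I \<phi> \<and>
     (\<forall>\<psi>. feasible I \<psi> \<longrightarrow> completion_time I \<phi> \<le> completion_time I \<psi>)"


section \<open>Model of computation\<close>

text \<open>
  A unit-cost random access machine with structured control flow. A program uses finitely many
  named arrays of unbounded length, which hold either natural numbers or extended real numbers;
  a scalar variable is cell 0 of an array. Array indices are computed natural numbers, which gives
  indirect addressing. The only arithmetic is addition, truncated subtraction and halving of
  naturals, and addition of extended reals; both sorts can be compared. In particular there is no
  unit-cost multiplication, and an extended real can influence the naturals only through
  comparisons.
\<close>

type_synonym array_name = string

record state =
  nmem :: "array_name \<Rightarrow> nat \<Rightarrow> nat"
  rmem :: "array_name \<Rightarrow> nat \<Rightarrow> ereal"

datatype nexp =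
    NLit nat
  | NCell array_name nexp
  | NAdd nexp nexp
  | NSub nexp nexp
  | NHalf nexp

datatype rexp =
    RCell array_name nexp
  | RAdd rexp rexp

datatype bexp =
    NLe nexp nexp
  | RLe rexp rexp
  | Neg bexp
  | Conj bexp bexp

datatype com =
    Skip
  | NAssign array_name nexp nexp
  | RAssign array_name nexp rexp
  | Seq com com
  | Cond bexp com com
  | While bexp com

primrec nval :: "nexp \<Rightarrow> state \<Rightarrow> nat" where
  "nval (NLit k) s = k"
| "nval (NCell a e) s = nmem s a (nval e s)"
| "nval (NAdd e f) s = nval e s + nval f s"
| "nval (NSub e f) s = nval e s - nval f s"
| "nval (NHalf e) s = nval e s div 2"

primrec rval :: "rexp \<Rightarrow> state \<Rightarrow> ereal" where
  "rval (RCell a e) s = rmem s a (nval e s)"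
| "rval (RAdd e f) s = rval e s + rval f s"

primrec bval :: "bexp \<Rightarrow> state \<Rightarrow> bool" where
  "bval (NLe e f) s \<longleftrightarrow> nval e s \<le> nval f s"
| "bval (RLe e f) s \<longleftrightarrow> rval e s \<le> rval f s"
| "bval (Neg b) s \<longleftrightarrow> \<not> bval b s"
| "bval (Conj b c) s \<longleftrightarrow> bval b s \<and> bval c s"

definition nupdate :: "array_name \<Rightarrow> nat \<Rightarrow> nat \<Rightarrow> state \<Rightarrow> state" where
  "nupdate a i x s = s\<lparr>nmem := (nmem s)(a := (nmem s a)(i := x))\<rparr>"

definition rupdate :: "array_name \<Rightarrow> nat \<Rightarrow> ereal \<Rightarrow> state \<Rightarrow> state" where
  "rupdate a i x s = s\<lparr>rmem := (rmem s)(a := (rmem s a)(i := x))\<rparr>"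

text \<open>\<open>exec c s t s'\<close>: the program \<open>c\<close>, started in \<open>s\<close>, halts in \<open>s'\<close> after \<open>t\<close> steps. Every
  executed assignment or skip and every evaluated test counts as one step. The expressions occurring in
  a program have bounded size, so charging for each operation inside them would change \<open>t\<close>
  only by a constant factor depending on the program.\<close>

inductive exec :: "com \<Rightarrow> state \<Rightarrow> nat \<Rightarrow> state \<Rightarrow> bool" where
  Skip: "exec Skip s 1 s"
| NAssign: "exec (NAssign a i e) s 1 (nupdate a (nval i s) (nval e s) s)"
| RAssign: "exec (RAssign a i e) s 1 (rupdate a (nval i s) (rval e s) s)"
| Seq: "exec c s t s' \<Longrightarrow> exec d s' t' s'' \<Longrightarrow> exec (Seq c d) s (t + t') s''"
| CondTrue: "bval b s \<Longrightarrow> exec c s t s' \<Longrightarrow> exec (Cond b c d) s (Suc t) s'"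
| CondFalse: "\<not> bval b s \<Longrightarrow> exec d s t s' \<Longrightarrow> exec (Cond b c d) s (Suc t) s'"
| WhileFalse: "\<not> bval b s \<Longrightarrow> exec (While b c) s 1 s"
| WhileTrue: "bval b s \<Longrightarrow> exec c s t s' \<Longrightarrow> exec (While b c) s' t' s'' \<Longrightarrow>
    exec (While b c) s (Suc (t + t')) s''"

inductive_cases SkipE: "exec Skip s t s'"
inductive_cases NAssignE: "exec (NAssign a i e) s t s'"
inductive_cases RAssignE: "exec (RAssign a i e) s t s'"
inductive_cases SeqE: "exec (Seq c d) s t s'"
inductive_cases CondE: "exec (Cond b c d) s t s'"
inductive_cases WhileE: "exec (While b c) s t s'"

lemma exec_deterministic:
  "exec c s t s' \<Longrightarrow> exec c s u r \<Longrightarrow> u = t \<and> r = s'"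
proof (induction arbitrary: u r rule: exec.induct)
  case (Skip s)
  then show ?case by (auto elim: SkipE)
next
  case (NAssign a i e s)
  then show ?case by (auto elim: NAssignE)
next
  case (RAssign a i e s)
  then show ?case by (auto elim: RAssignE)
next
  case (Seq c s t s' d t' s'')
  then show ?case by (blast elim: SeqE)
next
  case (CondTrue b s c t s' d)
  then show ?case by (blast elim: CondE)
next
  case (CondFalse b s d t s' c)
  then show ?case by (blast elim: CondE)
next
  case (WhileFalse b s c)
  show ?case
    using WhileFalse.prems by (cases rule: WhileE) (use WhileFalse.hyps in auto)
next
  case (WhileTrue b s c t s' t' s'')
  obtain v q v' where "u = Suc (v + v')" "exec c s v q" "exec (While b c) q v' r"
    using WhileTrue.prems WhileTrue.hyps(1) by (blast elim: WhileE)
  with WhileTrue.IH show ?case by blast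
qed


section \<open>Input and output of a program\<close>

text \<open>Warehouses and products are given to a program as \<open>0, \<dots>, n - 1\<close> and \<open>0, \<dots>, m - 1\<close>.\<close>

definition indexed_instance :: "nat \<Rightarrow> nat \<Rightarrow> (nat, nat) reallocation \<Rightarrow> bool" where
  "indexed_instance n m I \<longleftrightarrow>
     reallocation_instance I \<and> warehouses I = {..<n} \<and> products I = {..<m}"

text \<open>The values of the instance outside the index ranges are meaningless and are masked;
  all memory that does not hold input is 0.\<close>

definition input_state :: "nat \<Rightarrow> nat \<Rightarrow> (nat, nat) reallocation \<Rightarrow> state" where
  "input_state n m I =
     \<lparr>nmem = (\<lambda>_ _. 0)
        (''n'' := (\<lambda>_. 0)(0 := n),
         ''m'' := (\<lambda>_. 0)(0 := m),
         ''source'' := (\<lambda>p. if p < m then source I p else 0),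
         ''sink'' := (\<lambda>p. if p < m then sink I p else 0),
         ''transit'' := (\<lambda>p. if p < m then transit I p else 0)),
      rmem = (\<lambda>_ _. 0)
        (''size'' := (\<lambda>p. if p < m then ereal (psize I p) else 0),
         ''capacity'' := (\<lambda>w. if w < n then capacity I w else 0),
         ''carry_out'' := (\<lambda>w. if w < n then carry_out I w else 0),
         ''carry_in'' := (\<lambda>w. if w < n then carry_in I w else 0))\<rparr>"

definition output_schedule :: "state \<Rightarrow> nat \<Rightarrow> nat" where
  "output_schedule s = nmem s ''schedule''"

end

theory Submission imports Defs begin

text \<open>
  If all products have the same size and transit time, let \<open>D\<close> be the least number such that every
  warehouse can send out, and receive, all its products in \<open>D\<close> rounds. No feasible schedule uses fewer
  departure times than \<open>D\<close>, and \<open>D\<close> departure times suffice. Start with a single block of departure times,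
  \<open>{0..<D}\<close>, that contains all products, and halve the blocks repeatedly, distributing the products
  of a block over its two halves in proportion to their lengths. At every warehouse the number of
  departures, the number of arrivals and their difference are all rounded up or down. Rounding the first two
  keeps the carry-out and carry-in capacities; rounding the third keeps the excess of arrivals over
  departures before every block boundary below its initial or its final value, hence keeps the warehouse capacity.

  Such a rounding is an integral flow close to a fractional one, in a network with three nodes
  for every warehouse and a common root. The edges of fractional value form a forest of parent
  pointers. An edge that would close a cycle is inserted by pushing flow around
  the cycle until one of its edges becomes integral. As the network has \<open>3n + 1\<close> nodes, each of the \<open>m\<close> insertions
  takes time \<open>O(n)\<close>, and \<open>O(log m)\<close> halvings are needed. When all edges have been inserted, a leaf of the forest would have
  exactly one fractional edge, which contradicts flow conservation; so the forest is empty and the flow integral.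
\<close>


section \<open>Reasoning about programs\<close>

text \<open>The capacities are consulted only to find \<open>D\<close>. If \<open>k\<close> products
  fit into one round at a warehouse and \<open>D * k\<close> bounds its load, then division in
  proportion to length gives every sub-block the bound length times \<open>k\<close>; this bound is
  an integer, so rounding up cannot exceed it. In general \<open>D\<close> is not a power of two.
  Blocks therefore start at multiples of a power of two, and the last one is cut off at
  \<open>D\<close>: a block of length \<open>M\<close> splits into lengths \<open>h\<close> and
  \<open>M - h\<close>, where \<open>M\<close> may be less than \<open>2 * h\<close>, and a block no
  longer than \<open>h\<close> stays whole. Hence the proportion \<open>h / M\<close> can differ
  between blocks, and flows are stored in units of \<open>1 / M\<close>: the machine cannot divide,
  while one conditional subtraction reduces a sum modulo \<open>M\<close>. Rounding must move each
  star value by strictly less than one unit, so a star edge that starts at 0 has to stay there; the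
  invariants track this. Apart from its insertions a block costs \<open>O(n)\<close>, which is
  affordable because a level splits at most \<open>D\<close> blocks and
  \<open>D \<le> m\<close>.\<close>

definition wp :: "com \<Rightarrow> state \<Rightarrow> (nat \<Rightarrow> state \<Rightarrow> bool) \<Rightarrow> bool" where
  "wp c s Q \<longleftrightarrow> (\<exists>t s'. exec c s t s' \<and> Q t s')"

primrec writes :: "com \<Rightarrow> array_name set" where
  "writes Skip = {}"
| "writes (NAssign a i e) = {a}"
| "writes (RAssign a i e) = {}"
| "writes (Seq c d) = writes c \<union> writes d"
| "writes (Cond b c d) = writes c \<union> writes d"
| "writes (While b c) = writes c"

primrec rwrites :: "com \<Rightarrow> array_name set" where
  "rwrites Skip = {}"
| "rwrites (NAssign a i e) = {}"
| "rwrites (RAssign a i e) = {a}"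
| "rwrites (Seq c d) = rwrites c \<union> rwrites d"
| "rwrites (Cond b c d) = rwrites c \<union> rwrites d"
| "rwrites (While b c) = rwrites c"

text \<open>A syntactic frame condition on whole arrays. \<open>wp_mono\<close> supplies it for
  every program, so a specification need only speak of arrays that the program writes.\<close>

definition unchanged :: "com \<Rightarrow> state \<Rightarrow> state \<Rightarrow> bool" where
  "unchanged c s s' \<longleftrightarrow>
     (\<forall>a. a \<notin> writes c \<longrightarrow> nmem s' a = nmem s a) \<and> (\<forall>a. a \<notin> rwrites c \<longrightarrow> rmem s' a = rmem s a)"

lemma nmem_nupdate [simp]:
  "nmem (nupdate a i x s) b = (if b = a then (nmem s a)(i := x) else nmem s b)"
  by (simp add: nupdate_def)

lemma rmem_nupdate [simp]: "rmem (nupdate a i x s) = rmem s"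
  by (simp add: nupdate_def)

lemma rmem_rupdate [simp]:
  "rmem (rupdate a i x s) b = (if b = a then (rmem s a)(i := x) else rmem s b)"
  by (simp add: rupdate_def)

lemma nmem_rupdate [simp]: "nmem (rupdate a i x s) = nmem s"
  by (simp add: rupdate_def)

lemma exec_unchanged: "exec c s t s' \<Longrightarrow> unchanged c s s'"
  by (induction rule: exec.induct) (auto simp: unchanged_def)

lemma unchanged_refl: "unchanged c s s"
  by (simp add: unchanged_def)

lemma unchanged_trans: "unchanged c s s' \<Longrightarrow> unchanged c s' s'' \<Longrightarrow> unchanged c s s''"
  by (simp add: unchanged_def)

lemma exec_simps [simp]:
  "exec Skip s t s' \<longleftrightarrow> t = 1 \<and> s' = s"
  "exec (NAssign a i e) s t s' \<longleftrightarrow> t = 1 \<and> s' = nupdate a (nval i s) (nval e s) s"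
  "exec (RAssign a i r) s t s' \<longleftrightarrow> t = 1 \<and> s' = rupdate a (nval i s) (rval r s) s"
  "exec (Cond b c d) s t s' \<longleftrightarrow>
     (\<exists>u. t = Suc u \<and> (if bval b s then exec c s u s' else exec d s u s'))"
  by (auto intro: exec.intros[simplified] elim: SkipE NAssignE RAssignE CondE)

lemma wp_simps [simp]:
  "wp Skip s Q \<longleftrightarrow> Q 1 s"
  "wp (NAssign a i e) s Q \<longleftrightarrow> Q 1 (nupdate a (nval i s) (nval e s) s)"
  "wp (RAssign a i r) s Q \<longleftrightarrow> Q 1 (rupdate a (nval i s) (rval r s) s)"
  "wp (Cond b c d) s Q \<longleftrightarrow> (if bval b s then wp c s (\<lambda>t. Q (Suc t)) else wp d s (\<lambda>t. Q (Suc t)))"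
  by (auto simp: wp_def)

lemma wp_Seq [simp]: "wp (Seq c d) s Q \<longleftrightarrow> wp c s (\<lambda>t s'. wp d s' (\<lambda>t'. Q (t + t')))"
  unfolding wp_def by (blast intro: exec.Seq elim: SeqE)

lemma wp_mono:
  assumes "wp c s Q" "\<And>t s'. unchanged c s s' \<Longrightarrow> Q t s' \<Longrightarrow> Q' t s'"
  shows "wp c s Q'"
  using assms exec_unchanged unfolding wp_def by blast

text \<open>For loops whose number of iterations is known beforehand. The cost \<open>T k\<close>
  may depend on the iteration, so that the costs of blocks of different sizes can be added up
  instead of being estimated by the largest.\<close>

lemma wp_While_count:
  assumes "J 0 s"
    and "\<And>k s'. k < N \<Longrightarrow> unchanged c s s' \<Longrightarrow> J k s' \<Longrightarrow>
           bval b s' \<and> wp c s' (\<lambda>t s''. t \<le> T k \<and> J (Suc k) s'')"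
    and "\<And>s'. unchanged c s s' \<Longrightarrow> J N s' \<Longrightarrow> \<not> bval b s'"
  shows "wp (While b c) s (\<lambda>t s'. t \<le> (\<Sum>k<N. T k + 1) + 1 \<and> J N s')"
proof -
  have "\<exists>t s'. exec (While b c) r t s' \<and> t \<le> (\<Sum>i=k..<N. T i + 1) + 1 \<and> J N s'"
    if "k \<le> N" "unchanged c s r" "J k r" for k r
    using that
  \<comment> \<open>Downwards from \<open>N\<close>, since the claim concerns the iterations that
    remain.\<close>
  proof (induction k arbitrary: r rule: inc_induct)
    case base
    then have "exec (While b c) r 1 r" using assms(3) exec.WhileFalse by blast
    then show ?case using base by auto
  next
    case (step k)
    then obtain t r' where r': "bval b r" "exec c r t r'" "t \<le> T k" "J (Suc k) r'"
      using assms(2)[of k r] unfolding wp_def by blast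
    have "unchanged c s r'" using unchanged_trans step.prems(1) exec_unchanged r'(2) by blast
    then obtain u q where "exec (While b c) r' u q" "u \<le> (\<Sum>i=Suc k..<N. T i + 1) + 1" "J N q"
      using step.IH r'(4) by blast
    moreover have "(\<Sum>i=k..<N. T i + 1) = T k + 1 + (\<Sum>i=Suc k..<N. T i + 1)"
      using step.hyps by (simp add: sum.atLeast_Suc_lessThan)
    ultimately show ?case using exec.WhileTrue[OF r'(1,2)] r'(3) by fastforce
  qed
  from this[of 0 s] assms(1) show ?thesis
    unfolding wp_def by (simp add: unchanged_refl atLeast0LessThan)
qed

text \<open>For loops whose length depends on the data: the measure drops in each iteration, so its
  initial value bounds their number.\<close>

lemma wp_While_measure:
  fixes \<mu> :: "state \<Rightarrow> nat"
  assumes "J s"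
    and "\<And>s'. unchanged c s s' \<Longrightarrow> J s' \<Longrightarrow> bval b s' \<Longrightarrow>
           wp c s' (\<lambda>t s''. t \<le> T \<and> J s'' \<and> \<mu> s'' < \<mu> s')"
  shows "wp (While b c) s (\<lambda>t s'. t \<le> (T + 1) * \<mu> s + 1 \<and> J s' \<and> \<not> bval b s')"
proof -
  have "\<exists>t s'. exec (While b c) r t s' \<and> t \<le> (T + 1) * \<mu> r + 1 \<and> J s' \<and> \<not> bval b s'"
    if "unchanged c s r" "J r" for r
    using that
  proof (induction "\<mu> r" arbitrary: r rule: less_induct)
    case less
    show ?case
    proof (cases "bval b r")
      case False
      then show ?thesis using less.prems exec.WhileFalse[OF False] by force
    next
      case True
      then obtain t r' where r': "exec c r t r'" "t \<le> T" "J r'" "\<mu> r' < \<mu> r"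
        using assms(2) less.prems unfolding wp_def by blast
      have "unchanged c s r'" using unchanged_trans less.prems(1) exec_unchanged r'(1) by blast
      then obtain u q where q: "exec (While b c) r' u q" "u \<le> (T + 1) * \<mu> r' + 1" "J q"
        "\<not> bval b q"
        using less.hyps r' by blast
      have "(T + 1) * (\<mu> r' + 1) \<le> (T + 1) * \<mu> r"
        using r'(4) by (intro mult_le_mono) auto
      then have "Suc (t + u) \<le> (T + 1) * \<mu> r + 1" using q(2) r'(2) by (simp add: algebra_simps)
      then show ?thesis using exec.WhileTrue[OF True r'(1) q(1)] q by blast
    qed
  qed
  from this[OF unchanged_refl] assms(1) show ?thesis unfolding wp_def by blast
qed

abbreviation var :: "array_name \<Rightarrow> nexp" where
  "var a \<equiv> NCell a (NLit 0)"

abbreviation set_var :: "array_name \<Rightarrow> nexp \<Rightarrow> com" (infix "::=" 62) where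
  "a ::= e \<equiv> NAssign a (NLit 0) e"

notation Seq (infixr ";;" 60)

abbreviation Less :: "nexp \<Rightarrow> nexp \<Rightarrow> bexp" where
  "Less e f \<equiv> Neg (NLe f e)"

definition Equal :: "nexp \<Rightarrow> nexp \<Rightarrow> bexp" where
  "Equal e f = Conj (NLe e f) (NLe f e)"

lemma bval_Equal [simp]: "bval (Equal e f) s \<longleftrightarrow> nval e s = nval f s"
  by (auto simp: Equal_def)

definition For :: "array_name \<Rightarrow> nexp \<Rightarrow> com \<Rightarrow> com" where
  "For i b c = i ::= NLit 0 ;; While (Less (var i) b) (c ;; i ::= NAdd (var i) (NLit 1))"

lemma writes_For [simp]: "writes (For i b c) = insert i (writes c)"
  by (auto simp: For_def)

lemma rwrites_For [simp]: "rwrites (For i b c) = rwrites c"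
  by (auto simp: For_def)

text \<open>The bound \<open>b\<close> is evaluated again before each iteration, so the invariant
  has to keep its value at \<open>N\<close>. Beyond \<open>T k\<close> an iteration pays 2 for the
  test and the increment; the final 2 pays for the initialisation and the last test.\<close>

lemma wp_For:
  assumes "J 0 (nupdate i 0 0 s)"
    and "\<And>k s'. k < N \<Longrightarrow> unchanged (For i b c) s s' \<Longrightarrow> J k s' \<Longrightarrow> nmem s' i 0 = k \<Longrightarrow>
           wp c s' (\<lambda>t s''. t \<le> T k \<and> J (Suc k) (nupdate i 0 (Suc k) s''))"
    and "i \<notin> writes c"
    and "\<And>k s'. k \<le> N \<Longrightarrow> unchanged (For i b c) s s' \<Longrightarrow> J k s' \<Longrightarrow> nval b s' = N"
    and "\<And>t s'. t \<le> (\<Sum>k<N. T k + 2) + 2 \<Longrightarrow> unchanged (For i b c) s s' \<Longrightarrow> J N s' \<Longrightarrow> Q t s'"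
  shows "wp (For i b c) s Q"
proof -
  let ?b = "Less (var i) b" and ?c = "c ;; i ::= NAdd (var i) (NLit 1)"
  let ?s = "nupdate i 0 0 s"
  let ?J = "\<lambda>k s'. J k s' \<and> nmem s' i 0 = k"
  have fr: "unchanged (For i b c) s r" if "unchanged ?c ?s r" for r
    using that by (auto simp: unchanged_def)
  have "wp (While ?b ?c) ?s (\<lambda>t s'. t \<le> (\<Sum>k<N. (T k + 1) + 1) + 1 \<and> ?J N s')"
  proof (rule wp_While_count)
    show "?J 0 ?s" using assms(1) by simp
  next
    fix k s' assume k: "k < N" "unchanged ?c ?s s'" "?J k s'"
    note u = fr[OF k(2)]
    have "wp c s' (\<lambda>t s''. t \<le> T k \<and> J (Suc k) (nupdate i 0 (Suc k) s''))"
      using assms(2) k u by blast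
    then have "wp ?c s' (\<lambda>t s''. t \<le> T k + 1 \<and> ?J (Suc k) s'')"
      unfolding wp_Seq by (rule wp_mono) (use assms(3) k in \<open>auto simp: unchanged_def\<close>)
    moreover have "bval ?b s'" using assms(4)[of k s'] k u by simp
    ultimately show "bval ?b s' \<and> wp ?c s' (\<lambda>t s''. t \<le> T k + 1 \<and> ?J (Suc k) s'')" by blast
  next
    fix s' assume "unchanged ?c ?s s'" "?J N s'"
    then show "\<not> bval ?b s'" using assms(4)[of N s'] fr by simp
  qed
  then have "wp (While ?b ?c) ?s (\<lambda>t. Q (1 + t))"
    by (rule wp_mono) (use assms(5) fr in \<open>auto simp: unchanged_def\<close>)
  then show ?thesis unfolding For_def by simp
qed


section \<open>Forests of fractional edges\<close>

lemma single_valued_root_unique: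
  assumes "single_valued r" "(v, x) \<in> r\<^sup>*" "(v, y) \<in> r\<^sup>*" "x \<notin> Domain r" "y \<notin> Domain r"
  shows "x = y"
  using single_valued_confluent[OF assms(1-3)] Not_Domain_rtrancl[OF assms(4)]
    Not_Domain_rtrancl[OF assms(5)] by auto

text \<open>A path to \<open>u\<close> cannot visit \<open>y\<close>, from which \<open>u\<close> is
  unreachable; so the pairs that leave \<open>y\<close> can be deleted.\<close>

lemma rtrancl_avoid:
  assumes "(x, u) \<in> r\<^sup>*" "(y, u) \<notin> r\<^sup>*"
  shows "(x, u) \<in> {(a, b) \<in> r. a \<noteq> y}\<^sup>*"
  using assms(1)
proof (induction rule: converse_rtrancl_induct)
  case (step a b)
  have "(a, u) \<in> r\<^sup>*" using step.hyps by (rule converse_rtrancl_into_rtrancl)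
  then have "a \<noteq> y" using assms(2) by blast
  then show ?case using step by (auto intro: converse_rtrancl_into_rtrancl)
qed simp

text \<open>A path from \<open>y\<close> back to \<open>x\<close> would close a cycle with the pair
  \<open>(x, y)\<close>, so no path from \<open>y\<close> uses a pair that leaves
  \<open>x\<close>.\<close>

lemma reachable_avoid:
  assumes "acyclic r" "(x, y) \<in> r"
  shows "{(a, b) \<in> r. a \<noteq> x}\<^sup>* `` {y} = r\<^sup>* `` {y}"
proof
  show "{(a, b) \<in> r. a \<noteq> x}\<^sup>* `` {y} \<subseteq> r\<^sup>* `` {y}"
    using rtrancl_mono[of "{(a, b) \<in> r. a \<noteq> x}" r] by blast
  have "(y, z) \<in> {(a, b) \<in> r. a \<noteq> x}\<^sup>*" if "(y, z) \<in> r\<^sup>*" for z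
    using that
  proof (induction rule: rtrancl_induct)
    case (step a b)
    have "a \<noteq> x"
    proof
      assume "a = x"
      then have "(x, x) \<in> r\<^sup>+" using assms(2) step.hyps(1) by (metis rtrancl_into_trancl2)
      then show False using assms(1) unfolding acyclic_def by blast
    qed
    then show ?case using step by (auto intro: rtrancl_into_rtrancl)
  qed simp
  then show "r\<^sup>* `` {y} \<subseteq> {(a, b) \<in> r. a \<noteq> x}\<^sup>* `` {y}" by blast
qed

lemma reachable_step:
  assumes "single_valued r" "acyclic r" "(x, y) \<in> r"
  shows "r\<^sup>* `` {x} = insert x (r\<^sup>* `` {y})" "x \<notin> r\<^sup>* `` {y}"
proof -
  show "x \<notin> r\<^sup>* `` {y}"
    using assms(2,3) unfolding acyclic_def by (metis Image_singleton_iff rtrancl_into_trancl2)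
  have "z = x \<or> (y, z) \<in> r\<^sup>*" if "(x, z) \<in> r\<^sup>*" for z
    using that assms(1,3) by (cases rule: converse_rtranclE) (auto dest: single_valuedD)
  moreover have "(x, z) \<in> r\<^sup>*" if "(y, z) \<in> r\<^sup>*" for z
    using assms(3) that by (rule converse_rtrancl_into_rtrancl)
  ultimately show "r\<^sup>* `` {x} = insert x (r\<^sup>* `` {y})" by auto
qed

text \<open>Pointers leave no choice: any way from \<open>v\<close> to the root \<open>u\<close>
  leads through \<open>x\<close>, and it ends there once the pointer of \<open>x\<close> is
  gone.\<close>

lemma cut_disconnects:
  assumes "single_valued r" "(v, x) \<in> r\<^sup>*" "u \<notin> Domain r" "u \<noteq> x"
  shows "(v, u) \<notin> {(a, b) \<in> r. a \<noteq> x}\<^sup>*"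
  using assms(2)
proof (induction rule: converse_rtrancl_induct)
  case base
  have "x \<notin> Domain {(a, b) \<in> r. a \<noteq> x}" by auto
  from Not_Domain_rtrancl[OF this] have "(x, u) \<notin> {(a, b) \<in> r. a \<noteq> x}\<^sup>*"
    using assms(4) by auto
  then show ?case .
next
  case (step a b)
  show ?case
  proof
    assume "(a, u) \<in> {(a, b) \<in> r. a \<noteq> x}\<^sup>*"
    then show False
    proof (cases rule: converse_rtranclE)
      case base
      then show False using step.hyps(1) assms(3) by blast
    next
      fix c assume "(a, c) \<in> {(a, b) \<in> r. a \<noteq> x}" "(c, u) \<in> {(a, b) \<in> r. a \<noteq> x}\<^sup>*"
      moreover from this have "c = b" using step.hyps(1) assms(1) unfolding single_valued_def by blast
      ultimately show False using step.IH by blast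
    qed
  qed
qed

section \<open>Forests of parent pointers and flow conservation\<close>

locale network =
  fixes V E :: "nat set" and tl hd :: "nat \<Rightarrow> nat" and M :: nat
  assumes finite_V: "finite V" and finite_E: "finite E" and zero_notin_E: "0 \<notin> E"
    and ends: "g \<in> E \<Longrightarrow> tl g \<in> V \<and> hd g \<in> V \<and> tl g \<noteq> hd g"
begin

text \<open>For an end \<open>x\<close> of \<open>g\<close> this is the opposite end. The arithmetic
  form lets the program cross an edge in one assignment, without a test.\<close>

definition other :: "nat \<Rightarrow> nat \<Rightarrow> nat" where
  "other g x = tl g + hd g - x"

definition up :: "(nat \<Rightarrow> nat) \<Rightarrow> (nat \<times> nat) set" where
  "up par = {(x, other (par x) x) |x. x \<in> V \<and> par x \<noteq> 0}"

text \<open>A forest is stored by giving every node \<open>x\<close> the edge \<open>par x\<close> to its parent; \<open>par x = 0\<close> marks a root,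
  which is why no edge has the number \<open>0\<close>.\<close>

definition forest :: "(nat \<Rightarrow> nat) \<Rightarrow> nat set \<Rightarrow> bool" where
  "forest par F \<longleftrightarrow> F \<subseteq> E \<and> bij_betw par {x \<in> V. par x \<noteq> 0} F \<and>
     (\<forall>x\<in>V. par x \<noteq> 0 \<longrightarrow> x = tl (par x) \<or> x = hd (par x)) \<and> acyclic (up par)"

definition balance :: "(nat \<Rightarrow> nat) \<Rightarrow> nat \<Rightarrow> int" where
  "balance val z = (\<Sum>g\<in>E. int (val g) * (of_bool (tl g = z) - of_bool (hd g = z)))"

text \<open>Flow values are stored as multiples of \<open>1 / M\<close>, so the integral values in the unit interval are \<open>0\<close> and \<open>M\<close>.\<close>

definition fractional :: "(nat \<Rightarrow> nat) \<Rightarrow> nat set \<Rightarrow> nat set" where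
  "fractional val A = {g \<in> A. 0 < val g \<and> val g < M}"

lemma other_tl [simp]: "other g (tl g) = hd g" and other_hd [simp]: "other g (hd g) = tl g"
  by (simp_all add: other_def)

lemma single_valued_up: "single_valued (up par)"
  by (auto simp: up_def single_valued_def)

lemma Domain_up: "Domain (up par) = {x \<in> V. par x \<noteq> 0}"
  by (auto simp: up_def)

lemma up_cut: "up (par(x := 0)) = {(a, b) \<in> up par. a \<noteq> x}"
  by (auto simp: up_def)

lemma forestD:
  assumes "forest par F" "x \<in> V" "par x \<noteq> 0"
  shows "par x \<in> F" "par x \<in> E" "x = tl (par x) \<or> x = hd (par x)" "other (par x) x \<in> V"
    "other (par x) x \<noteq> x" "(x, other (par x) x) \<in> up par"
    "y \<in> V \<Longrightarrow> par y = par x \<Longrightarrow> y = x"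
proof -
  have F: "F \<subseteq> E" "bij_betw par {x \<in> V. par x \<noteq> 0} F" and e: "x = tl (par x) \<or> x = hd (par x)"
    using assms unfolding forest_def by auto
  show "par x \<in> F" using F(2) assms(2,3) by (auto dest: bij_betwE)
  then show E: "par x \<in> E" using F by blast
  show "x = tl (par x) \<or> x = hd (par x)" by (rule e)
  show "other (par x) x \<in> V" "other (par x) x \<noteq> x"
    using e ends[OF E] other_tl[of "par x"] other_hd[of "par x"] by metis+
  show "(x, other (par x) x) \<in> up par" using assms by (auto simp: up_def)
  show "y = x" if "y \<in> V" "par y = par x"
    using F(2) that assms(2,3) unfolding bij_betw_def inj_on_def by auto
qed

lemma forest_acyclic: "forest par F \<Longrightarrow> acyclic (up par)"
  by (simp add: forest_def)

lemma finite_up: "finite (up par)"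
  using finite_V by (simp add: up_def)

lemma up_subset: assumes "forest par F" shows "up par \<subseteq> V \<times> V"
  using forestD(4)[OF assms] by (auto simp: up_def)

lemma reachable_subset: assumes "forest par F" "x \<in> V" shows "(up par)\<^sup>* `` {x} \<subseteq> V"
proof -
  have "(x, y) \<in> (up par)\<^sup>* \<Longrightarrow> y \<in> V" for y
    by (induction rule: rtrancl_induct) (use assms up_subset in auto)
  then show ?thesis by blast
qed

lemma forest_cut:
  assumes f: "forest par F" and x: "x \<in> V"
  shows "forest (par(x := 0)) (F - {par x})"
proof -
  have b: "bij_betw par {x \<in> V. par x \<noteq> 0} F" and sub: "F \<subseteq> E" using f by (auto simp: forest_def)
  have "bij_betw (par(x := 0)) {y \<in> V. (par(x := 0)) y \<noteq> 0} (F - {par x})"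
  proof (cases "par x = 0")
    \<comment> \<open>Cutting at a root changes nothing: \<open>par x\<close> is 0, which is not an
      edge, so \<open>F - {0} = F\<close>.\<close>
    case True
    then have "par(x := 0) = par" by auto
    moreover have "0 \<notin> F" using sub zero_notin_E by blast
    ultimately show ?thesis using b True by simp
  next
    case False
    then have "bij_betw par ({x \<in> V. par x \<noteq> 0} - {x}) (F - {par x})"
      using b x bij_betw_DiffI[OF b, of "{x}" "{par x}"] by (auto simp: bij_betw_def)
    moreover have "{y \<in> V. (par(x := 0)) y \<noteq> 0} = {x \<in> V. par x \<noteq> 0} - {x}" by auto
    ultimately show ?thesis by (subst bij_betw_cong[where g = par]) auto
  qed
  moreover have "acyclic (up (par(x := 0)))"
    unfolding up_cut using f by (auto simp: forest_def intro: acyclic_subset)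
  ultimately show ?thesis using f unfolding forest_def by auto
qed

lemma forest_link:
  assumes f: "forest par F" and x: "x \<in> V" "par x = 0" and g: "g \<in> E" "g \<notin> F" "x = tl g \<or> x = hd g"
    and r: "(other g x, x) \<notin> (up par)\<^sup>*"
  shows "forest (par(x := g)) (insert g F)" "up (par(x := g)) = insert (x, other g x) (up par)"
proof -
  have g0: "g \<noteq> 0" using g(1) zero_notin_E by metis
  show up: "up (par(x := g)) = insert (x, other g x) (up par)"
    using x g0 by (auto simp: up_def)
  have b: "bij_betw par {x \<in> V. par x \<noteq> 0} F" and sub: "F \<subseteq> E" using f by (auto simp: forest_def)
  have "{y \<in> V. (par(x := g)) y \<noteq> 0} = insert x {x \<in> V. par x \<noteq> 0}" using x g0 by auto
  moreover have "bij_betw (par(x := g)) {x \<in> V. par x \<noteq> 0} F"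
    using b x(2) by (subst bij_betw_cong[where g = par]) auto
  ultimately have "bij_betw (par(x := g)) {y \<in> V. (par(x := g)) y \<noteq> 0} (insert g F)"
    using x g by (auto simp: bij_betw_def)
  moreover have "acyclic (up (par(x := g)))" using f r unfolding up by (simp add: forest_def)
  ultimately show "forest (par(x := g)) (insert g F)"
    using f g sub unfolding forest_def by auto
qed

lemma balance_update:
  assumes "g \<in> E"
  shows "balance (val(g := a)) z =
    balance val z + (int a - int (val g)) * (of_bool (tl g = z) - of_bool (hd g = z))"
proof -
  have "(\<Sum>k\<in>E - {g}. int ((val(g := a)) k) * (of_bool (tl k = z) - of_bool (hd k = z))) =
        (\<Sum>k\<in>E - {g}. int (val k) * (of_bool (tl k = z) - of_bool (hd k = z)))"
    by (intro sum.cong) auto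
  then show ?thesis
    unfolding balance_def sum.remove[OF finite_E assms] by (simp add: algebra_simps)
qed

text \<open>Conservation modulo \<open>M\<close> suffices: at a leaf every edge except the parent
  edge carries 0 or \<open>M\<close>, so \<open>M\<close> would divide the value of the parent edge,
  which lies strictly between. This is why the star edges may carry residues in place of the true
  flow.\<close>

lemma no_fractional:
  assumes f: "forest par F" and frac: "F = fractional val E" and le: "\<forall>g\<in>E. val g \<le> M"
    and b: "\<forall>z\<in>V. int M dvd balance val z"
  shows "F = {}"
proof (rule ccontr)
  assume "F \<noteq> {}"
  have bij: "bij_betw par {x \<in> V. par x \<noteq> 0} F" using f by (simp add: forest_def)
  have "wf (up par)" using f finite_up by (simp add: finite_acyclic_wf forest_def)
  moreover obtain x0 where "x0 \<in> {x \<in> V. par x \<noteq> 0}"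
    using bij \<open>F \<noteq> {}\<close> unfolding bij_betw_def by auto
  ultimately obtain x where x: "x \<in> V" "par x \<noteq> 0" and
    leaf: "\<And>y. (y, x) \<in> up par \<Longrightarrow> y \<notin> {x \<in> V. par x \<noteq> 0}"
    by (rule wfE_min) blast
  let ?g = "par x"
  note gx = forestD[OF f x]
  \<comment> \<open>Another fractional edge at \<open>x\<close> would be the parent edge of some
    \<open>y \<noteq> x\<close>, and \<open>y\<close> would then be a child of the leaf
    \<open>x\<close>.\<close>
  have other_int: "val k = 0 \<or> val k = M" if k: "k \<in> E" "k \<noteq> ?g" "tl k = x \<or> hd k = x" for k
  proof (rule ccontr)
    assume "\<not> ?thesis"
    then have "k \<in> F" using le k frac by (force simp: fractional_def)
    then obtain y where y: "y \<in> V" "par y \<noteq> 0" "par y = k"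
      using bij unfolding bij_betw_def by auto
    note gy = forestD[OF f y(1,2)]
    have "y \<noteq> x" using y k by auto
    then have "other k y = x"
      using gy(3) k(3) y(3) other_tl[of k] other_hd[of k] by metis
    then show False using leaf gy(6) y by auto
  qed
  have "int M dvd int (val k) * (of_bool (tl k = x) - of_bool (hd k = x))" if "k \<in> E - {?g}" for k
    using other_int[of k] that by (cases "tl k = x \<or> hd k = x") auto
  then have "int M dvd (\<Sum>k\<in>E - {?g}. int (val k) * (of_bool (tl k = x) - of_bool (hd k = x)))"
    by (rule dvd_sum)
  moreover have "int M dvd balance val x" using b x by blast
  ultimately have "int M dvd int (val ?g) * (of_bool (tl ?g = x) - of_bool (hd ?g = x))"
    unfolding balance_def sum.remove[OF finite_E gx(2)] by (meson dvd_add_left_iff)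
  then have "int M dvd int (val ?g)" using gx(3) ends[OF gx(2)] by auto
  then have "M dvd val ?g" by simp
  moreover have "0 < val ?g" "val ?g < M" using gx(1) frac by (auto simp: fractional_def)
  ultimately show False using nat_dvd_not_less by blast
qed

section \<open>Moving the root of a tree\<close>

text \<open>While the path from \<open>u\<close> to its root is reversed, \<open>g\<close> is the edge that has been removed but not yet
  reinserted (if any), \<open>x\<close> its end in the tree of \<open>u\<close>.\<close>

definition reroot_inv :: "nat set \<Rightarrow> nat \<Rightarrow> (nat \<Rightarrow> nat) \<Rightarrow> nat \<Rightarrow> nat \<Rightarrow> bool" where
  "reroot_inv F u par x g \<longleftrightarrow> u \<in> V \<and> par u = 0 \<and> x \<in> V \<and> (x, u) \<in> (up par)\<^sup>* \<and>
     (if g = 0 then forest par F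
      else g \<in> F \<and> F \<subseteq> E \<and> forest par (F - {g}) \<and> (x = tl g \<or> x = hd g) \<and> (other g x, u) \<notin> (up par)\<^sup>*)"

text \<open>The nodes reachable from the far end of the pending edge \<open>g\<close> form the part
  of the path not yet reversed, so their number bounds the steps left. With \<open>g = 0\<close> the
  old root has been passed and the loop is over.\<close>

definition reroot_measure :: "(nat \<Rightarrow> nat) \<Rightarrow> nat \<Rightarrow> nat \<Rightarrow> nat" where
  "reroot_measure par x g = (if g = 0 then 0 else card ((up par)\<^sup>* `` {other g x}))"

lemma reroot_start:
  assumes f: "forest par F" and u: "u \<in> V"
  shows "reroot_inv F u (par(u := 0)) u (par u)"
proof (cases "par u = 0")
  case True
  then have "par(u := 0) = par" by auto
  then show ?thesis using assms True by (simp add: reroot_inv_def)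
next
  case False
  note p = forestD[OF f u False]
  have "u \<notin> (up par)\<^sup>* `` {other (par u) u}"
    by (rule reachable_step(2)[OF single_valued_up forest_acyclic[OF f] p(6)])
  then have "(other (par u) u, u) \<notin> (up (par(u := 0)))\<^sup>*"
    using rtrancl_mono[of "up (par(u := 0))" "up par"] unfolding up_cut by blast
  then show ?thesis
    using False p u forest_cut[OF f u] f unfolding reroot_inv_def forest_def[of par] by auto
qed

lemma reroot_step:
  assumes inv: "reroot_inv F u par x g" and g0: "g \<noteq> 0"
  defines "y \<equiv> other g x"
  shows "reroot_inv F u (par(y := g)) y (par y)"
    "reroot_measure (par(y := g)) y (par y) < reroot_measure par x g"
proof -
  let ?R = "up par"
  have u: "u \<in> V" "par u = 0" and x: "x \<in> V" "(x, u) \<in> ?R\<^sup>*" and g: "g \<in> F" "F \<subseteq> E"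
    and f: "forest par (F - {g})" and gx: "x = tl g \<or> x = hd g" and yu: "(y, u) \<notin> ?R\<^sup>*"
    using inv g0 by (auto simp: reroot_inv_def y_def)
  have gE: "g \<in> E" using g by blast
  have oy: "other g y = x" and gy: "y = tl g \<or> y = hd g" and yV: "y \<in> V" and xy: "x \<noteq> y"
    using gx ends[OF gE] unfolding y_def by auto
  have yneu: "y \<noteq> u" using yu by blast
  \<comment> \<open>Overwriting the pointer of \<open>y\<close> is read as a cut followed by a link,
    so that \<open>forest_cut\<close> and \<open>forest_link\<close> apply. The link closes no
    cycle: after the cut \<open>x\<close> leads to the root \<open>u\<close>, hence not to the root
    \<open>y\<close>.\<close>
  define par1 where "par1 = par(y := 0)"
  have f1: "forest par1 (F - {g} - {par y})" unfolding par1_def by (rule forest_cut[OF f yV])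
  have R1: "up par1 = {(a, b) \<in> ?R. a \<noteq> y}" unfolding par1_def by (rule up_cut)
  have R1R: "(up par1)\<^sup>* \<subseteq> ?R\<^sup>*" unfolding R1 by (intro rtrancl_mono) auto
  have xu1: "(x, u) \<in> (up par1)\<^sup>*" unfolding R1 by (rule rtrancl_avoid[OF x(2) yu])
  have roots: "y \<notin> Domain (up par1)" "u \<notin> Domain (up par1)"
    using u(2) yneu by (auto simp: Domain_up par1_def)
  have xy1: "(x, y) \<notin> (up par1)\<^sup>*"
    using single_valued_root_unique[OF single_valued_up xu1 _ roots(2,1)] yneu by blast
  have par': "par1(y := g) = par(y := g)" by (simp add: par1_def)
  note link = forest_link[OF f1 yV _ gE _ gy, unfolded par' oy]
  have f': "forest (par(y := g)) (insert g (F - {g} - {par y}))"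
    and up': "up (par(y := g)) = insert (y, x) (up par1)"
    using link xy1 by (auto simp: par1_def)
  have yu': "(y, u) \<in> (up (par(y := g)))\<^sup>*"
    unfolding up' using xu1 rtrancl_mono[of "up par1" "insert (y, x) (up par1)"]
    by (meson converse_rtrancl_into_rtrancl insertI1 subset_insertI subsetD)
  have "reroot_inv F u (par(y := g)) y (par y) \<and>
    reroot_measure (par(y := g)) y (par y) < reroot_measure par x g"
  proof (cases "par y = 0")
    case True
    have "0 \<notin> F" using g zero_notin_E by blast
    then have "insert g (F - {g} - {par y}) = F" using True g by auto
    then have inv': "reroot_inv F u (par(y := g)) y (par y)"
      using True f' u yneu yV yu' by (simp add: reroot_inv_def)
    have "(up par)\<^sup>* `` {y} \<noteq> {}" "finite ((up par)\<^sup>* `` {y})"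
      using reachable_subset[OF f yV] finite_V finite_subset by auto
    then show ?thesis
      using inv' True g0 by (simp add: reroot_measure_def y_def[symmetric] card_gt_0_iff)
  next
    case False
    define z where "z = other (par y) y"
    note py = forestD[OF f yV False, folded z_def]
    have zy: "(z, y) \<notin> ?R\<^sup>*"
      using reachable_step(2)[OF single_valued_up forest_acyclic[OF f] py(6)] by blast
    have zy': "(z, y) \<notin> (up par1)\<^sup>*" using zy R1R by blast
    \<comment> \<open>The new pointer of \<open>y\<close> does not affect \<open>z\<close>, from
      which \<open>y\<close> cannot be reached.\<close>
    have reach: "(up (par(y := g)))\<^sup>* `` {z} = (up par1)\<^sup>* `` {z}"
      unfolding up' using zy' by (auto simp: rtrancl_insert)
    have "(z, u) \<notin> ?R\<^sup>*" using yu py(6) by (meson converse_rtrancl_into_rtrancl)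
    then have zu: "(z, u) \<notin> (up (par(y := g)))\<^sup>*" using reach R1R by blast
    have "insert g (F - {g} - {par y}) = F - {par y}" using g py(1) by auto
    then have inv': "reroot_inv F u (par(y := g)) y (par y)"
      using False f' u yneu yV yu' py zu g unfolding reroot_inv_def z_def[symmetric] by auto
    have sub: "(up (par(y := g)))\<^sup>* `` {z} \<subseteq> (up par)\<^sup>* `` {z}"
      unfolding reach using R1R by blast
    moreover have st: "(up par)\<^sup>* `` {y} = insert y ((up par)\<^sup>* `` {z})" "y \<notin> (up par)\<^sup>* `` {z}"
      using reachable_step[OF single_valued_up forest_acyclic[OF f] py(6)] by auto
    moreover have fin: "finite ((up par)\<^sup>* `` {y})"
      using reachable_subset[OF f yV] finite_V finite_subset by auto
    ultimately have "card ((up (par(y := g)))\<^sup>* `` {z}) < card ((up par)\<^sup>* `` {y})"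
      by (intro psubset_card_mono) auto
    then show ?thesis
      using inv' False g0 by (simp add: reroot_measure_def y_def[symmetric] z_def[symmetric])
  qed
  then show "reroot_inv F u (par(y := g)) y (par y)"
    "reroot_measure (par(y := g)) y (par y) < reroot_measure par x g"
    by auto
qed

lemma reroot_measure_le:
  assumes "reroot_inv F u par x g"
  shows "reroot_measure par x g \<le> card V"
proof (cases "g = 0")
  case False
  then have "g \<in> E" "forest par (F - {g})" "x = tl g \<or> x = hd g"
    using assms by (auto simp: reroot_inv_def)
  then have "other g x \<in> V" using ends by auto
  then have "(up par)\<^sup>* `` {other g x} \<subseteq> V"
    using reachable_subset \<open>forest par (F - {g})\<close> by blast
  then show ?thesis using finite_V by (simp add: reroot_measure_def card_mono)
qed (simp add: reroot_measure_def)

text \<open>The flow that can still be sent from \<open>z\<close> to its parent: the parent edge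
  gains if it is directed away from \<open>z\<close>, and loses otherwise.\<close>

definition room :: "(nat \<Rightarrow> nat) \<Rightarrow> (nat \<Rightarrow> nat) \<Rightarrow> nat \<Rightarrow> nat" where
  "room par val z = (if tl (par z) = z then M - val (par z) else val (par z))"

text \<open>The difference of the two reachable sets is the part of the path from \<open>v\<close>
  that has been climbed. There \<open>d\<close> is exactly the minimum of the rooms and of
  \<open>d0\<close>, the room of the edge to be inserted. That the minimum is attained is what later
  makes the push break the cycle.\<close>

definition walk_inv :: "(nat \<Rightarrow> nat) \<Rightarrow> (nat \<Rightarrow> nat) \<Rightarrow> nat \<Rightarrow> nat \<Rightarrow> nat \<Rightarrow> nat \<Rightarrow> bool" where
  "walk_inv par val v d0 x d \<longleftrightarrow> x \<in> V \<and> (v, x) \<in> (up par)\<^sup>* \<and> 0 < d \<and> d \<le> d0 \<and>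
     (\<forall>z\<in>(up par)\<^sup>* `` {v} - (up par)\<^sup>* `` {x}. d \<le> room par val z) \<and>
     (d = d0 \<or> (\<exists>z\<in>(up par)\<^sup>* `` {v} - (up par)\<^sup>* `` {x}. room par val z = d))"

lemma climb_measure:
  assumes "forest par F" "x \<in> V" "par x \<noteq> 0"
  shows "card ((up par)\<^sup>* `` {other (par x) x}) < card ((up par)\<^sup>* `` {x})"
proof -
  have st: "(up par)\<^sup>* `` {x} = insert x ((up par)\<^sup>* `` {other (par x) x})"
    "x \<notin> (up par)\<^sup>* `` {other (par x) x}"
    using reachable_step[OF single_valued_up forest_acyclic[OF assms(1)] forestD(6)[OF assms]] by auto
  moreover have "finite ((up par)\<^sup>* `` {x})"
    using reachable_subset[OF assms(1,2)] finite_V finite_subset by auto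
  ultimately show ?thesis by (intro psubset_card_mono) auto
qed

lemma walk_step:
  assumes f: "forest par (fractional val A)" and w: "walk_inv par val v d0 x d" and x0: "par x \<noteq> 0"
  shows "walk_inv par val v d0 (other (par x) x) (min d (room par val x))"
proof -
  let ?y = "other (par x) x"
  have x: "x \<in> V" and vx: "(v, x) \<in> (up par)\<^sup>*" using w by (auto simp: walk_inv_def)
  note p = forestD[OF f x x0]
  have st: "(up par)\<^sup>* `` {x} = insert x ((up par)\<^sup>* `` {?y})" "x \<notin> (up par)\<^sup>* `` {?y}"
    using reachable_step[OF single_valued_up forest_acyclic[OF f] p(6)] by auto
  have "(v, z) \<in> (up par)\<^sup>*" if "(x, z) \<in> (up par)\<^sup>*" for z using vx that by (rule rtrancl_trans)
  then have visited: "(up par)\<^sup>* `` {v} - (up par)\<^sup>* `` {?y} =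
      insert x ((up par)\<^sup>* `` {v} - (up par)\<^sup>* `` {x})"
    using st vx by auto
  have "0 < room par val x" using p(1) by (auto simp: room_def fractional_def)
  moreover have "(v, ?y) \<in> (up par)\<^sup>*" using vx p(6) by (rule rtrancl_into_rtrancl)
  ultimately show ?thesis using w p(4) unfolding walk_inv_def visited
    by (simp add: Ball_def) (auto simp: min_def)
qed

text \<open>The last conjunct guarantees that the push around the cycle breaks it: either the path from \<open>v\<close> to \<open>u\<close> has
  already been cut, or the inserted edge is saturated, or an edge that attains the bottleneck \<open>d\<close> is still ahead.\<close>

definition push_inv ::
  "nat set \<Rightarrow> (nat \<Rightarrow> int) \<Rightarrow> (nat \<Rightarrow> nat) \<Rightarrow> nat \<Rightarrow> nat \<Rightarrow> nat \<Rightarrow> bool \<Rightarrow>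
   (nat \<Rightarrow> nat) \<Rightarrow> (nat \<Rightarrow> nat) \<Rightarrow> nat \<Rightarrow> bool" where
  "push_inv A b val0 d u v tight par val x \<longleftrightarrow>
     forest par (fractional val A) \<and> par u = 0 \<and> x \<in> V \<and> (x, u) \<in> (up par)\<^sup>* \<and>
     (\<forall>g\<in>E. val g \<le> M) \<and> (\<forall>g. g \<notin> fractional val0 A \<longrightarrow> val g = val0 g) \<and>
     (\<forall>z. balance val z = b z + int d * (of_bool (z = u) - of_bool (z = x))) \<and>
     (\<forall>z\<in>(up par)\<^sup>* `` {x} - {u}. d \<le> room par val z) \<and>
     ((v, u) \<notin> (up par)\<^sup>* \<or>
      (v, x) \<in> (up par)\<^sup>* \<and> (tight \<or> (\<exists>z\<in>(up par)\<^sup>* `` {x} - {u}. room par val z = d)))"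

text \<open>One step carries an excess of \<open>d\<close> units from \<open>x\<close> to its
  parent. An edge that becomes integral is dropped at once, which is harmless because the pointers
  ahead of \<open>x\<close> do not depend on that of \<open>x\<close>.\<close>

lemma push_step:
  assumes inv: "push_inv A b val0 d u v tight par val x" and xu: "x \<noteq> u"
  defines "g \<equiv> par x"
  defines "val' \<equiv> val(g := if tl g = x then val g + d else val g - d)"
  defines "par' \<equiv> if val' g = 0 \<or> val' g = M then par(x := 0) else par"
  shows "g \<noteq> 0" "push_inv A b val0 d u v tight par' val' (other g x)"
    "card ((up par')\<^sup>* `` {other g x}) < card ((up par)\<^sup>* `` {x})"
proof -
  let ?R = "up par" and ?y = "other g x"
  have f: "forest par (fractional val A)" and u: "par u = 0" and x: "x \<in> V" "(x, u) \<in> ?R\<^sup>*"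
    and le: "\<forall>g\<in>E. val g \<le> M" and v0: "\<forall>g. g \<notin> fractional val0 A \<longrightarrow> val g = val0 g"
    and bal: "\<forall>z. balance val z = b z + int d * (of_bool (z = u) - of_bool (z = x))"
    and rm: "\<forall>z\<in>?R\<^sup>* `` {x} - {u}. d \<le> room par val z"
    and tight: "(v, u) \<notin> ?R\<^sup>* \<or>
      (v, x) \<in> ?R\<^sup>* \<and> (tight \<or> (\<exists>z\<in>?R\<^sup>* `` {x} - {u}. room par val z = d))"
    using inv by (auto simp: push_inv_def)
  have g0: "par x \<noteq> 0"
  proof
    assume "par x = 0"
    then have "x \<notin> Domain ?R" by (simp add: Domain_up)
    from Not_Domain_rtrancl[OF this] show False using x(2) xu by simp
  qed
  then show "g \<noteq> 0" by (simp add: g_def)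
  note p = forestD[OF f x(1) g0, folded g_def]
  note ac = forest_acyclic[OF f]
  have st: "?R\<^sup>* `` {x} = insert x (?R\<^sup>* `` {?y})" "x \<notin> ?R\<^sup>* `` {?y}"
    using reachable_step[OF single_valued_up ac p(6)] by auto
  have rx: "d \<le> room par val x" using rm xu by auto
  have frac: "0 < val g" "val g < M" "g \<in> A" using p(1) by (auto simp: fractional_def)
  have sub: "up par' \<subseteq> ?R" unfolding par'_def using up_cut by auto
  then have subs: "(up par')\<^sup>* \<subseteq> ?R\<^sup>*" by (rule rtrancl_mono)
  have reach: "(up par')\<^sup>* `` {?y} = ?R\<^sup>* `` {?y}"
    unfolding par'_def using reachable_avoid[OF ac p(6)] by (auto simp: up_cut)
  have yu: "(?y, u) \<in> ?R\<^sup>*" using st(1) x(2) xu by auto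
  have le': "val' g \<le> M" using rx frac by (auto simp: val'_def room_def g_def)
  have forest': "forest par' (fractional val' A)"
  proof (cases "val' g = 0 \<or> val' g = M")
    case True
    then have "fractional val' A = fractional val A - {g}"
      by (auto simp: fractional_def val'_def)
    then show ?thesis using True forest_cut[OF f x(1)] by (simp add: par'_def g_def)
  next
    case False
    then have "fractional val' A = fractional val A"
      using frac le' by (auto simp: fractional_def val'_def)
    then show ?thesis using False f by (simp add: par'_def)
  qed
  have bal': "balance val' z = b z + int d * (of_bool (z = u) - of_bool (z = ?y))" for z
  proof (cases "tl g = x")
    case True
    then have "?y = hd g" by auto
    then show ?thesis using True spec[OF bal, of z] balance_update[OF p(2), of val "val g + d" z] ends[OF p(2)]
      by (auto simp: val'_def algebra_simps)
  next
    case False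
    then have "x = hd g" "d \<le> val g" using p(3) rx by (auto simp: room_def g_def)
    moreover from this have "?y = tl g" using other_hd by metis
    ultimately have "x = hd g" "?y = tl g" "d \<le> val g" by auto
    then show ?thesis using False spec[OF bal, of z] balance_update[OF p(2), of val "val g - d" z] ends[OF p(2)]
      by (auto simp: val'_def algebra_simps of_nat_diff)
  qed
  \<comment> \<open>Distinct nodes have distinct parent edges, so the new value of \<open>g\<close>
    leaves the rooms ahead as they were.\<close>
  have room': "room par' val' z = room par val z" if "(?y, z) \<in> ?R\<^sup>*" "z \<noteq> u" for z
  proof -
    have zx: "z \<noteq> x" using st(2) that by auto
    moreover have "z \<in> V" using reachable_subset[OF f p(4)] that by blast
    ultimately have "par z \<noteq> g" using p(7) by blast
    then show ?thesis using zx by (simp add: room_def par'_def val'_def)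
  qed
  have tight': "(v, u) \<notin> (up par')\<^sup>* \<or> (v, ?y) \<in> (up par')\<^sup>* \<and>
      (tight \<or> (\<exists>z\<in>(up par')\<^sup>* `` {?y} - {u}. room par' val' z = d))"
  proof (cases "(v, u) \<in> ?R\<^sup>*")
    case True
    then have t: "(v, x) \<in> ?R\<^sup>*" "tight \<or> (\<exists>z\<in>?R\<^sup>* `` {x} - {u}. room par val z = d)"
      using tight by auto
    show ?thesis
    proof (cases "val' g = 0 \<or> val' g = M")
      \<comment> \<open>The dropped edge lies on the path from \<open>v\<close> to \<open>u\<close>,
        so the two are now separated.\<close>
      case cut: True
      have "u \<notin> Domain ?R" using u by (simp add: Domain_up)
      then show ?thesis
        using cut_disconnects[OF single_valued_up t(1) _ xu[symmetric]] cut
        by (simp add: par'_def up_cut)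
    next
      case False
      \<comment> \<open>Had the room at \<open>x\<close> been \<open>d\<close>, the edge would be
        integral now; so the bottleneck is still ahead.\<close>
      have "room par val x \<noteq> d" using False frac by (auto simp: room_def val'_def g_def split: if_splits)
      then have "tight \<or> (\<exists>z\<in>?R\<^sup>* `` {?y} - {u}. room par val z = d)" using t(2) st(1) by auto
      then have "tight \<or> (\<exists>z\<in>(up par')\<^sup>* `` {?y} - {u}. room par' val' z = d)"
        using reach room' by auto
      moreover have "(v, ?y) \<in> (up par')\<^sup>*"
        using False t(1) p(6) by (auto simp: par'_def intro: rtrancl_into_rtrancl)
      ultimately show ?thesis by blast
    qed
  qed (use subs in blast)
  have "g \<in> fractional val0 A"
    using v0 frac by (metis (no_types, lifting) fractional_def mem_Collect_eq)
  then have "\<forall>g. g \<notin> fractional val0 A \<longrightarrow> val' g = val0 g" using v0 by (auto simp: val'_def)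
  moreover have "par' u = 0" using u by (simp add: par'_def)
  moreover have "(?y, u) \<in> (up par')\<^sup>*" using yu reach by blast
  moreover have "\<forall>k\<in>E. val' k \<le> M" using le le' by (auto simp: val'_def split: if_splits)
  moreover have "\<forall>z\<in>(up par')\<^sup>* `` {?y} - {u}. d \<le> room par' val' z"
    unfolding reach using rm room' st(1) by simp
  ultimately show "push_inv A b val0 d u v tight par' val' ?y"
    using forest' p(4) bal' tight' unfolding push_inv_def by blast
  have "finite (?R\<^sup>* `` {x})" using reachable_subset[OF f x(1)] finite_V finite_subset by auto
  then show "card ((up par')\<^sup>* `` {?y}) < card (?R\<^sup>* `` {x})"
    unfolding reach using st by (intro psubset_card_mono) auto
qed

end


section \<open>Inserting an edge\<close>

definition goto_other :: com where
  "goto_other = ''x'' ::= NSub (NAdd (NCell ''tail'' (var ''g'')) (NCell ''head'' (var ''g''))) (var ''x'')"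

definition reroot_body :: com where
  "reroot_body =
     goto_other ;;
     ''t'' ::= NCell ''par'' (var ''x'') ;;
     NAssign ''par'' (var ''x'') (var ''g'') ;;
     ''g'' ::= var ''t''"

definition reroot :: com where
  "reroot =
     ''u'' ::= NCell ''tail'' (var ''e'') ;;
     ''x'' ::= var ''u'' ;;
     ''g'' ::= NCell ''par'' (var ''x'') ;;
     NAssign ''par'' (var ''x'') (NLit 0) ;;
     While (Neg (NLe (var ''g'') (NLit 0))) reroot_body"

definition walk_body :: com where
  "walk_body =
     ''g'' ::= NCell ''par'' (var ''x'') ;;
     Cond (Equal (NCell ''tail'' (var ''g'')) (var ''x''))
       (''r'' ::= NSub (var ''modulus'') (NCell ''val'' (var ''g'')))
       (''r'' ::= NCell ''val'' (var ''g'')) ;;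
     Cond (NLe (var ''d'') (var ''r'')) Skip (''d'' ::= var ''r'') ;;
     goto_other"

definition walk :: com where
  "walk =
     ''x'' ::= NCell ''head'' (var ''e'') ;;
     ''d'' ::= NSub (var ''modulus'') (NCell ''val'' (var ''e'')) ;;
     While (Conj (Neg (Equal (var ''x'') (var ''u''))) (Neg (NLe (NCell ''par'' (var ''x'')) (NLit 0)))) walk_body"

definition push_body :: com where
  "push_body =
     ''g'' ::= NCell ''par'' (var ''x'') ;;
     Cond (Equal (NCell ''tail'' (var ''g'')) (var ''x''))
       (NAssign ''val'' (var ''g'') (NAdd (NCell ''val'' (var ''g'')) (var ''d'')))
       (NAssign ''val'' (var ''g'') (NSub (NCell ''val'' (var ''g'')) (var ''d''))) ;;
     Cond (Conj (Neg (NLe (NCell ''val'' (var ''g'')) (NLit 0)))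
                (Neg (NLe (var ''modulus'') (NCell ''val'' (var ''g'')))))
       Skip (NAssign ''par'' (var ''x'') (NLit 0)) ;;
     goto_other"

definition push :: com where
  "push =
     NAssign ''val'' (var ''e'') (NAdd (NCell ''val'' (var ''e'')) (var ''d'')) ;;
     ''x'' ::= NCell ''head'' (var ''e'') ;;
     While (Neg (Equal (var ''x'') (var ''u''))) push_body"

text \<open>Rerooting at the tail \<open>u\<close> of the new edge \<open>e\<close> serves twice: a
  cycle closed by \<open>e\<close> consists of \<open>e\<close> and the pointer path from its head
  to \<open>u\<close>, and the empty pointer of \<open>u\<close> is a place where \<open>e\<close>
  itself can be stored. The flow on \<open>e\<close> is only ever increased, so \<open>e\<close>
  becomes integral exactly when it reaches the modulus.\<close>

definition insert_edge :: com where
  "insert_edge =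
     reroot ;; walk ;;
     Cond (Equal (var ''x'') (var ''u'')) push Skip ;;
     Cond (NLe (var ''modulus'') (NCell ''val'' (var ''e''))) Skip (NAssign ''par'' (var ''u'') (var ''e''))"

lemma writes_insert_edge:
  "writes insert_edge = {''u'', ''x'', ''g'', ''t'', ''par'', ''d'', ''r'', ''val''}" "rwrites insert_edge = {}"
  by (auto simp: insert_edge_def reroot_def walk_def push_def reroot_body_def walk_body_def push_body_def goto_other_def)

context network
begin

definition loaded :: "state \<Rightarrow> bool" where
  "loaded s \<longleftrightarrow> nmem s ''tail'' = tl \<and> nmem s ''head'' = hd \<and> nmem s ''modulus'' 0 = M"

lemma loaded_unchanged:
  "loaded s \<Longrightarrow> unchanged c s s' \<Longrightarrow> writes c \<inter> {''tail'', ''head'', ''modulus''} = {} \<Longrightarrow> loaded s'"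
  unfolding loaded_def unchanged_def by auto

lemma wp_reroot:
  assumes ld: "loaded s" and e: "e \<in> E" "nmem s ''e'' 0 = e" and f: "forest (nmem s ''par'') F"
  shows "wp reroot s (\<lambda>t s'. t \<le> 5 * card V + 5 \<and> forest (nmem s' ''par'') F \<and>
    nmem s' ''par'' (tl e) = 0 \<and> nmem s' ''u'' 0 = tl e)"
proof -
  let ?u = "tl e"
  define s1 where "s1 = nupdate ''par'' ?u 0 (nupdate ''g'' 0 (nmem s ''par'' ?u)
    (nupdate ''x'' 0 ?u (nupdate ''u'' 0 ?u s)))"
  let ?J = "\<lambda>s'. reroot_inv F ?u (nmem s' ''par'') (nmem s' ''x'' 0) (nmem s' ''g'' 0)"
  let ?\<mu> = "\<lambda>s'. reroot_measure (nmem s' ''par'') (nmem s' ''x'' 0) (nmem s' ''g'' 0)"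
  have ld1: "loaded s1" using ld by (auto simp: s1_def loaded_def)
  have start: "?J s1" using reroot_start[OF f, of ?u] ends[OF e(1)] by (simp add: s1_def)
  have "wp (While (Neg (NLe (var ''g'') (NLit 0))) reroot_body) s1
    (\<lambda>t s'. t \<le> (4 + 1) * ?\<mu> s1 + 1 \<and> ?J s' \<and> \<not> bval (Neg (NLe (var ''g'') (NLit 0))) s')"
  proof (rule wp_While_measure)
    fix s' assume u: "unchanged reroot_body s1 s'" and J: "?J s'" and "bval (Neg (NLe (var ''g'') (NLit 0))) s'"
    then have g: "nmem s' ''g'' 0 \<noteq> 0" by simp
    have "loaded s'" using loaded_unchanged[OF ld1 u] by (simp add: reroot_body_def goto_other_def)
    then show "wp reroot_body s' (\<lambda>t s''. t \<le> 4 \<and> ?J s'' \<and> ?\<mu> s'' < ?\<mu> s')"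
      using reroot_step[OF J g] by (simp add: reroot_body_def goto_other_def loaded_def other_def)
  qed (rule start)
  then have "wp (While (Neg (NLe (var ''g'') (NLit 0))) reroot_body) s1
    (\<lambda>t s'. t + 4 \<le> 5 * card V + 5 \<and> forest (nmem s' ''par'') F \<and>
    nmem s' ''par'' (tl e) = 0 \<and> nmem s' ''u'' 0 = tl e)"
  proof (rule wp_mono, goal_cases)
    case (1 t s')
    have "nmem s' ''u'' = nmem s1 ''u''" using 1(1) by (simp add: unchanged_def reroot_body_def goto_other_def)
    then show ?case
      using 1(2) reroot_measure_le[OF start] by (simp add: reroot_inv_def s1_def)
  qed
  then show ?thesis
    unfolding reroot_def using ld e
    by (simp add: s1_def loaded_def add.commute)
qed

lemma wp_walk:
  assumes ld: "loaded s" and e: "e \<in> E" "nmem s ''e'' 0 = e" and f: "forest (nmem s ''par'') (fractional (nmem s ''val'') A)"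
    and u: "u \<in> V" "nmem s ''par'' u = 0" "nmem s ''u'' 0 = u" and ve: "nmem s ''val'' e < M"
  shows "wp walk s (\<lambda>t s'. t \<le> 7 * card V + 3 \<and>
    (if nmem s' ''x'' 0 = u then walk_inv (nmem s ''par'') (nmem s ''val'') (hd e) (M - nmem s ''val'' e) u (nmem s' ''d'' 0)
     else (hd e, u) \<notin> (up (nmem s ''par''))\<^sup>*))"
proof -
  let ?par = "nmem s ''par''" and ?val = "nmem s ''val''" and ?d0 = "M - nmem s ''val'' e"
  define s1 where "s1 = nupdate ''d'' 0 ?d0 (nupdate ''x'' 0 (hd e) s)"
  define b where "b = Conj (Neg (Equal (var ''x'') (var ''u''))) (Neg (NLe (NCell ''par'' (var ''x'')) (NLit 0)))"
  let ?J = "\<lambda>s'. walk_inv ?par ?val (hd e) ?d0 (nmem s' ''x'' 0) (nmem s' ''d'' 0)"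
  let ?\<mu> = "\<lambda>s'. card ((up ?par)\<^sup>* `` {nmem s' ''x'' 0})"
  have ld1: "loaded s1" using ld by (auto simp: s1_def loaded_def)
  have start: "?J s1" using ends[OF e(1)] ve by (simp add: s1_def walk_inv_def)
  have "wp (While b walk_body) s1 (\<lambda>t s'. t \<le> (6 + 1) * ?\<mu> s1 + 1 \<and> ?J s' \<and> \<not> bval b s')"
  proof (rule wp_While_measure)
    fix s' assume un: "unchanged walk_body s1 s'" and J: "?J s'" and "bval b s'"
    moreover have [simp]: "nmem s' ''par'' = ?par" "nmem s' ''val'' = ?val" "nmem s' ''u'' = nmem s ''u''"
      using un by (auto simp: unchanged_def walk_body_def goto_other_def s1_def)
    ultimately have x: "?par (nmem s' ''x'' 0) \<noteq> 0" by (simp add: b_def)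
    have "loaded s'" using loaded_unchanged[OF ld1 un] by (simp add: walk_body_def goto_other_def)
    moreover have "nmem s' ''x'' 0 \<in> V" using J by (simp add: walk_inv_def)
    ultimately show "wp walk_body s' (\<lambda>t s''. t \<le> 6 \<and> ?J s'' \<and> ?\<mu> s'' < ?\<mu> s')"
      using walk_step[OF f J x] climb_measure[OF f _ x] forestD(3)[OF f _ x]
      by (auto simp: walk_body_def goto_other_def loaded_def other_def room_def min_def)
  qed (rule start)
  then have "wp (While b walk_body) s1 (\<lambda>t s'. t + 2 \<le> 7 * card V + 3 \<and>
    (if nmem s' ''x'' 0 = u then walk_inv ?par ?val (hd e) ?d0 u (nmem s' ''d'' 0)
     else (hd e, u) \<notin> (up ?par)\<^sup>*))"
  proof (rule wp_mono, goal_cases)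
    case (1 t s')
    note un = 1(1) and a = 1(2)
    have eq: "nmem s' ''u'' = nmem s ''u''" "nmem s' ''par'' = ?par"
      using un by (simp_all add: unchanged_def walk_body_def goto_other_def s1_def)
    have "?\<mu> s1 \<le> card V"
      using reachable_subset[OF f] ends[OF e(1)] finite_V by (intro card_mono) (auto simp: s1_def)
    \<comment> \<open>The walk stopped at another root. A node leads to only one root, so
      \<open>u\<close> is not reachable from the head of \<open>e\<close>.\<close>
    moreover have "(hd e, u) \<notin> (up ?par)\<^sup>*" if "nmem s' ''x'' 0 \<noteq> u"
    proof
      assume hu: "(hd e, u) \<in> (up ?par)\<^sup>*"
      have "?par (nmem s' ''x'' 0) = 0" using a that eq u by (auto simp: b_def)
      then have "nmem s' ''x'' 0 \<notin> Domain (up ?par)" "u \<notin> Domain (up ?par)"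
        using u(2) by (auto simp: Domain_up)
      then show False
        using single_valued_root_unique[OF single_valued_up _ hu, of "nmem s' ''x'' 0"] a that
        by (auto simp: walk_inv_def)
    qed
    ultimately show ?case
      using a by auto
  qed
  then show ?thesis
    unfolding walk_def b_def[symmetric] using ld e
    by (simp add: s1_def loaded_def add.commute)
qed

text \<open>Once \<open>e\<close> has taken its \<open>d\<close> units, there is an excess of
  \<open>d\<close> at its head and a deficit at its tail. The rooms on the path are unchanged
  because \<open>e\<close> is not yet an edge of the forest.\<close>

lemma push_start:
  assumes e: "e \<in> E" "e \<notin> A" and f: "forest par (fractional val A)" and u: "par (tl e) = 0"
    and w: "walk_inv par val (hd e) (M - val e) (tl e) d" and le: "\<forall>g\<in>E. val g \<le> M"
    and bal: "\<forall>z. balance val z = b z"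
  defines "val1 \<equiv> val(e := val e + d)"
  shows "push_inv A b val1 d (tl e) (hd e) (val1 e = M) par val1 (hd e)"
proof -
  let ?R = "up par" and ?u = "tl e"
  have frac: "fractional val1 A = fractional val A" using e by (auto simp: fractional_def val1_def)
  have "?u \<notin> Domain ?R" using u by (simp add: Domain_up)
  from Not_Domain_rtrancl[OF this] have Ru: "?R\<^sup>* `` {?u} = {?u}" by auto
  have vu: "(hd e, ?u) \<in> ?R\<^sup>*" and d: "d \<le> M - val e"
    and rm: "\<forall>z\<in>?R\<^sup>* `` {hd e} - {?u}. d \<le> room par val z"
    and ti: "d = M - val e \<or> (\<exists>z\<in>?R\<^sup>* `` {hd e} - {?u}. room par val z = d)"
    using w unfolding walk_inv_def Ru by auto
  have V: "?R\<^sup>* `` {hd e} \<subseteq> V" using reachable_subset[OF f] ends[OF e(1)] by blast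
  have "e \<noteq> par z" if "z \<in> V" for z
  proof
    assume z: "e = par z"
    then have "par z \<noteq> 0" using e(1) zero_notin_E by metis
    then have "e \<in> fractional val A" using forestD(1)[OF f that] z by simp
    then show False using e(2) by (simp add: fractional_def)
  qed
  then have room: "room par val1 z = room par val z" if "z \<in> ?R\<^sup>* `` {hd e}" for z
    using that V by (auto simp: room_def val1_def)
  have "\<forall>z\<in>?R\<^sup>* `` {hd e} - {?u}. d \<le> room par val1 z" using rm room by simp
  moreover have "val1 e = M \<or> (\<exists>z\<in>?R\<^sup>* `` {hd e} - {?u}. room par val1 z = d)"
    using ti room le e(1) by (auto simp: val1_def)
  moreover have "balance val1 z = b z + int d * (of_bool (z = ?u) - of_bool (z = hd e))" for z
    using balance_update[OF e(1), of val "val e + d" z] bal by (auto simp: val1_def)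
  moreover have "\<forall>g\<in>E. val1 g \<le> M" using le d e(1) by (auto simp: val1_def)
  ultimately show ?thesis
    using f u vu ends[OF e(1)] unfolding push_inv_def frac by auto
qed

lemma wp_push:
  assumes ld: "loaded s" and e: "e \<in> E" "e \<notin> A" "nmem s ''e'' 0 = e" and f: "forest (nmem s ''par'') (fractional (nmem s ''val'') A)"
    and u: "nmem s ''par'' (tl e) = 0" "nmem s ''u'' 0 = tl e"
    and w: "walk_inv (nmem s ''par'') (nmem s ''val'') (hd e) (M - nmem s ''val'' e) (tl e) (nmem s ''d'' 0)"
    and le: "\<forall>g\<in>E. nmem s ''val'' g \<le> M"
    and bal: "\<forall>z. balance (nmem s ''val'') z = b z"
  shows "wp push s (\<lambda>t s'. t \<le> 7 * card V + 3 \<and>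
    forest (nmem s' ''par'') (fractional (nmem s' ''val'') A) \<and> nmem s' ''par'' (tl e) = 0 \<and>
    (\<forall>g\<in>E. nmem s' ''val'' g \<le> M) \<and> (\<forall>z. balance (nmem s' ''val'') z = b z) \<and>
    (\<forall>g. g \<notin> fractional (nmem s ''val'') A \<longrightarrow> g \<noteq> e \<longrightarrow> nmem s' ''val'' g = nmem s ''val'' g) \<and>
    nmem s ''val'' e \<le> nmem s' ''val'' e \<and>
    ((hd e, tl e) \<notin> (up (nmem s' ''par''))\<^sup>* \<or> nmem s' ''val'' e = M))"
    (is "wp _ _ (\<lambda>t s'. t \<le> _ \<and> ?Q s')")
proof -
  let ?u = "tl e" and ?d = "nmem s ''d'' 0"
  let ?val1 = "(nmem s ''val'')(e := nmem s ''val'' e + ?d)"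
  define s1 where "s1 = nupdate ''x'' 0 (hd e) (nupdate ''val'' e (nmem s ''val'' e + ?d) s)"
  define c where "c = Neg (Equal (var ''x'') (var ''u''))"
  let ?J = "\<lambda>s'. push_inv A b ?val1 ?d ?u (hd e) (?val1 e = M) (nmem s' ''par'') (nmem s' ''val'') (nmem s' ''x'' 0)"
  let ?\<mu> = "\<lambda>s'. card ((up (nmem s' ''par''))\<^sup>* `` {nmem s' ''x'' 0})"
  have ld1: "loaded s1" using ld by (auto simp: s1_def loaded_def)
  have start: "?J s1" using push_start[OF e(1,2) f u(1) w le bal] by (simp add: s1_def)
  have "wp (While c push_body) s1 (\<lambda>t s'. t \<le> (6 + 1) * ?\<mu> s1 + 1 \<and> ?J s' \<and> \<not> bval c s')"
  proof (rule wp_While_measure)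
    fix s' assume un: "unchanged push_body s1 s'" and J: "?J s'" and c: "bval c s'"
    have eq: "nmem s' ''u'' = nmem s ''u''" "nmem s' ''d'' = nmem s ''d''"
      using un by (auto simp: unchanged_def push_body_def goto_other_def s1_def)
    have xu: "nmem s' ''x'' 0 \<noteq> ?u" using c u eq by (auto simp: c_def)
    have ld': "loaded s'" using loaded_unchanged[OF ld1 un] by (simp add: push_body_def goto_other_def)
    let ?x = "nmem s' ''x'' 0"
    let ?g = "nmem s' ''par'' ?x"
    let ?v = "if tl ?g = ?x then nmem s' ''val'' ?g + ?d else nmem s' ''val'' ?g - ?d"
    \<comment> \<open>The program compares the new value with \<open>M\<close> by an inequality,
      \<open>push_step\<close> by an equation. This bound, read off the invariant after the step,
      reconciles the two.\<close>
    have v: "?v \<le> M"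
      using push_step(2)[OF J xu] push_step(1)[OF J xu] J forestD(2)[of "nmem s' ''par''" _ ?x]
      unfolding push_inv_def by (metis fun_upd_same)
    note ps = push_step(2,3)[OF J xu]
    show "wp push_body s' (\<lambda>t s''. t \<le> 6 \<and> ?J s'' \<and> ?\<mu> s'' < ?\<mu> s')"
    proof (cases "?v = 0 \<or> ?v = M")
      case True
      then show ?thesis
        using ps ld' eq by (cases "tl ?g = ?x") (auto simp: push_body_def goto_other_def loaded_def other_def)
    next
      case False
      then have F: "(?v = 0 \<or> ?v = M) = False" and "0 < ?v" "?v < M" using v by auto
      then show ?thesis
        using ps[unfolded fun_upd_same F if_False] ld' eq by (cases "tl ?g = ?x") (auto simp: push_body_def goto_other_def loaded_def other_def)
    qed
  qed (rule start)
  then have "wp (While c push_body) s1 (\<lambda>t s'. t + 2 \<le> 7 * card V + 3 \<and>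
    ?Q s')"
  proof (rule wp_mono, goal_cases)
    case (1 t s')
    note un = 1(1) and a = 1(2)
    have "?\<mu> s1 \<le> card V"
      using reachable_subset[OF f] ends[OF e(1)] finite_V by (intro card_mono) (auto simp: s1_def)
    moreover have "nmem s' ''x'' 0 = ?u"
      using a un u by (auto simp: unchanged_def push_body_def goto_other_def s1_def c_def)
    moreover have "fractional ?val1 A = fractional (nmem s ''val'') A"
      using e(2) by (auto simp: fractional_def)
    moreover have "nmem s' ''val'' e = ?val1 e"
      using a e(2) unfolding push_inv_def fractional_def by blast
    moreover have "(up (nmem s' ''par''))\<^sup>* `` {?u} = {?u}"
    proof -
      have "?u \<notin> Domain (up (nmem s' ''par''))" using a by (simp add: Domain_up push_inv_def)
      from Not_Domain_rtrancl[OF this] show ?thesis by auto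
    qed
    ultimately show ?case
      using a unfolding push_inv_def by auto
  qed
  then show ?thesis
    unfolding push_def c_def[symmetric] using ld e
    by (simp add: s1_def loaded_def add.commute)
qed

text \<open>\<open>A\<close> is the set of edges inserted so far; edges outside \<open>A\<close> may
  be fractional without appearing in the forest.\<close>

definition rounding_inv :: "nat set \<Rightarrow> (nat \<Rightarrow> int) \<Rightarrow> state \<Rightarrow> bool" where
  "rounding_inv A b s \<longleftrightarrow> A \<subseteq> E \<and> forest (nmem s ''par'') (fractional (nmem s ''val'') A) \<and>
     (\<forall>g\<in>E. nmem s ''val'' g \<le> M) \<and> (\<forall>z. balance (nmem s ''val'') z = b z)"

text \<open>The last conjunct serves two purposes: product edges still to come keep their fractional
  value, and star edges that carry 0 keep it, on which the strictness of the rounding bounds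
  rests.\<close>

lemma wp_insert_edge:
  assumes ld: "loaded s" and e: "e \<in> E" "e \<notin> A" "nmem s ''e'' 0 = e" and r: "rounding_inv A b s"
    and ve: "0 < nmem s ''val'' e" "nmem s ''val'' e < M"
  shows "wp insert_edge s (\<lambda>t s'. t \<le> 19 * card V + 15 \<and> rounding_inv (insert e A) b s' \<and>
    (\<forall>g. g \<notin> fractional (nmem s ''val'') A \<longrightarrow> g \<noteq> e \<longrightarrow> nmem s' ''val'' g = nmem s ''val'' g))"
    (is "wp _ _ ?Q")
proof -
  let ?val = "nmem s ''val''"
  have f: "forest (nmem s ''par'') (fractional ?val A)" and A: "A \<subseteq> E" and le: "\<forall>g\<in>E. ?val g \<le> M"
    and bal: "\<forall>z. balance ?val z = b z"
    using r by (auto simp: rounding_inv_def)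
  have u: "tl e \<in> V" "hd e \<in> V" using ends[OF e(1)] by auto
  let ?rest = "Cond (Equal (var ''x'') (var ''u'')) push Skip"
  define add where "add = Cond (NLe (var ''modulus'') (NCell ''val'' (var ''e''))) Skip (NAssign ''par'' (var ''u'') (var ''e''))"
  \<comment> \<open>The common end of both branches. Either \<open>e\<close> has reached
    \<open>M\<close> and stays outside the forest, or its head does not lead to \<open>u\<close>,
    because there was no cycle or because the cycle was broken elsewhere; then \<open>e\<close> can
    be linked at \<open>u\<close>.\<close>
  have finish: "wp add s' (\<lambda>t s''. t \<le> 2 \<and> rounding_inv (insert e A) b s'' \<and>
        nmem s'' ''val'' = nmem s' ''val'')"
    if "loaded s'" "nmem s' ''e'' 0 = e" "nmem s' ''u'' 0 = tl e"
      "forest (nmem s' ''par'') (fractional (nmem s' ''val'') A)" "nmem s' ''par'' (tl e) = 0"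
      "\<forall>g\<in>E. nmem s' ''val'' g \<le> M" "\<forall>z. balance (nmem s' ''val'') z = b z"
      "0 < nmem s' ''val'' e" "(hd e, tl e) \<notin> (up (nmem s' ''par''))\<^sup>* \<or> nmem s' ''val'' e = M" for s'
  proof (cases "nmem s' ''val'' e = M")
    case True
    then have "fractional (nmem s' ''val'') (insert e A) = fractional (nmem s' ''val'') A"
      by (auto simp: fractional_def)
    then show ?thesis using True that A e by (simp add: rounding_inv_def loaded_def add_def)
  next
    case False
    then have lt: "nmem s' ''val'' e < M" using that(6) e(1) by (simp add: le_neq_implies_less)
    then have "fractional (nmem s' ''val'') (insert e A) = insert e (fractional (nmem s' ''val'') A)"
      using that(8) by (auto simp: fractional_def)
    moreover have "forest ((nmem s' ''par'')(tl e := e)) (insert e (fractional (nmem s' ''val'') A))"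
      using forest_link(1)[OF that(4) u(1) that(5) e(1)] e(2) False that(9) by (simp add: fractional_def)
    ultimately show ?thesis using lt that A e by (simp add: rounding_inv_def loaded_def add_def)
  qed
  have "wp reroot s (\<lambda>t s1. wp (walk ;; ?rest ;;
     add) s1
     (\<lambda>t'. ?Q (t + t')))"
  proof (rule wp_mono[OF wp_reroot[OF ld e(1,3) f]], goal_cases)
    case (1 t1 s1)
    note un1 = 1(1) and a1 = 1(2)
    have ld1: "loaded s1" using loaded_unchanged[OF ld un1] by (simp add: reroot_def reroot_body_def goto_other_def)
    have eq1: "nmem s1 ''e'' 0 = e" "nmem s1 ''val'' = ?val"
      using un1 e by (simp_all add: unchanged_def reroot_def reroot_body_def goto_other_def)
    have w: "wp walk s1 (\<lambda>t s'. t \<le> 7 * card V + 3 \<and>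
      (if nmem s' ''x'' 0 = tl e then walk_inv (nmem s1 ''par'') ?val (hd e) (M - ?val e) (tl e) (nmem s' ''d'' 0)
       else (hd e, tl e) \<notin> (up (nmem s1 ''par''))\<^sup>*))"
      by (rule wp_walk[OF ld1 e(1) eq1(1), of A "tl e", unfolded eq1(2)]) (use a1 u ve in auto)
    show ?case
      unfolding wp_Seq
    proof (rule wp_mono[OF w], goal_cases)
      case (1 t2 s2)
      note un2 = 1(1) and a2 = 1(2)
      have ld2: "loaded s2" using loaded_unchanged[OF ld1 un2] by (simp add: walk_def walk_body_def goto_other_def)
      have eq2: "nmem s2 ''e'' 0 = e" "nmem s2 ''val'' = ?val" "nmem s2 ''par'' = nmem s1 ''par''" "nmem s2 ''u'' 0 = tl e"
        using un2 eq1 a1 by (simp_all add: unchanged_def walk_def walk_body_def goto_other_def)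
      show ?case
      proof (cases "nmem s2 ''x'' 0 = tl e")
        case True
        then have "walk_inv (nmem s2 ''par'') (nmem s2 ''val'') (hd e) (M - nmem s2 ''val'' e) (tl e) (nmem s2 ''d'' 0)"
          using a2 eq2 by simp
        note p = wp_push[OF ld2 e(1,2) eq2(1) _ _ eq2(4) this, of b]
        have "wp push s2 (\<lambda>t s'. wp add s'
          (\<lambda>t'. ?Q (t1 + (t2 + (Suc t + t')))))"
        proof (rule wp_mono[OF p], goal_cases)
          case (5 t3 s3)
          have ld3: "loaded s3" using loaded_unchanged[OF ld2 5(1)] by (simp add: push_def push_body_def goto_other_def)
          have eq3: "nmem s3 ''e'' 0 = e" "nmem s3 ''u'' 0 = tl e"
            using 5(1) eq2 by (simp_all add: unchanged_def push_def push_body_def goto_other_def)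
          have "0 < nmem s3 ''val'' e" using 5(2) eq2 ve by simp
          then show ?case
            by (intro wp_mono[OF finish[OF ld3 eq3]]) (use 5(2) a1 a2 eq2 in auto)
        qed (use a1 eq2 le bal in auto)
        then show ?thesis using True eq2 by simp
      next
        case False
        have "wp add s2
          (\<lambda>t'. ?Q (t1 + (t2 + (Suc 1 + t'))))"
          by (rule wp_mono[OF finish[OF ld2 eq2(1,4)]])
            (use a1 a2 eq2 False le bal ve in \<open>auto split: if_splits\<close>)
        then show ?thesis using False eq2 by simp
      qed
    qed
  qed
  then show ?thesis unfolding insert_edge_def add_def wp_Seq .
qed

end


section \<open>The network of a block of products\<close>

definition fibre :: "('a \<Rightarrow> 'b) \<Rightarrow> 'a set \<Rightarrow> 'b \<Rightarrow> nat" where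
  "fibre f S w = card {p \<in> S. f p = w}"

text \<open>Divided by \<open>M\<close>, each inequality says that a quantity of \<open>S1\<close>
  differs by less than 1 from the fraction \<open>h / M\<close> of the same quantity of
  \<open>S\<close>, so it is that fraction rounded up or down.\<close>

definition rounded ::
  "nat \<Rightarrow> (nat \<Rightarrow> nat) \<Rightarrow> (nat \<Rightarrow> nat) \<Rightarrow> nat \<Rightarrow> nat \<Rightarrow> nat set \<Rightarrow> nat set \<Rightarrow> bool" where
  "rounded n src snk M h S S1 \<longleftrightarrow> S1 \<subseteq> S \<and> (\<forall>w<n.
     \<bar>int M * int (fibre src S1 w) - int h * int (fibre src S w)\<bar> < int M \<and>
     \<bar>int M * int (fibre snk S1 w) - int h * int (fibre snk S w)\<bar> < int M \<and>
     \<bar>int M * (int (fibre snk S1 w) - int (fibre src S1 w)) -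
      int h * (int (fibre snk S w) - int (fibre src S w))\<bar> < int M)"

text \<open>Node \<open>0\<close> is the root. Warehouse \<open>w\<close> has the nodes \<open>1 + w\<close>, \<open>1 + n + w\<close> (departures) and \<open>1 + 2n + w\<close>
  (arrivals), and the star edge at each of them has the same number. The star edges carry the numbers of
  departures and of arrivals and their difference, all reduced modulo \<open>1\<close>.\<close>

locale warehouse_network =
  fixes n M h :: nat and S :: "nat set" and src snk tl hd :: "nat \<Rightarrow> nat"
  assumes finite_S: "finite S" and src: "p \<in> S \<Longrightarrow> src p < n" and snk: "p \<in> S \<Longrightarrow> snk p < n"
    and h: "0 < h" "h < M"
    and ends_net: "w < n \<Longrightarrow> tl (1 + w) = 1 + w \<and> hd (1 + w) = 0"
    and ends_out: "w < n \<Longrightarrow> tl (1 + n + w) = 1 + w \<and> hd (1 + n + w) = 1 + n + w"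
    and ends_in: "w < n \<Longrightarrow> tl (1 + 2 * n + w) = 1 + 2 * n + w \<and> hd (1 + 2 * n + w) = 1 + w"
    and ends_product: "p \<in> S \<Longrightarrow> tl (1 + 3 * n + p) = 1 + n + src p \<and> hd (1 + 3 * n + p) = 1 + 2 * n + snk p"
begin

definition stars :: "nat set" where
  "stars = {1..3 * n}"

definition edge :: "nat \<Rightarrow> nat" where
  "edge p = 1 + 3 * n + p"

lemma star_cases:
  assumes "g \<in> stars"
  obtains w where "w < n" "g = 1 + w" | w where "w < n" "g = 1 + n + w" | w where "w < n" "g = 1 + 2 * n + w"
proof -
  have "g - 1 < n \<and> g = 1 + (g - 1) \<or> g - 1 - n < n \<and> g = 1 + n + (g - 1 - n) \<or>
    g - 1 - 2 * n < n \<and> g = 1 + 2 * n + (g - 1 - 2 * n)"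
    using assms by (auto simp: stars_def)
  then show thesis using that by blast
qed

sublocale network "{..3 * n}" "stars \<union> edge ` S" tl hd M
proof
  show "finite (stars \<union> edge ` S)" using finite_S by (simp add: stars_def)
  show "0 \<notin> stars \<union> edge ` S" by (auto simp: stars_def edge_def)
  fix g assume "g \<in> stars \<union> edge ` S"
  then show "tl g \<in> {..3 * n} \<and> hd g \<in> {..3 * n} \<and> tl g \<noteq> hd g"
  proof
    assume "g \<in> stars"
    then show ?thesis by (cases rule: star_cases) (use ends_net ends_out ends_in in auto)
  next
    assume "g \<in> edge ` S"
    then show ?thesis using ends_product src snk by (force simp: edge_def)
  qed
qed simp

lemma sum_edges:
  fixes f :: "nat \<Rightarrow> int"
  shows "(\<Sum>g\<in>stars \<union> edge ` S. f g) =
    (\<Sum>w<n. f (1 + w)) + (\<Sum>w<n. f (1 + n + w)) + (\<Sum>w<n. f (1 + 2 * n + w)) + (\<Sum>p\<in>S. f (edge p))"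
proof -
  have st: "stars = (\<lambda>w. 1 + w) ` {..<n} \<union> (\<lambda>w. 1 + n + w) ` {..<n} \<union> (\<lambda>w. 1 + 2 * n + w) ` {..<n}"
    (is "_ = ?A \<union> ?B \<union> ?C")
  proof
    show "stars \<subseteq> ?A \<union> ?B \<union> ?C"
      by (rule subsetI) (erule star_cases; blast)
    show "?A \<union> ?B \<union> ?C \<subseteq> stars" by (auto simp: stars_def)
  qed
  have "sum f (stars \<union> edge ` S) = sum f stars + sum f (edge ` S)"
    using finite_S by (intro sum.union_disjoint) (auto simp: stars_def edge_def)
  also have "sum f stars = sum f (?A \<union> ?B) + sum f ?C" unfolding st by (intro sum.union_disjoint) auto
  also have "sum f (?A \<union> ?B) = sum f ?A + sum f ?B" by (intro sum.union_disjoint) auto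
  finally show ?thesis
    by (simp add: sum.reindex inj_on_def edge_def o_def)
qed

lemma balance_out:
  assumes w: "w < n"
  shows "balance val (1 + n + w) = (\<Sum>p | p \<in> S \<and> src p = w. int (val (edge p))) - int (val (1 + n + w))"
proof -
  let ?z = "1 + n + w"
  let ?f = "\<lambda>g. int (val g) * (of_bool (tl g = ?z) - of_bool (hd g = ?z))"
  have "(\<Sum>v<n. ?f (1 + v)) = 0" by (intro sum.neutral) (use ends_net in auto)
  moreover have "(\<Sum>v<n. ?f (1 + n + v)) = (\<Sum>v<n. if v = w then - int (val ?z) else 0)"
    by (intro sum.cong) (use ends_out in auto)
  moreover have "(\<Sum>v<n. ?f (1 + 2 * n + v)) = 0" by (intro sum.neutral) (use ends_in w in auto)
  moreover have "(\<Sum>p\<in>S. ?f (edge p)) = (\<Sum>p\<in>S. if src p = w then int (val (edge p)) else 0)"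
    by (intro sum.cong) (use ends_product w in \<open>auto simp: edge_def dest: src snk\<close>)
  moreover have "\<dots> = (\<Sum>p | p \<in> S \<and> src p = w. int (val (edge p)))"
    by (simp add: sum.inter_filter[OF finite_S])
  ultimately show ?thesis unfolding balance_def sum_edges using w by simp
qed

lemma balance_in:
  assumes w: "w < n"
  shows "balance val (1 + 2 * n + w) = int (val (1 + 2 * n + w)) - (\<Sum>p | p \<in> S \<and> snk p = w. int (val (edge p)))"
proof -
  let ?z = "1 + 2 * n + w"
  let ?f = "\<lambda>g. int (val g) * (of_bool (tl g = ?z) - of_bool (hd g = ?z))"
  have "(\<Sum>v<n. ?f (1 + v)) = 0" by (intro sum.neutral) (use ends_net in auto)
  moreover have "(\<Sum>v<n. ?f (1 + 2 * n + v)) = (\<Sum>v<n. if v = w then int (val ?z) else 0)"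
    by (intro sum.cong) (use ends_in in auto)
  moreover have "(\<Sum>v<n. ?f (1 + n + v)) = 0" by (intro sum.neutral) (use ends_out w in auto)
  moreover have "(\<Sum>p\<in>S. ?f (edge p)) = (\<Sum>p\<in>S. - (if snk p = w then int (val (edge p)) else 0))"
    by (intro sum.cong) (use ends_product w in \<open>auto simp: edge_def dest: src snk\<close>)
  moreover have "\<dots> = - (\<Sum>p | p \<in> S \<and> snk p = w. int (val (edge p)))"
    by (simp add: sum.inter_filter[OF finite_S] sum_negf)
  ultimately show ?thesis unfolding balance_def sum_edges using w by simp
qed

lemma balance_net:
  assumes w: "w < n"
  shows "balance val (1 + w) = int (val (1 + w)) + int (val (1 + n + w)) - int (val (1 + 2 * n + w))"
proof -
  let ?z = "1 + w"
  let ?f = "\<lambda>g. int (val g) * (of_bool (tl g = ?z) - of_bool (hd g = ?z))"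
  have "(\<Sum>v<n. ?f (1 + v)) = (\<Sum>v<n. if v = w then int (val (1 + w)) else 0)"
    by (intro sum.cong) (use ends_net in auto)
  moreover have "(\<Sum>v<n. ?f (1 + n + v)) = (\<Sum>v<n. if v = w then int (val (1 + n + w)) else 0)"
    by (intro sum.cong) (use ends_out w in auto)
  moreover have "(\<Sum>v<n. ?f (1 + 2 * n + v)) = (\<Sum>v<n. if v = w then - int (val (1 + 2 * n + w)) else 0)"
    by (intro sum.cong) (use ends_in w in auto)
  moreover have "(\<Sum>p\<in>S. ?f (edge p)) = 0"
    by (intro sum.neutral) (use ends_product w in \<open>auto simp: edge_def\<close>)
  ultimately show ?thesis unfolding balance_def sum_edges using w by simp
qed

lemma balance_root: "balance val 0 = - (\<Sum>w<n. int (val (1 + w)))"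
proof -
  let ?f = "\<lambda>g. int (val g) * (of_bool (tl g = 0) - of_bool (hd g = 0))"
  have "(\<Sum>v<n. ?f (1 + v)) = (\<Sum>v<n. - int (val (1 + v)))"
    by (intro sum.cong) (use ends_net in auto)
  moreover have "(\<Sum>v<n. ?f (1 + n + v)) = 0"
    by (intro sum.neutral) (use ends_out in auto)
  moreover have "(\<Sum>v<n. ?f (1 + 2 * n + v)) = 0"
    by (intro sum.neutral) (use ends_in in auto)
  moreover have "(\<Sum>p\<in>S. ?f (edge p)) = 0"
    by (intro sum.neutral) (use ends_product in \<open>auto simp: edge_def\<close>)
  ultimately show ?thesis unfolding balance_def sum_edges by (simp add: sum_negf)
qed

text \<open>Each product edge carries the share \<open>h / M\<close> of the first half. On the star
  edges integral parts are dropped: only the fractional parts have to be rounded, and residues keep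
  every edge within the unit interval.\<close>

definition initial_values :: "(nat \<Rightarrow> nat) \<Rightarrow> bool" where
  "initial_values val \<longleftrightarrow> (\<forall>p\<in>S. val (edge p) = h) \<and> (\<forall>w<n.
     val (1 + n + w) = h * fibre src S w mod M \<and> val (1 + 2 * n + w) = h * fibre snk S w mod M \<and>
     val (1 + w) < M \<and> int M dvd int (val (1 + w)) + int (val (1 + n + w)) - int (val (1 + 2 * n + w)))"

lemma initial_star_less:
  assumes "initial_values val" "g \<in> stars"
  shows "val g < M"
  using assms(2) by (cases rule: star_cases) (use assms(1) h in \<open>auto simp: initial_values_def\<close>)

lemma initial_sum:
  assumes "initial_values val"
  shows "(\<Sum>p | p \<in> S \<and> f p = w. int (val (edge p))) = int (h * fibre f S w)"
proof -
  have "(\<Sum>p | p \<in> S \<and> f p = w. int (val (edge p))) = (\<Sum>p | p \<in> S \<and> f p = w. int h)"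
    by (intro sum.cong) (use assms in \<open>auto simp: initial_values_def\<close>)
  then show ?thesis by (simp add: fibre_def)
qed

lemma initial_dvd:
  assumes i: "initial_values val" and z: "z \<in> {..3 * n}"
  shows "int M dvd balance val z"
proof -
  have md: "int M dvd int (a mod M) - int a" for a
    by (metis dvd_minus_iff minus_diff_eq mod_eq_dvd_iff mod_mod_trivial of_nat_mod)
  have net: "int M dvd balance val (1 + w)" if "w < n" for w
    unfolding balance_net[OF that] using i that unfolding initial_values_def by blast
  have out: "int M dvd balance val (1 + n + w)" if w: "w < n" for w
  proof -
    have "balance val (1 + n + w) = - (int (h * fibre src S w mod M) - int (h * fibre src S w))"
      unfolding balance_out[OF w] initial_sum[OF i] using i w by (simp add: initial_values_def)
    then show ?thesis using md by (metis dvd_minus_iff)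
  qed
  have "in": "int M dvd balance val (1 + 2 * n + w)" if w: "w < n" for w
  proof -
    have "balance val (1 + 2 * n + w) = int (h * fibre snk S w mod M) - int (h * fibre snk S w)"
      unfolding balance_in[OF w] initial_sum[OF i] using i w by (simp add: initial_values_def)
    then show ?thesis using md by metis
  qed
  \<comment> \<open>Every edge leaves one node and enters another, so the balances of all nodes add
    up to 0, and the root inherits divisibility from the others.\<close>
  have root: "int M dvd balance val 0"
  proof -
    have c: "(\<Sum>w<n. \<Sum>p | p \<in> S \<and> f p = w. int (val (edge p))) = (\<Sum>p\<in>S. int (val (edge p)))"
      if "f ` S \<subseteq> {..<n}" for f :: "nat \<Rightarrow> nat"
      using that finite_S by (intro sum.group) auto
    have "(\<Sum>w<n. balance val (1 + w) + balance val (1 + n + w) + balance val (1 + 2 * n + w)) =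
      (\<Sum>w<n. int (val (1 + w)) + (\<Sum>p | p \<in> S \<and> src p = w. int (val (edge p)))
         - (\<Sum>p | p \<in> S \<and> snk p = w. int (val (edge p))))"
      by (intro sum.cong refl) (simp only: lessThan_iff balance_net balance_out balance_in)
    also have "\<dots> = (\<Sum>w<n. int (val (1 + w)))"
      using c[of src] c[of snk] src snk by (auto simp: sum.distrib sum_subtractf image_subset_iff)
    finally have "balance val 0 =
      - (\<Sum>w<n. balance val (1 + w) + balance val (1 + n + w) + balance val (1 + 2 * n + w))"
      using balance_root by simp
    moreover have "int M dvd (\<Sum>w<n. balance val (1 + w) + balance val (1 + n + w) + balance val (1 + 2 * n + w))"
      by (intro dvd_sum dvd_add) (use net out "in" in auto)
    ultimately show ?thesis by simp
  qed
  show ?thesis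
  proof (cases "z = 0")
    case False
    then have "z \<in> stars" using z by (auto simp: stars_def)
    then show ?thesis by (cases rule: star_cases) (use net out "in" in auto)
  qed (use root in simp)
qed

text \<open>Equal balances force each sum of product values to change by as much as a star value. A
  star value starts below \<open>M\<close> and ends at 0 or \<open>M\<close>; the only possible
  change by a full \<open>M\<close> is from 0 to \<open>M\<close>, and the last hypothesis excludes
  it.\<close>

lemma final_rounded:
  assumes i: "initial_values val0" and b: "\<forall>z. balance val z = balance val0 z"
    and int: "\<forall>g\<in>stars \<union> edge ` S. val g = 0 \<or> val g = M"
    and zero: "\<forall>g\<in>stars. val0 g = 0 \<longrightarrow> val g = 0"
  shows "rounded n src snk M h S {p \<in> S. val (edge p) \<noteq> 0}"
proof -
  let ?S1 = "{p \<in> S. val (edge p) \<noteq> 0}"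
  have near: "\<bar>int (val g) - int (val0 g)\<bar> < int M" if g: "g \<in> stars" for g
    using initial_star_less[OF i g] int zero g h by (cases "val0 g = 0") force+
  have st: "1 + w \<in> stars" "1 + n + w \<in> stars" "1 + 2 * n + w \<in> stars" if "w < n" for w
    using that by (auto simp: stars_def)
  have sum0: "(\<Sum>p | p \<in> S \<and> f p = w. int (val0 (edge p))) = int h * int (fibre f S w)" for f :: "nat \<Rightarrow> nat" and w
    using initial_sum[OF i] by simp
  have prod: "val (edge p) = 0 \<or> val (edge p) = M" if "p \<in> S" for p using int that by blast
  have sum1: "(\<Sum>p | p \<in> S \<and> f p = w. int (val (edge p))) = int M * int (fibre f ?S1 w)" for f :: "nat \<Rightarrow> nat" and w
  proof -
    have "(\<Sum>p | p \<in> S \<and> f p = w. int (val (edge p))) = (\<Sum>p\<in>{p \<in> ?S1. f p = w}. int (val (edge p)))"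
      using finite_S by (intro sum.mono_neutral_right) auto
    also have "\<dots> = (\<Sum>p\<in>{p \<in> ?S1. f p = w}. int M)"
      by (intro sum.cong) (auto dest: prod)
    finally show ?thesis by (simp add: fibre_def)
  qed
  show ?thesis unfolding rounded_def
  proof (intro conjI allI impI)
    fix w assume w: "w < n"
    have o: "int M * int (fibre src ?S1 w) - int (val (1 + n + w)) =
        int h * int (fibre src S w) - int (val0 (1 + n + w))"
      using spec[OF b, of "1 + n + w"] by (simp only: balance_out[OF w] sum0 sum1)
    have i: "int (val (1 + 2 * n + w)) - int M * int (fibre snk ?S1 w) =
        int (val0 (1 + 2 * n + w)) - int h * int (fibre snk S w)"
      using spec[OF b, of "1 + 2 * n + w"] by (simp only: balance_in[OF w] sum0 sum1)
    have d: "int (val (1 + w)) + int (val (1 + n + w)) - int (val (1 + 2 * n + w)) =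
        int (val0 (1 + w)) + int (val0 (1 + n + w)) - int (val0 (1 + 2 * n + w))"
      using spec[OF b, of "1 + w"] by (simp only: balance_net[OF w])
    show "\<bar>int M * int (fibre src ?S1 w) - int h * int (fibre src S w)\<bar> < int M"
      using o near[OF st(2)[OF w]] by linarith
    show "\<bar>int M * int (fibre snk ?S1 w) - int h * int (fibre snk S w)\<bar> < int M"
      using i near[OF st(3)[OF w]] by linarith
    show "\<bar>int M * (int (fibre snk ?S1 w) - int (fibre src ?S1 w)) -
      int h * (int (fibre snk S w) - int (fibre src S w))\<bar> < int M"
      using o i d near[OF st(1)[OF w]] unfolding right_diff_distrib by linarith
  qed auto
qed

end


section \<open>Splitting a block of products\<close>

primrec chain :: "(nat \<Rightarrow> nat) \<Rightarrow> nat \<Rightarrow> nat list \<Rightarrow> bool" where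
  "chain nxt q [] \<longleftrightarrow> q = 0"
| "chain nxt q (p # ps) \<longleftrightarrow> q = Suc p \<and> chain nxt (nxt p) ps"

lemma chain_drop:
  "chain nxt q ps \<Longrightarrow> k < length ps \<Longrightarrow> chain nxt (Suc (ps ! k)) (drop k ps) \<and> chain nxt (nxt (ps ! k)) (drop (Suc k) ps)"
proof (induction ps arbitrary: q k)
  case (Cons p ps)
  then show ?case by (cases k) auto
qed simp

lemma chain_head: "chain nxt q ps \<Longrightarrow> q = (if ps = [] then 0 else Suc (ps ! 0))"
  by (cases ps) auto

lemma chain_cong: "chain nxt q ps \<Longrightarrow> (\<And>p. p \<in> set ps \<Longrightarrow> nxt' p = nxt p) \<Longrightarrow> chain nxt' q ps"
  by (induction ps arbitrary: q) auto

text \<open>Pointers are product numbers plus one, so that 0 can end a list; hence the subtractions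
  of 1. The cell \<open>base\<close> holds the number of the first product edge, which follows the
  star edges.\<close>

definition For_products :: "com \<Rightarrow> com" where
  "For_products c = ''q'' ::= NCell ''first'' (var ''lo'') ;;
     While (Neg (NLe (var ''q'') (NLit 0)))
       (''e'' ::= NSub (NAdd (var ''base'') (var ''q'')) (NLit 1) ;;
        c ;;
        ''q'' ::= NCell ''next'' (NSub (var ''q'') (NLit 1)))"

lemma writes_For_products [simp]:
  "writes (For_products c) = {''q'', ''e''} \<union> writes c" "rwrites (For_products c) = rwrites c"
  by (auto simp: For_products_def)

text \<open>\<open>J k\<close> describes the state after the first \<open>k\<close> products of the
  list; \<open>cong\<close> makes it insensitive to the two loop variables.\<close>

lemma wp_For_products:
  assumes ch: "chain (nmem s ''next'') (nmem s ''first'' (nmem s ''lo'' 0)) ps"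
    and J0: "J 0 s"
    and cong: "\<And>k r r'. J k r \<Longrightarrow> (\<forall>a. a \<noteq> ''q'' \<longrightarrow> a \<noteq> ''e'' \<longrightarrow> nmem r' a = nmem r a) \<Longrightarrow> J k r'"
    and body: "\<And>k r. k < length ps \<Longrightarrow> unchanged (For_products c) s r \<Longrightarrow> J k r \<Longrightarrow>
      nmem r ''q'' 0 = Suc (ps ! k) \<Longrightarrow> nmem r ''e'' 0 = nmem s ''base'' 0 + ps ! k \<Longrightarrow>
      wp c r (\<lambda>t r'. t \<le> T \<and> J (Suc k) r')"
    and w: "writes c \<inter> {''q'', ''e'', ''next'', ''first'', ''lo'', ''base''} = {}"
  shows "wp (For_products c) s (\<lambda>t r. t \<le> length ps * (T + 3) + 2 \<and> J (length ps) r)"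
proof -
  let ?c = "''e'' ::= NSub (NAdd (var ''base'') (var ''q'')) (NLit 1) ;; c ;;
        ''q'' ::= NCell ''next'' (NSub (var ''q'') (NLit 1))"
  let ?b = "Neg (NLe (var ''q'') (NLit 0))"
  let ?s = "nupdate ''q'' 0 (nmem s ''first'' (nmem s ''lo'' 0)) s"
  let ?cur = "\<lambda>k. if k < length ps then Suc (ps ! k) else 0"
  let ?J = "\<lambda>k r. J k r \<and> nmem r ''q'' 0 = ?cur k"
  have next_cur: "nmem s ''next'' (ps ! k) = ?cur (Suc k)" if "k < length ps" for k
  proof -
    have "chain (nmem s ''next'') (nmem s ''next'' (ps ! k)) (drop (Suc k) ps)"
      using chain_drop[OF ch that] by blast
    then show ?thesis using that by (auto dest!: chain_head)
  qed
  have fr: "unchanged (For_products c) s r" if "unchanged ?c ?s r" for r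
    using that by (auto simp: unchanged_def)
  have "wp (While ?b ?c) ?s (\<lambda>t r. t \<le> (\<Sum>k<length ps. (T + 2) + 1) + 1 \<and> ?J (length ps) r)"
  proof (rule wp_While_count[where J = ?J])
    show "?J 0 ?s" using cong[OF J0, of ?s] chain_head[OF ch] by auto
  next
    fix k r assume k: "k < length ps" "unchanged ?c ?s r" "?J k r"
    let ?r = "nupdate ''e'' 0 (nmem s ''base'' 0 + ps ! k) r"
    have base: "nmem r ''base'' = nmem s ''base''" and nx: "nmem r ''next'' = nmem s ''next''"
      using k(2) w by (auto simp: unchanged_def)
    have "wp c ?r (\<lambda>t r'. t \<le> T \<and> J (Suc k) r')"
    proof (rule body)
      show "unchanged (For_products c) s ?r" using fr[OF k(2)] by (simp add: unchanged_def)
      show "J k ?r" using cong[of k r ?r] k(3) by auto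
    qed (use k in auto)
    then have "wp c ?r (\<lambda>t r'. t \<le> T \<and> J (Suc k) (nupdate ''q'' 0 (?cur (Suc k)) r') \<and>
      nmem r' ''next'' (nmem r' ''q'' 0 - 1) = ?cur (Suc k))"
    proof (rule wp_mono)
      fix t r' assume u: "unchanged c ?r r'" and a: "t \<le> T \<and> J (Suc k) r'"
      have "nmem r' ''q'' 0 = Suc (ps ! k)" "nmem r' ''next'' = nmem s ''next''"
        using u w k nx by (auto simp: unchanged_def)
      then show "t \<le> T \<and> J (Suc k) (nupdate ''q'' 0 (?cur (Suc k)) r') \<and>
        nmem r' ''next'' (nmem r' ''q'' 0 - 1) = ?cur (Suc k)"
        using a cong[of "Suc k" r'] next_cur[OF k(1)] by auto
    qed
    moreover have "nupdate ''e'' (nval (NLit 0) r) (nval (NSub (NAdd (var ''base'') (var ''q'')) (NLit 1)) r) r = ?r"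
      using k base by simp
    ultimately have "wp ?c r (\<lambda>t r'. t \<le> T + 2 \<and> ?J (Suc k) r')"
      unfolding wp_Seq wp_simps(2) by (simp only:) (erule wp_mono, cases "Suc k < length ps"; simp)
    moreover have "bval ?b r" using k by simp
    ultimately show "bval ?b r \<and> wp ?c r (\<lambda>t r'. t \<le> T + 2 \<and> ?J (Suc k) r')" by blast
  qed simp
  then have "wp (While ?b ?c) ?s (\<lambda>t r. 1 + t \<le> length ps * (T + 3) + 2 \<and> J (length ps) r)"
    by (rule wp_mono) (simp add: algebra_simps)
  then show ?thesis unfolding For_products_def by simp
qed

section \<open>The program that splits one block\<close>

definition clear_values :: com where
  "clear_values = For ''i'' (var ''base'') (NAssign ''val'' (var ''i'') (NLit 0))"

text \<open>Applied to a residue and \<open>h\<close>, both below the modulus, so one conditional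
  subtraction reduces the sum.\<close>

definition add_mod :: "nexp \<Rightarrow> com" where
  "add_mod x = NAssign ''val'' x (NAdd (NCell ''val'' x) (var ''h'')) ;;
     Cond (NLe (var ''modulus'') (NCell ''val'' x))
       (NAssign ''val'' x (NSub (NCell ''val'' x) (var ''modulus''))) Skip"

text \<open>The star edge at a departure or arrival node has the number of that node, so the ends of
  a product edge address the two counters directly.\<close>

definition count_product :: com where
  "count_product =
     add_mod (NCell ''head'' (var ''e'')) ;;
     add_mod (NCell ''tail'' (var ''e'')) ;;
     NAssign ''val'' (var ''e'') (var ''h'')"

text \<open>Arrivals minus departures modulo \<open>M\<close>. Where the difference would be
  negative the modulus is added first, because subtraction truncates.\<close>

definition net_values :: com where
  "net_values = For ''i'' (var ''n'')
     (''x'' ::= NAdd (NAdd (NLit 1) (var ''n'')) (var ''i'') ;;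
      ''y'' ::= NAdd (var ''x'') (var ''n'') ;;
      Cond (NLe (NCell ''val'' (var ''x'')) (NCell ''val'' (var ''y'')))
        (NAssign ''val'' (NAdd (NLit 1) (var ''i'')) (NSub (NCell ''val'' (var ''y'')) (NCell ''val'' (var ''x''))))
        (NAssign ''val'' (NAdd (NLit 1) (var ''i''))
          (NSub (NAdd (NCell ''val'' (var ''y'')) (var ''modulus'')) (NCell ''val'' (var ''x'')))))"

definition star_forest :: com where
  "star_forest = For ''i'' (var ''base'')
     (Cond (NLe (NCell ''val'' (var ''i'')) (NLit 0))
       (NAssign ''par'' (var ''i'') (NLit 0))
       (NAssign ''par'' (var ''i'') (var ''i'')))"

text \<open>Value 0 puts the product into the second half of its block; value \<open>M\<close>
  leaves it at the start.\<close>

definition postpone :: com where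
  "postpone = Cond (NLe (NCell ''val'' (var ''e'')) (NLit 0))
     (NAssign ''schedule'' (NSub (var ''q'') (NLit 1))
        (NAdd (NCell ''schedule'' (NSub (var ''q'') (NLit 1))) (var ''h''))) Skip"

definition split_block :: com where
  "split_block =
     clear_values ;; For_products count_product ;; net_values ;; star_forest ;;
     For_products insert_edge ;; For_products postpone"

lemma fibre_insert:
  "finite X \<Longrightarrow> p \<notin> X \<Longrightarrow> fibre f (insert p X) w = fibre f X w + (if f p = w then 1 else 0)"
proof -
  assume X: "finite X" "p \<notin> X"
  have "{q \<in> insert p X. f q = w} = (if f p = w then insert p {q \<in> X. f q = w} else {q \<in> X. f q = w})" by auto
  then show ?thesis using X by (simp add: fibre_def)
qed

lemma mod_add_step:
  fixes a h M :: nat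
  assumes "h < M"
  shows "(a + h) mod M = (if M \<le> a mod M + h then a mod M + h - M else a mod M + h)"
proof -
  have l: "a mod M < M" using assms by simp
  have "(a + h) mod M = (a mod M + h) mod M" by (simp add: mod_add_left_eq)
  also have "\<dots> = (if M \<le> a mod M + h then a mod M + h - M else a mod M + h)"
  proof -
    have "a mod M + h - M < M" using l assms by linarith
    then have "(a mod M + h - M) mod M = a mod M + h - M" by (rule mod_less)
    then show ?thesis by (simp add: le_mod_geq)
  qed
  finally show ?thesis .
qed

context warehouse_network
begin

definition ready :: "state \<Rightarrow> bool" where
  "ready s \<longleftrightarrow> loaded s \<and> nmem s ''n'' 0 = n \<and> nmem s ''base'' 0 = 1 + 3 * n \<and> nmem s ''h'' 0 = h"

lemma ready_unchanged:
  assumes rd: "ready s" and u: "unchanged c s s'"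
    and w: "writes c \<inter> {''tail'', ''head'', ''modulus'', ''n'', ''base'', ''h''} = {}"
  shows "ready s'"
proof -
  have "writes c \<inter> {''tail'', ''head'', ''modulus''} = {}" and n: "''n'' \<notin> writes c" "''base'' \<notin> writes c" "''h'' \<notin> writes c"
    using w by auto
  then have "loaded s'" using loaded_unchanged[OF _ u] rd by (simp add: ready_def)
  moreover have "nmem s' ''n'' = nmem s ''n''" "nmem s' ''base'' = nmem s ''base''" "nmem s' ''h'' = nmem s ''h''"
    using n u by (simp_all add: unchanged_def)
  ultimately show ?thesis using rd by (simp add: ready_def)
qed

lemma wp_clear_values:
  assumes rd: "ready s"
  shows "wp clear_values s (\<lambda>t r. t \<le> 9 * n + 5 \<and> (\<forall>i\<le>3 * n. nmem r ''val'' i = 0))"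
  unfolding clear_values_def
proof (rule wp_For[where J = "\<lambda>k r. \<forall>i<k. nmem r ''val'' i = 0" and T = "\<lambda>_. 1" and N = "1 + 3 * n"], goal_cases)
  case (2 k r)
  then show ?case by (simp add: less_Suc_eq)
next
  case (4 k r)
  have "nmem s ''base'' 0 = 1 + 3 * n" using rd by (simp add: ready_def)
  then show ?case using 4(2) by (simp add: unchanged_def)
next
  case (5 t r)
  then show ?case by (simp add: less_Suc_eq_le)
qed simp_all

definition counted :: "(nat \<Rightarrow> nat) \<Rightarrow> nat set \<Rightarrow> bool" where
  "counted val X \<longleftrightarrow> (\<forall>p\<in>X. val (edge p) = h) \<and> (\<forall>w<n.
     val (1 + n + w) = h * fibre src X w mod M \<and> val (1 + 2 * n + w) = h * fibre snk X w mod M)"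

lemma counted_insert:
  assumes c: "counted val X" and X: "X \<subseteq> S" and p: "p \<in> S" "p \<notin> X"
    and new: "\<And>g. val' g = (if g = edge p then h
      else if g = tl (edge p) \<or> g = hd (edge p) then (if M \<le> val g + h then val g + h - M else val g + h)
      else val g)"
  shows "counted val' (insert p X)"
proof -
  have fin: "finite X" using X finite_S finite_subset by blast
  have te: "tl (edge p) = 1 + n + src p" "hd (edge p) = 1 + 2 * n + snk p"
    using ends_product p by (auto simp: edge_def)
  have lt: "src p < n" "snk p < n" using src snk p by auto
  have "val' (edge q) = h" if "q \<in> insert p X" for q
    using that c lt unfolding new te by (auto simp: counted_def edge_def)
  moreover have "val' (1 + n + w) = h * fibre src (insert p X) w mod M" if w: "w < n" for w
  proof (cases "src p = w")
    case True
    then have "val' (1 + n + w) = (if M \<le> val (1 + n + w) + h then val (1 + n + w) + h - M else val (1 + n + w) + h)"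
      unfolding new te using w by (simp add: edge_def)
    also have "val (1 + n + w) = h * fibre src X w mod M" using c w by (simp only: counted_def)
    finally show ?thesis
      using True fin p mod_add_step[OF h(2), of "h * fibre src X w"] by (simp add: fibre_insert add.commute)
  next
    case False
    then have "val' (1 + n + w) = val (1 + n + w)" unfolding new te using w lt by (simp add: edge_def)
    then show ?thesis using False fin p c w by (simp add: fibre_insert counted_def)
  qed
  moreover have "val' (1 + 2 * n + w) = h * fibre snk (insert p X) w mod M" if w: "w < n" for w
  proof (cases "snk p = w")
    case True
    then have "val' (1 + 2 * n + w) = (if M \<le> val (1 + 2 * n + w) + h then val (1 + 2 * n + w) + h - M else val (1 + 2 * n + w) + h)"
      unfolding new te using w by (simp add: edge_def)
    also have "val (1 + 2 * n + w) = h * fibre snk X w mod M" using c w by (simp only: counted_def)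
    finally show ?thesis
      using True fin p mod_add_step[OF h(2), of "h * fibre snk X w"] by (simp add: fibre_insert add.commute)
  next
    case False
    then have "val' (1 + 2 * n + w) = val (1 + 2 * n + w)" unfolding new te using w lt by (simp add: edge_def)
    then show ?thesis using False fin p c w by (simp add: fibre_insert counted_def)
  qed
  ultimately show ?thesis unfolding counted_def by blast
qed

lemma take_Suc_set: "k < length ps \<Longrightarrow> set (take (Suc k) ps) = insert (ps ! k) (set (take k ps))"
  by (simp add: take_Suc_conv_app_nth)

lemma nth_notin_take:
  assumes "distinct ps" "k < length ps"
  shows "ps ! k \<notin> set (take k ps)"
proof
  assume "ps ! k \<in> set (take k ps)"
  then obtain i where "i < length (take k ps)" "take k ps ! i = ps ! k" unfolding in_set_conv_nth by blast
  then show False using assms nth_eq_iff_index_eq[of ps i k] by simp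
qed

definition add_h :: "nat \<Rightarrow> (nat \<Rightarrow> nat) \<Rightarrow> nat \<Rightarrow> nat" where
  "add_h i val = val(i := if M \<le> val i + h then val i + h - M else val i + h)"

lemma wp_add_mod:
  assumes "ready r" and "a \<noteq> ''val''"
  shows "wp (add_mod (NCell a (var ''e''))) r
    (\<lambda>t r'. t \<le> 3 \<and> nmem r' ''val'' = add_h (nmem r a (nmem r ''e'' 0)) (nmem r ''val''))"
proof -
  have "nmem r ''modulus'' 0 = M" "nmem r ''h'' 0 = h"
    using assms(1) by (simp_all add: ready_def loaded_def)
  then show ?thesis using assms(2) by (simp add: add_mod_def add_h_def)
qed

lemma wp_count_product:
  assumes rd: "ready r" and e: "nmem r ''e'' 0 = e"
  shows "wp count_product r (\<lambda>t r'. t \<le> 7 \<and>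
    nmem r' ''val'' = (add_h (tl e) (add_h (hd e) (nmem r ''val'')))(e := h))"
  unfolding count_product_def wp_Seq
proof (rule wp_mono[OF wp_add_mod[OF rd]], goal_cases)
  case (2 t1 r1)
  have r1: "ready r1" "nmem r1 ''e'' 0 = e"
    using ready_unchanged[OF rd 2(1)] 2(1) e by (simp_all add: add_mod_def unchanged_def)
  have hd: "nmem r ''head'' (nmem r ''e'' 0) = hd e" using rd e by (simp add: ready_def loaded_def)
  show ?case
  proof (rule wp_mono[OF wp_add_mod[OF r1(1)]], goal_cases)
    case (2 t2 r2)
    have "nmem r2 ''e'' 0 = e" "nmem r2 ''h'' 0 = h"
      using 2(1) r1 by (simp_all add: add_mod_def unchanged_def ready_def)
    moreover have "nmem r1 ''tail'' (nmem r1 ''e'' 0) = tl e" using r1 by (simp add: ready_def loaded_def)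
    ultimately show ?case using 2(2) \<open>t1 \<le> 3 \<and> _\<close> hd by simp
  qed simp
qed simp

lemma wp_count_products:
  assumes rd: "ready s" and ch: "chain (nmem s ''next'') (nmem s ''first'' (nmem s ''lo'' 0)) ps"
    and ps: "distinct ps" "set ps = S" and clear: "\<forall>i\<le>3 * n. nmem s ''val'' i = 0"
  shows "wp (For_products count_product) s (\<lambda>t r. t \<le> length ps * 10 + 2 \<and> counted (nmem r ''val'') S \<and> nmem r ''val'' 0 = 0)"
proof -
  let ?J = "\<lambda>k r. counted (nmem r ''val'') (set (take k ps)) \<and> nmem r ''val'' 0 = 0"
  have "wp (For_products count_product) s (\<lambda>t r. t \<le> length ps * (7 + 3) + 2 \<and> ?J (length ps) r)"
  proof (rule wp_For_products[OF ch])
    show "?J 0 s" using clear by (simp add: counted_def fibre_def)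
  next
    fix k r assume k: "k < length ps" and un: "unchanged (For_products count_product) s r" and J: "?J k r"
      and e: "nmem r ''e'' 0 = nmem s ''base'' 0 + ps ! k"
    let ?p = "ps ! k"
    have p: "?p \<in> S" "?p \<notin> set (take k ps)" using k ps nth_notin_take by auto
    have rd': "ready r" using ready_unchanged[OF rd un] by (simp add: count_product_def add_mod_def)
    have ep: "nmem r ''e'' 0 = edge ?p" using e rd by (simp add: ready_def edge_def)
    have te: "tl (edge ?p) = 1 + n + src ?p" "hd (edge ?p) = 1 + 2 * n + snk ?p" "src ?p < n" "snk ?p < n"
      using ends_product src snk p by (auto simp: edge_def)
    let ?val = "(add_h (tl (edge ?p)) (add_h (hd (edge ?p)) (nmem r ''val'')))(edge ?p := h)"
    have ne: "tl (edge ?p) \<noteq> hd (edge ?p)" "tl (edge ?p) \<noteq> 0" "hd (edge ?p) \<noteq> 0" "edge ?p \<noteq> 0"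
      using te by (auto simp: edge_def)
    have "counted ?val (insert ?p (set (take k ps)))"
      using J p ps ne
      by (intro counted_insert[of "nmem r ''val''"]) (auto dest: in_set_takeD simp: add_h_def)
    moreover have "?val 0 = 0" using J ne by (simp add: add_h_def)
    ultimately show "wp count_product r (\<lambda>t r'. t \<le> 7 \<and> ?J (Suc k) r')"
      using wp_mono[OF wp_count_product[OF rd' ep], of "\<lambda>t r'. t \<le> 7 \<and> ?J (Suc k) r'"]
      by (simp only: take_Suc_set[OF k])
  qed (auto simp: count_product_def add_mod_def)
  then show ?thesis by (rule wp_mono) (use ps in auto)
qed

lemma wp_net_values:
  assumes rd: "ready s" and c: "counted (nmem s ''val'') S" and v0: "nmem s ''val'' 0 = 0"
  shows "wp net_values s (\<lambda>t r. t \<le> 6 * n + 2 \<and> initial_values (nmem r ''val'') \<and> nmem r ''val'' 0 = 0)"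
  unfolding net_values_def
\<comment> \<open>The condition \<open>1 \<le> g \<longrightarrow> n < g\<close> singles out the
  cells outside \<open>{1..n}\<close>; the loop writes values only inside.\<close>
proof (rule wp_For[where N = n and T = "\<lambda>_. 4" and J = "\<lambda>k r. (\<forall>g. (1 \<le> g \<longrightarrow> n < g) \<longrightarrow> nmem r ''val'' g = nmem s ''val'' g) \<and>
    (\<forall>w<k. nmem r ''val'' (1 + w) < M \<and> int M dvd int (nmem r ''val'' (1 + w)) + int (nmem s ''val'' (1 + n + w)) - int (nmem s ''val'' (1 + 2 * n + w)))"],
    goal_cases)
  case (2 k r)
  have rd': "nmem r ''n'' 0 = n" "nmem r ''modulus'' 0 = M"
    using 2(2) rd by (auto simp: unchanged_def ready_def loaded_def)
  let ?x = "nmem s ''val'' (1 + n + k)" and ?y = "nmem s ''val'' (1 + 2 * n + k)"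
  have xy: "?x < M" "?y < M"
    using c \<open>k < n\<close> h unfolding counted_def by (metis less_nat_zero_code mod_less_divisor neq0_conv)+
  have eq: "nmem r ''val'' (1 + n + k) = ?x" "nmem r ''val'' (1 + 2 * n + k) = ?y" using 2(3) by auto
  have ix: "Suc (n + k + n) = 1 + 2 * n + k" by simp
  show ?case
    using 2 rd' xy eq by (auto simp: ix less_Suc_eq of_nat_diff)
next
  case (5 t r)
  then show ?case using c v0 by (auto simp: initial_values_def counted_def edge_def)
qed (use rd in \<open>auto simp: ready_def unchanged_def\<close>)

text \<open>The star edges form a forest at once, without insertions: the star edge \<open>x\<close>
  joins node \<open>x\<close> to a smaller node, so storing \<open>x\<close> as the pointer of node
  \<open>x\<close> makes all pointers descend. Cell 0 belongs to no edge; its value 0 leaves the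
  pointer of the root empty.\<close>

lemma star_forestI:
  assumes val: "\<forall>g\<in>stars. val g < M" and par: "\<forall>i\<le>3 * n. par i = (if val i = 0 then 0 else i)"
    and v0: "val 0 = 0"
  shows "forest par (fractional val stars)"
proof -
  have roots: "{x \<in> {..3 * n}. par x \<noteq> 0} = fractional val stars"
    using val par v0 by (auto simp: fractional_def stars_def Suc_le_eq) (metis neq0_conv)+
  have id: "par x = x" if "x \<in> fractional val stars" for x
    using that par by (auto simp: fractional_def stars_def)
  have e: "(x = tl x \<or> x = hd x) \<and> other x x < x" if "x \<in> stars" for x
    using that by (cases rule: star_cases) (use ends_net ends_out ends_in in \<open>auto simp: other_def\<close>)
  have "up par \<subseteq> less_than\<inverse>"
    using roots id e by (force simp: up_def fractional_def)
  then have "acyclic (up par)"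
    using wf_less_than by (meson acyclic_converse acyclic_subset wf_acyclic)
  moreover have "bij_betw par {x \<in> {..3 * n}. par x \<noteq> 0} (fractional val stars)"
    unfolding roots using id by (auto simp: bij_betw_def inj_on_def)
  moreover have "\<forall>x\<in>{..3 * n}. par x \<noteq> 0 \<longrightarrow> x = tl (par x) \<or> x = hd (par x)"
  proof (intro ballI impI)
    fix x assume "x \<in> {..3 * n}" "par x \<noteq> 0"
    then have x: "x \<in> fractional val stars" using roots by blast
    then have "x \<in> stars" by (simp add: fractional_def)
    then show "x = tl (par x) \<or> x = hd (par x)" using id[OF x] e by simp
  qed
  ultimately show ?thesis unfolding forest_def by (auto simp: fractional_def)
qed

lemma wp_star_forest:
  assumes rd: "ready s" and i: "initial_values (nmem s ''val'')" and v0: "nmem s ''val'' 0 = 0"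
  shows "wp star_forest s (\<lambda>t r. t \<le> 12 * n + 6 \<and> rounding_inv stars (balance (nmem s ''val'')) r \<and>
    nmem r ''val'' = nmem s ''val'')"
  unfolding star_forest_def
proof (rule wp_For[where N = "1 + 3 * n" and T = "\<lambda>_. 2" and
    J = "\<lambda>k r. (\<forall>i<k. nmem r ''par'' i = (if nmem s ''val'' i = 0 then 0 else i))"], goal_cases)
  case (5 t r)
  have "nmem r ''val'' = nmem s ''val''" using 5(2) by (simp add: unchanged_def)
  moreover have "\<forall>g\<in>stars. nmem s ''val'' g < M" using initial_star_less[OF i] by blast
  moreover have "forest (nmem r ''par'') (fractional (nmem s ''val'') stars)"
    by (rule star_forestI) (use 5 v0 initial_star_less[OF i] in auto)
  ultimately show ?case using 5(1) i h by (auto simp: rounding_inv_def initial_values_def le_less)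
qed (use rd in \<open>auto simp: ready_def unchanged_def less_Suc_eq\<close>)

lemma wp_insert_edges:
  assumes rd: "ready s" and ch: "chain (nmem s ''next'') (nmem s ''first'' (nmem s ''lo'' 0)) ps"
    and ps: "distinct ps" "set ps = S" and i: "initial_values (nmem s ''val'')"
    and r: "rounding_inv stars (balance (nmem s ''val'')) s"
  shows "wp (For_products insert_edge) s (\<lambda>t r. t \<le> length ps * (57 * n + 37) + 2 \<and>
    rounded n src snk M h S {p \<in> S. nmem r ''val'' (edge p) \<noteq> 0})"
proof -
  let ?b = "balance (nmem s ''val'')"
  \<comment> \<open>The second clause keeps the next product edge fractional, as
    \<open>wp_insert_edge\<close> demands; the third is what \<open>final_rounded\<close> demands of
    the star edges.\<close>
  let ?J = "\<lambda>k r. rounding_inv (stars \<union> edge ` set (take k ps)) ?b r \<and>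
    (\<forall>p\<in>S - set (take k ps). nmem r ''val'' (edge p) = h) \<and>
    (\<forall>g\<in>stars. nmem s ''val'' g = 0 \<longrightarrow> nmem r ''val'' g = 0)"
  \<comment> \<open>With \<open>3 * n + 1\<close> nodes the bound \<open>19 * card V + 15\<close>
    becomes \<open>57 * n + 34\<close>.\<close>
  have "wp (For_products insert_edge) s (\<lambda>t r. t \<le> length ps * ((57 * n + 34) + 3) + 2 \<and> ?J (length ps) r)"
  proof (rule wp_For_products[OF ch])
    show "?J 0 s" using r i by (simp add: initial_values_def)
  next
    fix k r assume k: "k < length ps" and un: "unchanged (For_products insert_edge) s r" and J: "?J k r"
      and e: "nmem r ''e'' 0 = nmem s ''base'' 0 + ps ! k"
    let ?p = "ps ! k" and ?A = "stars \<union> edge ` set (take k ps)"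
    have p: "?p \<in> S" "?p \<notin> set (take k ps)" using k ps nth_notin_take by auto
    have "ready r" using ready_unchanged[OF rd un] by (simp add: writes_insert_edge)
    then have ld: "loaded r" by (simp add: ready_def)
    have ep: "nmem r ''e'' 0 = edge ?p" using e rd by (simp add: ready_def edge_def)
    have pE: "edge ?p \<in> stars \<union> edge ` S" "edge ?p \<notin> ?A"
      using p by (auto simp: edge_def stars_def)
    have val: "nmem r ''val'' (edge ?p) = h" using J p by blast
    have ins: "insert (edge ?p) ?A = stars \<union> edge ` set (take (Suc k) ps)"
      by (auto simp: take_Suc_set[OF k])
    have "wp insert_edge r (\<lambda>t s'. t \<le> 19 * card {..3 * n} + 15 \<and> rounding_inv (insert (edge ?p) ?A) ?b s' \<and>
      (\<forall>g. g \<notin> fractional (nmem r ''val'') ?A \<longrightarrow> g \<noteq> edge ?p \<longrightarrow> nmem s' ''val'' g = nmem r ''val'' g))"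
      by (rule wp_insert_edge[OF ld pE ep]) (use J val h in auto)
    then show "wp insert_edge r (\<lambda>t r'. t \<le> 57 * n + 34 \<and> ?J (Suc k) r')"
    proof (rule wp_mono, goal_cases)
      case (1 t s')
      note a = 1(2)
      have "nmem s' ''val'' (edge x) = h" if "x \<in> S - set (take (Suc k) ps)" for x
      proof -
        have "edge x \<notin> ?A" "edge x \<noteq> edge ?p" using that by (auto simp: edge_def stars_def take_Suc_set[OF k])
        then show ?thesis using a J that by (simp add: fractional_def take_Suc_set[OF k])
      qed
      moreover have "nmem s' ''val'' g = 0" if "g \<in> stars" "nmem s ''val'' g = 0" for g
      proof -
        have "nmem r ''val'' g = 0" using J that by blast
        moreover have "g \<noteq> edge ?p" using that by (auto simp: edge_def stars_def)
        ultimately show ?thesis using a by (simp add: fractional_def)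
      qed
      ultimately show ?case using a unfolding ins by auto
    qed
  qed (auto simp: writes_insert_edge rounding_inv_def)
  then show ?thesis
  proof (rule wp_mono, goal_cases)
    case (1 t r)
    note a = 1(2)
    then have ri: "rounding_inv (stars \<union> edge ` S) ?b r" using ps by simp
    then have bal: "\<forall>z. balance (nmem r ''val'') z = ?b z" and le: "\<forall>g\<in>stars \<union> edge ` S. nmem r ''val'' g \<le> M"
      by (auto simp: rounding_inv_def)
    have "fractional (nmem r ''val'') (stars \<union> edge ` S) = {}"
      by (rule no_fractional[of "nmem r ''par''"]) (use ri initial_dvd[OF i] in \<open>auto simp: rounding_inv_def\<close>)
    then have "\<forall>g\<in>stars \<union> edge ` S. nmem r ''val'' g = 0 \<or> nmem r ''val'' g = M"
      using le by (force simp: fractional_def)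
    then show ?case
      using final_rounded[OF i bal] a by (simp add: add.commute)
  qed
qed

lemma wp_postpone:
  assumes rd: "ready s" and ch: "chain (nmem s ''next'') (nmem s ''first'' (nmem s ''lo'' 0)) ps"
    and ps: "distinct ps" "set ps = S"
  shows "wp (For_products postpone) s (\<lambda>t r. t \<le> length ps * 5 + 2 \<and>
    nmem r ''schedule'' = (\<lambda>p. nmem s ''schedule'' p + (if p \<in> S \<and> nmem s ''val'' (edge p) = 0 then h else 0)))"
proof -
  let ?f = "\<lambda>X p. nmem s ''schedule'' p + (if p \<in> X \<and> nmem s ''val'' (edge p) = 0 then h else 0)"
  let ?J = "\<lambda>k r. nmem r ''schedule'' = ?f (set (take k ps))"
  have "wp (For_products postpone) s (\<lambda>t r. t \<le> length ps * (2 + 3) + 2 \<and> ?J (length ps) r)"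
  proof (rule wp_For_products[OF ch])
    fix k r assume k: "k < length ps" and un: "unchanged (For_products postpone) s r" and J: "?J k r"
      and q: "nmem r ''q'' 0 = Suc (ps ! k)" and e: "nmem r ''e'' 0 = nmem s ''base'' 0 + ps ! k"
    have p: "ps ! k \<notin> set (take k ps)" using k ps nth_notin_take by auto
    have ep: "nmem r ''e'' 0 = edge (ps ! k)" using e rd by (simp add: ready_def edge_def)
    have v: "nmem r ''val'' = nmem s ''val''" "nmem r ''h'' 0 = h"
      using un rd by (auto simp: unchanged_def postpone_def ready_def)
    show "wp postpone r (\<lambda>t r'. t \<le> 2 \<and> ?J (Suc k) r')"
      using J p q ep v by (auto simp: postpone_def take_Suc_set[OF k] fun_eq_iff)
  qed (auto simp: postpone_def)
  then show ?thesis by (rule wp_mono) (use ps in auto)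
qed

lemma wp_split_block:
  assumes rd: "ready s" and ch: "chain (nmem s ''next'') (nmem s ''first'' (nmem s ''lo'' 0)) ps"
    and ps: "distinct ps" "set ps = S"
  shows "wp split_block s (\<lambda>t r. t \<le> length ps * (57 * n + 52) + 27 * n + 19 \<and>
    (\<forall>p. p \<notin> S \<longrightarrow> nmem r ''schedule'' p = nmem s ''schedule'' p) \<and>
    (\<forall>p. nmem r ''schedule'' p = nmem s ''schedule'' p \<or> nmem r ''schedule'' p = nmem s ''schedule'' p + h) \<and>
    rounded n src snk M h S {p \<in> S. nmem r ''schedule'' p = nmem s ''schedule'' p})" (is "wp _ _ ?Q")
proof -
  let ?C = "\<lambda>q. ready q \<and> chain (nmem q ''next'') (nmem q ''first'' (nmem q ''lo'' 0)) ps \<and> nmem q ''schedule'' = nmem s ''schedule''"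
  note ws = clear_values_def count_product_def add_mod_def net_values_def star_forest_def writes_insert_edge postpone_def
  have tr: "?C r'"
    if "unchanged c r r'" "?C r"
      "writes c \<inter> {''tail'', ''head'', ''modulus'', ''n'', ''base'', ''h'', ''next'', ''first'', ''lo'', ''schedule''} = {}" for c r r'
    using that ready_unchanged[of r c r'] by (auto simp: unchanged_def)
  have "wp clear_values s (\<lambda>t1 s1. wp (For_products count_product) s1 (\<lambda>t2 s2. wp net_values s2 (\<lambda>t3 s3.
     wp star_forest s3 (\<lambda>t4 s4. wp (For_products insert_edge) s4 (\<lambda>t5 s5. wp (For_products postpone) s5
       (\<lambda>t6. ?Q (t1 + (t2 + (t3 + (t4 + (t5 + t6)))))))))))"
  proof (rule wp_mono[OF wp_clear_values[OF rd]], goal_cases)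
    case (1 t1 s1)
    have c1: "?C s1"
      by (rule tr[OF 1(1)]) (use rd ch in \<open>auto simp: ws\<close>)
    show ?case
    proof (rule wp_mono[OF wp_count_products[of s1 ps]], goal_cases)
      case (6 t2 s2)
      have c2: "?C s2"
        by (rule tr[OF 6(1) c1]) (auto simp: ws)
      show ?case
      proof (rule wp_mono[OF wp_net_values[of s2]], goal_cases)
        case (4 t3 s3)
        have c3: "?C s3"
          by (rule tr[OF 4(1) c2]) (auto simp: ws)
        show ?case
        proof (rule wp_mono[OF wp_star_forest[of s3]], goal_cases)
          case (4 t4 s4)
          have c4: "?C s4"
            by (rule tr[OF 4(1) c3]) (auto simp: ws)
          show ?case
          proof (rule wp_mono[OF wp_insert_edges[of s4 ps]], goal_cases)
            case (7 t5 s5)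
            have c5: "?C s5"
              by (rule tr[OF 7(1) c4]) (auto simp: ws)
            show ?case
            proof (rule wp_mono[OF wp_postpone[of s5 ps]], goal_cases)
              case (5 t6 s6)
              have "{p \<in> S. nmem s6 ''schedule'' p = nmem s ''schedule'' p} = {p \<in> S. nmem s5 ''val'' (edge p) \<noteq> 0}"
                using 5(2) c5 h by auto
              moreover have "t1 + (t2 + (t3 + (t4 + (t5 + t6)))) \<le> length ps * (57 * n + 52) + 27 * n + 19"
                using 1(2) 6(2) \<open>t3 \<le> _ \<and> _\<close> \<open>t4 \<le> _ \<and> _\<close> 7(2) 5(2) by (simp add: algebra_simps)
              ultimately show ?case using 5(2) 7(2) c5 by auto
            qed (use c5 ps in auto)
          qed (use c4 ps 4 \<open>t3 \<le> _ \<and> _\<close> in auto)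
        qed (use c3 4 in auto)
      qed (use c2 6 in auto)
    qed (use c1 ps 1 in auto)
  qed
  then show ?thesis unfolding split_block_def wp_Seq .
qed

end


section \<open>Balanced schedules\<close>

lemma fibre_mono: "finite B \<Longrightarrow> A \<subseteq> B \<Longrightarrow> fibre f A w \<le> fibre f B w"
  unfolding fibre_def by (rule card_mono) auto

lemma fibre_Un_disjoint:
  "finite A \<Longrightarrow> finite B \<Longrightarrow> A \<inter> B = {} \<Longrightarrow> fibre f (A \<union> B) w = fibre f A w + fibre f B w"
proof -
  assume "finite A" "finite B" "A \<inter> B = {}"
  then have "card ({p \<in> A. f p = w} \<union> {p \<in> B. f p = w}) = fibre f A w + fibre f B w"
    unfolding fibre_def by (intro card_Un_disjoint) auto
  moreover have "{p \<in> A \<union> B. f p = w} = {p \<in> A. f p = w} \<union> {p \<in> B. f p = w}" by auto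
  ultimately show ?thesis by (simp add: fibre_def)
qed

text \<open>Each departure time is the start of the product's block, which has length
  \<open>g\<close> unless it is cut off at \<open>D\<close>. The truncated subtraction in the last
  clause is the maximum of 0 and the final excess. That clause does not limit \<open>lo\<close>, so
  it covers the right end of the last block even beyond \<open>D\<close>.\<close>

definition balanced ::
  "nat \<Rightarrow> nat \<Rightarrow> (nat \<Rightarrow> nat) \<Rightarrow> (nat \<Rightarrow> nat) \<Rightarrow> (nat \<Rightarrow> nat) \<Rightarrow> (nat \<Rightarrow> nat) \<Rightarrow> nat \<Rightarrow> nat \<Rightarrow> (nat \<Rightarrow> nat) \<Rightarrow> bool" where
  "balanced n m src snk kout kin D g \<phi> \<longleftrightarrow>
     (\<forall>p<m. \<phi> p < D \<and> g dvd \<phi> p) \<and>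
     (\<forall>w<n. \<forall>lo. g dvd lo \<longrightarrow> lo < D \<longrightarrow>
        fibre src {p. p < m \<and> \<phi> p = lo} w \<le> min g (D - lo) * kout w \<and>
        fibre snk {p. p < m \<and> \<phi> p = lo} w \<le> min g (D - lo) * kin w) \<and>
     (\<forall>w<n. \<forall>lo. g dvd lo \<longrightarrow>
        fibre snk {p. p < m \<and> \<phi> p < lo} w \<le> fibre src {p. p < m \<and> \<phi> p < lo} w +
          (fibre snk {..<m} w - fibre src {..<m} w))"

text \<open>As \<open>D \<le> g\<close> there is a single block. Nothing has departed before the
  boundary 0, and everything before any later one.\<close>

lemma balanced_init:
  assumes "\<forall>w<n. fibre src {..<m} w \<le> D * kout w \<and> fibre snk {..<m} w \<le> D * kin w"
    and "m = 0 \<or> 0 < D" and "D \<le> g"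
  shows "balanced n m src snk kout kin D g (\<lambda>_. 0)"
proof -
  have "fibre f {p. p < m \<and> 0 = lo} w \<le> min g (D - lo) * k"
    if "fibre f {..<m} w \<le> D * k" "g dvd lo" "lo < D" for f :: "nat \<Rightarrow> nat" and w lo k
  proof -
    have "lo = 0" using that(2,3) assms(3) by (metis dvd_imp_le le_trans not_le neq0_conv)
    then show ?thesis using that assms(3) by (simp add: min_def lessThan_def)
  qed
  moreover have "fibre snk {p. p < m \<and> 0 < lo} w \<le> fibre src {p. p < m \<and> 0 < lo} w +
          (fibre snk {..<m} w - fibre src {..<m} w)" for w and lo :: nat
    by (cases "lo = 0") (auto simp: fibre_def lessThan_def)
  ultimately show ?thesis using assms unfolding balanced_def by auto
qed

text \<open>The quota \<open>k\<close> per round bounds the fraction \<open>h / M\<close> of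
  \<open>b\<close> by the integer \<open>h * k\<close>, and rounding up cannot pass an integer
  bound.\<close>

lemma rounded_first_le:
  assumes "\<bar>int M * int a - int h * int b\<bar> < int M" "b \<le> M * k"
  shows "a \<le> h * k"
proof -
  have "int M * int a < int h * int b + int M" using assms(1) by linarith
  also have "int h * int b \<le> int h * int (M * k)" using assms(2) by (intro mult_left_mono) (auto simp flip: of_nat_mult)
  finally have "int M * int a < int M * (int h * int k + 1)" by (simp add: algebra_simps)
  then have "int a < int h * int k + 1" by (simp add: mult_less_cancel_left)
  then show ?thesis by (simp flip: of_nat_mult)
qed

text \<open>The complement of a rounding of the fraction \<open>h / M\<close> is a rounding of the
  fraction \<open>(M - h) / M\<close>.\<close>

lemma rounded_second_le:
  assumes "\<bar>int M * int a - int h * int b\<bar> < int M" "b \<le> M * k" "h \<le> M" "a + c = b"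
  shows "c \<le> (M - h) * k"
proof (rule rounded_first_le)
  have "int M * int c - int (M - h) * int b = - (int M * int a - int h * int b)"
    using assms(3,4) by (auto simp: of_nat_diff algebra_simps)
  then show "\<bar>int M * int c - int (M - h) * int b\<bar> < int M" using assms(1) by simp
qed (rule assms(2))

text \<open>The fraction \<open>h / M\<close> of \<open>d\<close> lies between 0 and
  \<open>d\<close>, both of them integers, so rounding stays between them.\<close>

lemma rounded_diff_le:
  assumes "\<bar>int M * x - int h * d\<bar> < int M" "h \<le> M"
  shows "x \<le> max 0 d"
proof (cases "d \<le> 0")
  case True
  then have "int h * d \<le> 0" by (simp add: mult_nonneg_nonpos)
  then have "int M * x < int M * 1" using assms(1) by linarith
  then have "x < 1" unfolding mult_less_cancel_left by auto
  then show ?thesis by simp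
next
  case False
  then have "int h * d \<le> int M * d" using assms(2) by (intro mult_right_mono) auto
  then have "int M * x < int M * (d + 1)" using assms(1) by (simp add: algebra_simps)
  then have "x < d + 1" unfolding mult_less_cancel_left by auto
  then show ?thesis by simp
qed

text \<open>Boundaries at multiples of \<open>2 * h\<close> are old, and no product crosses them.
  The new ones are midpoints of blocks, where \<open>rounded\<close> controls the counts.\<close>

lemma balanced_refine:
  assumes b: "balanced n m src snk kout kin D (2 * h) \<phi>" and h: "0 < h"
    and step: "\<forall>p<m. \<phi>' p = \<phi> p \<or> \<phi>' p = \<phi> p + h"
    and last: "\<forall>p<m. D \<le> \<phi> p + h \<longrightarrow> \<phi>' p = \<phi> p"
    and r: "\<And>lo. 2 * h dvd lo \<Longrightarrow> lo + h < D \<Longrightarrow>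
      rounded n src snk (min (2 * h) (D - lo)) h {p. p < m \<and> \<phi> p = lo} {p. p < m \<and> \<phi> p = lo \<and> \<phi>' p = \<phi> p}"
  shows "balanced n m src snk kout kin D h \<phi>'"
proof -
  let ?S = "\<lambda>lo. {p. p < m \<and> \<phi> p = lo}" and ?S' = "\<lambda>lo. {p. p < m \<and> \<phi>' p = lo}"
  let ?B = "\<lambda>lo. {p. p < m \<and> \<phi> p < lo}" and ?B' = "\<lambda>lo. {p. p < m \<and> \<phi>' p < lo}"
  have div: "2 * h dvd \<phi> p" if "p < m" for p using b that by (auto simp: balanced_def)
  have even: "\<phi>' p = lo \<longleftrightarrow> \<phi> p = lo \<and> \<phi>' p = \<phi> p" "\<phi>' p < lo \<longleftrightarrow> \<phi> p < lo"
    if p: "p < m" and lo: "2 * h dvd lo" for p lo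
  proof -
    obtain a c where ac: "\<phi> p = 2 * h * a" "lo = 2 * h * c" using div[OF p] lo by (auto elim!: dvdE)
    have "2 * h * a + h \<noteq> 2 * h * c"
    proof
      assume "2 * h * a + h = 2 * h * c"
      then have "h * (2 * a + 1) = h * (2 * c)" by (simp add: algebra_simps)
      then have "2 * a + 1 = 2 * c" using h by (metis mult_left_cancel not_gr0)
      then show False by presburger
    qed
    then show "\<phi>' p = lo \<longleftrightarrow> \<phi> p = lo \<and> \<phi>' p = \<phi> p" using step p ac by auto
    have "2 * h * a + h < 2 * h * c" if "2 * h * a < 2 * h * c"
    proof -
      have "a + 1 \<le> c" using that by simp
      then have "2 * h * (a + 1) \<le> 2 * h * c" by (rule mult_le_mono2)
      then show ?thesis using h by simp
    qed
    then have "2 * h * a + h < 2 * h * c \<longleftrightarrow> 2 * h * a < 2 * h * c" using add_lessD1 by blast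
    then show "\<phi>' p < lo \<longleftrightarrow> \<phi> p < lo" using step p ac by auto
  qed
  have odd: "\<phi>' p = lo + h \<longleftrightarrow> \<phi> p = lo \<and> \<phi>' p \<noteq> \<phi> p" "\<phi>' p < lo + h \<longleftrightarrow> \<phi> p < lo \<or> \<phi> p = lo \<and> \<phi>' p = \<phi> p"
    if p: "p < m" and lo: "2 * h dvd lo" for p lo
  proof -
    obtain a c where ac: "\<phi> p = 2 * h * a" "lo = 2 * h * c" using div[OF p] lo by (auto elim!: dvdE)
    have "2 * h * a \<noteq> 2 * h * c + h"
    proof
      assume "2 * h * a = 2 * h * c + h"
      then have "h * (2 * c + 1) = h * (2 * a)" by (simp add: algebra_simps)
      then have "2 * c + 1 = 2 * a" using h by (metis mult_left_cancel not_gr0)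
      then show False by presburger
    qed
    then show "\<phi>' p = lo + h \<longleftrightarrow> \<phi> p = lo \<and> \<phi>' p \<noteq> \<phi> p" using step p ac h by auto
    have "\<phi>' p \<ge> lo + h" if "\<phi> p > lo"
    proof -
      have "c + 1 \<le> a" using that ac by simp
      then have "2 * h * (c + 1) \<le> 2 * h * a" by (rule mult_le_mono2)
      then have "lo + 2 * h \<le> \<phi> p" using ac by (simp add: algebra_simps)
      moreover have "\<phi>' p = \<phi> p \<or> \<phi>' p = \<phi> p + h" using step p by blast
      ultimately show ?thesis by auto
    qed
    moreover have "\<phi>' p < lo" if "\<phi> p < lo" using even(2)[OF p lo] that by simp
    ultimately show "\<phi>' p < lo + h \<longleftrightarrow> \<phi> p < lo \<or> \<phi> p = lo \<and> \<phi>' p = \<phi> p"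
      using spec[OF step, of p] p h by (cases "\<phi> p" lo rule: linorder_cases) auto
  qed
  have half: "2 * h dvd lo \<or> (\<exists>l. 2 * h dvd l \<and> lo = l + h)" if lo: "h dvd lo" for lo
  proof -
    obtain c where c: "lo = h * c" using lo by (auto elim: dvdE)
    show ?thesis
    proof (cases "even c")
      case True
      then show ?thesis using c by (auto elim!: evenE)
    next
      case False
      then obtain d where "c = 2 * d + 1" by (auto elim: oddE)
      then have "lo = 2 * h * d + h" using c by (simp add: algebra_simps)
      then show ?thesis by (intro disjI2 exI[of _ "2 * h * d"]) simp
    qed
  qed
  have old: "fibre src (?S lo) w \<le> min (2 * h) (D - lo) * kout w" "fibre snk (?S lo) w \<le> min (2 * h) (D - lo) * kin w"
    if "w < n" "2 * h dvd lo" "lo < D" for w lo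
    using b that unfolding balanced_def by blast+
  have oldp: "fibre snk (?B lo) w \<le> fibre src (?B lo) w + (fibre snk {..<m} w - fibre src {..<m} w)"
    if "w < n" "2 * h dvd lo" for w lo
    using b that unfolding balanced_def by blast
  have parts: "fibre f (?S lo) w = fibre f {p. p < m \<and> \<phi> p = lo \<and> \<phi>' p = \<phi> p} w + fibre f (?S' (lo + h)) w"
    if "2 * h dvd lo" for f :: "nat \<Rightarrow> nat" and lo w
  proof -
    have "?S lo = {p. p < m \<and> \<phi> p = lo \<and> \<phi>' p = \<phi> p} \<union> ?S' (lo + h)" using odd(1)[OF _ that] by auto
    moreover have "{p. p < m \<and> \<phi> p = lo \<and> \<phi>' p = \<phi> p} \<inter> ?S' (lo + h) = {}" using odd(1)[OF _ that] by auto
    ultimately show ?thesis by (simp add: fibre_Un_disjoint)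
  qed
  have range: "\<phi>' p < D \<and> h dvd \<phi>' p" if p: "p < m" for p
  proof -
    have "\<phi> p < D" "h dvd \<phi> p" using b p div[OF p] by (auto simp: balanced_def dvd_mult_right dest: dvd_mult_left)
    then show ?thesis using step last p by (metis dvd_add dvd_refl not_le)
  qed
  have blocks: "fibre src (?S' lo) w \<le> min h (D - lo) * kout w \<and> fibre snk (?S' lo) w \<le> min h (D - lo) * kin w"
    if w: "w < n" and lo: "h dvd lo" "lo < D" for w lo
    using half[OF lo(1)]
  proof
    assume d: "2 * h dvd lo"
    have S': "?S' lo = {p. p < m \<and> \<phi> p = lo \<and> \<phi>' p = \<phi> p}" using even(1)[OF _ d] by auto
    show ?thesis
    proof (cases "lo + h < D")
      case True
      then have "min h (D - lo) = h" by simp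
      then show ?thesis
        using r[OF d True] w old[OF w d lo(2)] unfolding S' rounded_def by (auto intro: rounded_first_le)
    next
      \<comment> \<open>The block has length at most \<open>h\<close>, so both minima are
        \<open>D - lo\<close> and the old bound serves again.\<close>
      case False
      then have mi: "min h (D - lo) = min (2 * h) (D - lo)" by simp
      have le: "fibre f (?S' lo) w \<le> fibre f (?S lo) w" for f :: "nat \<Rightarrow> nat"
        unfolding S' by (rule fibre_mono) auto
      show ?thesis
        unfolding mi using order_trans[OF le old(1)[OF w d lo(2)]] order_trans[OF le old(2)[OF w d lo(2)]] by blast
    qed
  next
    assume "\<exists>l. 2 * h dvd l \<and> lo = l + h"
    then obtain l where l: "2 * h dvd l" "lo = l + h" by blast
    have "l + h < D" "l < D" using lo l by auto
    \<comment> \<open>The second half gets what \<open>h\<close> leaves of the block, whose end may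
      be cut off at \<open>D\<close>.\<close>
    then have M: "min h (D - lo) = min (2 * h) (D - l) - h" "h \<le> min (2 * h) (D - l)" using l by auto
    note R = r[OF l(1) \<open>l + h < D\<close>, unfolded rounded_def, THEN conjunct2, rule_format, OF w]
    show ?thesis
      unfolding M(1)
      using rounded_second_le[OF R[THEN conjunct1] old(1)[OF w l(1) \<open>l < D\<close>] M(2)]
        rounded_second_le[OF R[THEN conjunct2, THEN conjunct1] old(2)[OF w l(1) \<open>l < D\<close>] M(2)]
        parts[OF l(1), of src w] parts[OF l(1), of snk w] l(2) by simp
  qed
  have prefixes: "fibre snk (?B' lo) w \<le> fibre src (?B' lo) w + (fibre snk {..<m} w - fibre src {..<m} w)"
    if w: "w < n" and lo: "h dvd lo" for w lo
    using half[OF lo]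
  proof
    assume d: "2 * h dvd lo"
    have "?B' lo = ?B lo" using even(2)[OF _ d] by auto
    then show ?thesis using oldp[OF w d] by simp
  next
    assume "\<exists>l. 2 * h dvd l \<and> lo = l + h"
    then obtain l where l: "2 * h dvd l" "lo = l + h" by blast
    show ?thesis
    proof (cases "lo < D")
      case False
      then have "?B' lo = {..<m}" using range by force
      then show ?thesis by simp
    next
      case True
      let ?S1 = "{p. p < m \<and> \<phi> p = l \<and> \<phi>' p = \<phi> p}"
      have "?B' lo = ?B l \<union> ?S1" using odd(2)[OF _ l(1)] l(2) by auto
      then have B': "fibre f (?B' lo) w = fibre f (?B l) w + fibre f ?S1 w" for f :: "nat \<Rightarrow> nat"
        by (simp only:) (rule fibre_Un_disjoint; auto)
      have "?B (l + 2 * h) = ?B l \<union> ?S l"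
      proof -
        have "\<phi> p < l + 2 * h \<longleftrightarrow> \<phi> p < l \<or> \<phi> p = l" if p: "p < m" for p
        proof -
          obtain a c where ac: "\<phi> p = 2 * h * a" "l = 2 * h * c" using div[OF p] l(1) by (auto elim!: dvdE)
          have "\<phi> p < l + 2 * h \<longleftrightarrow> 2 * h * a < 2 * h * (c + 1)" using ac by (simp add: algebra_simps)
          also have "\<dots> \<longleftrightarrow> a < c + 1" unfolding mult_less_cancel1 using h by simp
          finally show ?thesis using ac h by auto
        qed
        then show ?thesis by auto
      qed
      then have B2: "fibre f (?B (l + 2 * h)) w = fibre f (?B l) w + fibre f (?S l) w" for f :: "nat \<Rightarrow> nat"
        by (simp only:) (rule fibre_Un_disjoint; auto)
      have "l + h < D" using True l by simp
      then have "int (fibre snk ?S1 w) - int (fibre src ?S1 w) \<le> max 0 (int (fibre snk (?S l) w) - int (fibre src (?S l) w))"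
        using r[OF l(1)] w unfolding rounded_def by (intro rounded_diff_le[of "min (2 * h) (D - l)"]) auto
      moreover have "2 * h dvd l + 2 * h" using l(1) by simp
      ultimately show ?thesis
        using oldp[OF w l(1)] oldp[OF w \<open>2 * h dvd l + 2 * h\<close>] unfolding B' B2 by linarith
    qed
  qed
  show ?thesis unfolding balanced_def using range blocks prefixes by blast
qed

text \<open>\<open>fits \<sigma> d a r\<close>: \<open>r\<close> rounds suffice to move \<open>a\<close> products of size \<open>\<sigma>\<close> under a limit of \<open>d\<close> per round.\<close>

definition fits :: "real \<Rightarrow> ereal \<Rightarrow> nat \<Rightarrow> nat \<Rightarrow> bool" where
  "fits \<sigma> d a r \<longleftrightarrow> (\<exists>k\<le>a. ereal (real k * \<sigma>) \<le> d \<and> a \<le> r * k)"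

lemma fits_mono: "fits \<sigma> d a r \<Longrightarrow> r \<le> r' \<Longrightarrow> fits \<sigma> d a r'"
  unfolding fits_def using mult_le_mono1 order_trans by blast

text \<open>For \<open>k\<close> take the load of the busiest round: \<open>r\<close> rounds of at
  most this load move everything.\<close>

lemma fits_rounds:
  assumes "finite S" and "\<forall>p\<in>S. \<psi> p < r" and "0 \<le> d"
    and lim: "\<forall>\<theta>. ereal (real (card {p \<in> S. \<psi> p = \<theta>}) * \<sigma>) \<le> d"
  shows "fits \<sigma> d (card S) r"
proof (cases "r = 0")
  case True
  then show ?thesis using assms by (auto simp: fits_def zero_ereal_def[symmetric])
next
  case False
  let ?c = "\<lambda>\<theta>. card {p \<in> S. \<psi> p = \<theta>}"
  define k where "k = Max (?c ` {..<r})"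
  have "k \<in> ?c ` {..<r}" unfolding k_def using False by (intro Max_in) auto
  then obtain \<theta> where \<theta>: "k = ?c \<theta>" by blast
  have "card S = (\<Sum>\<theta><r. ?c \<theta>)"
    using sum.group[of S "{..<r}" \<psi> "\<lambda>_. 1::nat"] assms(1,2) by (simp add: image_subset_iff)
  also have "\<dots> \<le> (\<Sum>\<theta><r. k)" unfolding k_def by (intro sum_mono Max_ge) auto
  finally have "card S \<le> r * k" by simp
  moreover have "k \<le> card S" unfolding \<theta> using assms(1) by (intro card_mono) auto
  ultimately show ?thesis unfolding fits_def using lim \<theta> by blast
qed

context
  fixes n m :: nat and I :: "(nat, nat) reallocation" and \<sigma> :: real and \<tau> :: nat
  assumes inst: "indexed_instance n m I"
    and size: "p < m \<Longrightarrow> psize I p = \<sigma>" and transit: "p < m \<Longrightarrow> transit I p = \<tau>"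
begin

lemma sum_size: "(\<forall>p\<in>X. p < m) \<Longrightarrow> (\<Sum>p\<in>X. psize I p) = real (card X) * \<sigma>"
  using size by simp

text \<open>With a common transit time the arrivals of a round are the departures of one round,
  shifted by \<open>\<tau>\<close>; so a limit on arrivals limits departures too.\<close>

lemma feasible_fits:
  assumes f: "feasible I \<psi>" and r: "\<forall>p<m. \<psi> p < r" and w: "w < n"
  shows "fits \<sigma> (carry_out I w) (fibre (source I) {..<m} w) r"
    "fits \<sigma> (carry_in I w) (fibre (sink I) {..<m} w) r"
proof -
  have d: "0 \<le> carry_out I w" "0 \<le> carry_in I w"
    using inst w by (auto simp: indexed_instance_def reallocation_instance_def)
  have p: "products I = {..<m}" "warehouses I = {..<n}" using inst by (auto simp: indexed_instance_def)
  show "fits \<sigma> (carry_out I w) (fibre (source I) {..<m} w) r"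
    unfolding fibre_def
  proof (rule fits_rounds[where \<psi> = \<psi>])
    have "ereal (\<Sum>p | p \<in> out_products I w \<and> \<psi> p = \<theta>. psize I p) \<le> carry_out I w" for \<theta>
      using f w p by (auto simp: feasible_def)
    moreover have "(\<Sum>p | p \<in> out_products I w \<and> \<psi> p = \<theta>. psize I p) =
        real (card {p \<in> {p \<in> {..<m}. source I p = w}. \<psi> p = \<theta>}) * \<sigma>" for \<theta>
      by (subst sum_size) (auto simp: out_products_def p)
    ultimately show "\<forall>\<theta>. ereal (real (card {p \<in> {p \<in> {..<m}. source I p = w}. \<psi> p = \<theta>}) * \<sigma>) \<le> carry_out I w"
      by metis
  qed (use r d in auto)
  show "fits \<sigma> (carry_in I w) (fibre (sink I) {..<m} w) r"
    unfolding fibre_def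
  proof (rule fits_rounds[where \<psi> = \<psi>])
    have "ereal (\<Sum>p | p \<in> in_products I w \<and> \<psi> p + transit I p = \<theta> + \<tau>. psize I p) \<le> carry_in I w" for \<theta>
      using f w p by (auto simp: feasible_def)
    moreover have "(\<Sum>p | p \<in> in_products I w \<and> \<psi> p + transit I p = \<theta> + \<tau>. psize I p) =
        real (card {p \<in> {p \<in> {..<m}. sink I p = w}. \<psi> p = \<theta>}) * \<sigma>" for \<theta>
    proof -
      have "{p. p \<in> in_products I w \<and> \<psi> p + transit I p = \<theta> + \<tau>} = {p \<in> {p \<in> {..<m}. sink I p = w}. \<psi> p = \<theta>}"
        using transit by (auto simp: in_products_def p)
      then show ?thesis by (simp only:) (rule sum_size, auto)
    qed
    ultimately show "\<forall>\<theta>. ereal (real (card {p \<in> {p \<in> {..<m}. sink I p = w}. \<psi> p = \<theta>}) * \<sigma>) \<le> carry_in I w"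
      by metis
  qed (use r d in auto)
qed

text \<open>For storage: whatever has arrived by time \<open>\<theta>\<close> departed before it,
  because \<open>0 < \<tau>\<close>. Together with the products still to leave, these are at most as
  many as the larger of all departures and all arrivals of the warehouse, and the standing
  assumptions bound the sizes of both by its capacity.\<close>

lemma balanced_feasible:
  assumes b: "balanced n m (source I) (sink I) kout kin D 1 \<phi>"
    and k: "\<forall>w<n. ereal (real (kout w) * \<sigma>) \<le> carry_out I w \<and> ereal (real (kin w) * \<sigma>) \<le> carry_in I w"
  shows "feasible I \<phi>"
  unfolding feasible_def
proof (intro allI ballI)
  fix \<theta> w assume "w \<in> warehouses I"
  then have w: "w < n" using inst by (simp add: indexed_instance_def)
  have p: "products I = {..<m}" using inst by (simp add: indexed_instance_def)
  \<comment> \<open>Without products the common size is arbitrary and may be negative, which is why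
    \<open>m = 0\<close> is a separate case below.\<close>
  have \<sigma>: "0 \<le> \<sigma>" if "0 < m" using inst size[OF that] that
    by (auto simp: indexed_instance_def reallocation_instance_def)
  have d: "0 \<le> carry_out I w" "0 \<le> carry_in I w" and cap: "ereal (\<Sum>p \<in> out_products I w. psize I p) \<le> capacity I w"
    "ereal (\<Sum>p \<in> in_products I w. psize I p) \<le> capacity I w"
    using inst w by (auto simp: indexed_instance_def reallocation_instance_def)
  have round: "fibre f {p. p < m \<and> \<phi> p = lo} w \<le> k \<Longrightarrow> ereal (real k * \<sigma>) \<le> c \<Longrightarrow> 0 \<le> c \<Longrightarrow>
    ereal (real (card {p. p < m \<and> f p = w \<and> \<phi> p = lo}) * \<sigma>) \<le> c" for f :: "nat \<Rightarrow> nat" and lo k c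
  proof (cases "m = 0")
    case False
    assume a: "fibre f {p. p < m \<and> \<phi> p = lo} w \<le> k" "ereal (real k * \<sigma>) \<le> c"
    have "{p. p < m \<and> f p = w \<and> \<phi> p = lo} = {p \<in> {p. p < m \<and> \<phi> p = lo}. f p = w}" by auto
    then have "real (card {p. p < m \<and> f p = w \<and> \<phi> p = lo}) * \<sigma> \<le> real k * \<sigma>"
      using a(1) \<sigma> False by (intro mult_right_mono) (simp_all add: fibre_def)
    then show ?thesis using a(2) by (metis ereal_less_eq(3) order_trans)
  qed (simp add: zero_ereal_def[symmetric])
  have blocks: "fibre (source I) {p. p < m \<and> \<phi> p = lo} w \<le> kout w \<and> fibre (sink I) {p. p < m \<and> \<phi> p = lo} w \<le> kin w" for lo
  proof (cases "lo < D")
    case True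
    then have "min 1 (D - lo) = 1" by simp
    then show ?thesis using b w True unfolding balanced_def by (metis mult_1 one_dvd)
  next
    case False
    then have "{p. p < m \<and> \<phi> p = lo} = {}" using b by (auto simp: balanced_def)
    then show ?thesis by (simp only:) (simp add: fibre_def)
  qed
  have out: "ereal (\<Sum>p | p \<in> out_products I w \<and> \<phi> p = \<theta>. psize I p) \<le> carry_out I w"
  proof -
    have "{p. p \<in> out_products I w \<and> \<phi> p = \<theta>} = {p. p < m \<and> source I p = w \<and> \<phi> p = \<theta>}"
      by (auto simp: out_products_def p)
    then show ?thesis
      using round[of "source I" \<theta> "kout w" "carry_out I w"] blocks k w d by (simp add: sum_size)
  qed
  have "in": "ereal (\<Sum>p | p \<in> in_products I w \<and> \<phi> p + transit I p = \<theta>. psize I p) \<le> carry_in I w"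
  proof (cases "\<tau> \<le> \<theta>")
    case True
    then have "{p. p \<in> in_products I w \<and> \<phi> p + transit I p = \<theta>} = {p. p < m \<and> sink I p = w \<and> \<phi> p = \<theta> - \<tau>}"
      using transit by (auto simp: in_products_def p)
    then show ?thesis
      using round[of "sink I" "\<theta> - \<tau>" "kin w" "carry_in I w"] blocks k w d by (simp add: sum_size)
  next
    case False
    then have "{p. p \<in> in_products I w \<and> \<phi> p + transit I p = \<theta>} = {}"
      using transit by (auto simp: in_products_def p)
    then show ?thesis using d by (simp only:) (simp add: zero_ereal_def[symmetric])
  qed
  let ?a = "fibre (source I) {..<m} w" and ?b = "fibre (sink I) {..<m} w"
  have store: "ereal ((\<Sum>p | p \<in> out_products I w \<and> \<theta> \<le> \<phi> p. psize I p) +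
      (\<Sum>p | p \<in> in_products I w \<and> \<phi> p + transit I p \<le> \<theta>. psize I p)) \<le> capacity I w"
  proof (cases "m = 0")
    case True
    then have "out_products I w = {}" "in_products I w = {}" by (auto simp: out_products_def in_products_def p)
    then show ?thesis using cap by simp
  next
    case False
    have \<tau>: "0 < \<tau>" using inst transit[of 0] False
      by (auto simp: indexed_instance_def reallocation_instance_def)
    let ?L = "{p. p < m \<and> source I p = w \<and> \<theta> \<le> \<phi> p}" and ?A = "{p. p < m \<and> sink I p = w \<and> \<phi> p + \<tau> \<le> \<theta>}"
    have "card ?A \<le> fibre (sink I) {p. p < m \<and> \<phi> p < \<theta>} w"
      unfolding fibre_def using \<tau> by (intro card_mono) auto
    also have "\<dots> \<le> fibre (source I) {p. p < m \<and> \<phi> p < \<theta>} w + (?b - ?a)"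
      using b w by (simp add: balanced_def)
    finally have 1: "card ?A \<le> fibre (source I) {p. p < m \<and> \<phi> p < \<theta>} w + (?b - ?a)" .
    have all: "{..<m} = {p. p < m \<and> \<phi> p < \<theta>} \<union> {p. p < m \<and> \<theta> \<le> \<phi> p}" by auto
    have "?a = fibre (source I) {p. p < m \<and> \<phi> p < \<theta>} w + fibre (source I) {p. p < m \<and> \<theta> \<le> \<phi> p} w"
      unfolding all by (rule fibre_Un_disjoint) auto
    moreover have "card ?L = fibre (source I) {p. p < m \<and> \<theta> \<le> \<phi> p} w"
      unfolding fibre_def by (rule arg_cong[where f = card]) auto
    ultimately have "card ?L + card ?A \<le> max ?a ?b" using 1 by linarith
    then have le: "real (card ?L + card ?A) * \<sigma> \<le> real (max ?a ?b) * \<sigma>"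
      using \<sigma> False by (intro mult_right_mono) auto
    have "ereal (real ?a * \<sigma>) \<le> capacity I w"
    proof -
      have "out_products I w = {p \<in> {..<m}. source I p = w}" by (auto simp: out_products_def p)
      then show ?thesis using cap(1) by (simp add: sum_size fibre_def)
    qed
    moreover have "ereal (real ?b * \<sigma>) \<le> capacity I w"
    proof -
      have "in_products I w = {p \<in> {..<m}. sink I p = w}" by (auto simp: in_products_def p)
      then show ?thesis using cap(2) by (simp add: sum_size fibre_def)
    qed
    ultimately have cap_max: "ereal (real (max ?a ?b) * \<sigma>) \<le> capacity I w" by (simp add: max_def)
    have c: "ereal (real (card ?L + card ?A) * \<sigma>) \<le> capacity I w"
      by (rule order_trans[OF _ cap_max]) (simp only: ereal_less_eq le)
    have "{p. p \<in> out_products I w \<and> \<theta> \<le> \<phi> p} = ?L" by (auto simp: out_products_def p)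
    moreover have "{p. p \<in> in_products I w \<and> \<phi> p + transit I p \<le> \<theta>} = ?A"
      using transit by (auto simp: in_products_def p)
    ultimately show ?thesis using c by (simp add: sum_size algebra_simps)
  qed
  show "ereal (\<Sum>p | p \<in> out_products I w \<and> \<phi> p = \<theta>. psize I p) \<le> carry_out I w \<and>
    ereal (\<Sum>p | p \<in> in_products I w \<and> \<phi> p + transit I p = \<theta>. psize I p) \<le> carry_in I w \<and>
    ereal ((\<Sum>p | p \<in> out_products I w \<and> \<theta> \<le> \<phi> p. psize I p) +
      (\<Sum>p | p \<in> in_products I w \<and> \<phi> p + transit I p \<le> \<theta>. psize I p)) \<le> capacity I w"
    using out "in" store by blast
qed

text \<open>A feasible \<open>\<psi>\<close> has at most
  \<open>completion_time I \<psi> - \<tau> + 1\<close> departure times to choose from, and every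
  warehouse must manage within this number; so \<open>D\<close> is no larger.\<close>

lemma balanced_optimal:
  assumes b: "balanced n m (source I) (sink I) kout kin D 1 \<phi>"
    and k: "\<forall>w<n. ereal (real (kout w) * \<sigma>) \<le> carry_out I w \<and> ereal (real (kin w) * \<sigma>) \<le> carry_in I w"
    and least: "\<And>r. (\<forall>w<n. fits \<sigma> (carry_out I w) (fibre (source I) {..<m} w) r \<and>
      fits \<sigma> (carry_in I w) (fibre (sink I) {..<m} w) r) \<Longrightarrow> D \<le> r"
  shows "optimal_schedule I \<phi>"
  unfolding optimal_schedule_def
proof (intro conjI allI impI)
  show "feasible I \<phi>" by (rule balanced_feasible[OF b k])
  fix \<psi> assume \<psi>: "feasible I \<psi>"
  have p: "products I = {..<m}" using inst by (simp add: indexed_instance_def)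
  show "completion_time I \<phi> \<le> completion_time I \<psi>"
  proof (cases "m = 0")
    \<comment> \<open>Both completion times are \<open>Max {}\<close>, hence equal.\<close>
    case True
    then show ?thesis by (simp add: completion_time_def p)
  next
    case False
    let ?r = "completion_time I \<psi> - \<tau> + 1"
    have c: "\<psi> q + \<tau> \<le> completion_time I \<psi>" if "q < m" for q
      unfolding completion_time_def p using that transit[OF that, symmetric] by (intro Max_ge) auto
    have "\<forall>q<m. \<psi> q < ?r" using c by force
    then have D: "D \<le> ?r" using least feasible_fits[OF \<psi>] by blast
    have "\<phi> q + transit I q \<le> completion_time I \<psi>" if "q < m" for q
    proof -
      have "\<phi> q < D" using b that by (simp add: balanced_def)
      then show ?thesis using D c[OF that] transit[OF that] by simp
    qed
    then show ?thesis unfolding completion_time_def[of I \<phi>] p using False by (intro Max.boundedI) auto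
  qed
qed

end


section \<open>Halving all blocks\<close>

text \<open>The modulus is the length of the block at \<open>lo\<close>, that is
  \<open>min (2 * h) (D - lo)\<close>.\<close>

definition set_modulus :: com where
  "set_modulus = Cond (NLe (NAdd (NAdd (var ''lo'') (var ''h'')) (var ''h'')) (var ''rounds''))
     (''modulus'' ::= NAdd (var ''h'') (var ''h''))
     (''modulus'' ::= NSub (var ''rounds'') (var ''lo''))"

definition clear_lists :: com where
  "clear_lists = For ''i'' (var ''rounds'') (NAssign ''first'' (var ''i'') (NLit 0))"

text \<open>Buckets indexed by departure time, rebuilt on every level, so that a block can be
  enumerated in time proportional to its size.\<close>

definition build_lists :: com where
  "build_lists = For ''i'' (var ''m'')
     (NAssign ''next'' (var ''i'') (NCell ''first'' (NCell ''schedule'' (var ''i''))) ;;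
      NAssign ''first'' (NCell ''schedule'' (var ''i'')) (NAdd (var ''i'') (NLit 1)))"

definition split_blocks :: com where
  "split_blocks = ''lo'' ::= NLit 0 ;;
     While (Less (NAdd (var ''lo'') (var ''h'')) (var ''rounds''))
       (set_modulus ;; split_block ;; ''lo'' ::= NAdd (NAdd (var ''lo'') (var ''h'')) (var ''h''))"

definition level :: com where
  "level = clear_lists ;; build_lists ;; split_blocks"

lemma writes_split_block:
  "writes split_block = {''i'', ''val'', ''q'', ''e'', ''x'', ''y'', ''par'', ''u'', ''g'', ''t'', ''d'', ''r'', ''schedule''}"
  "rwrites split_block = {}"
  by (auto simp: split_block_def clear_values_def count_product_def add_mod_def net_values_def
      star_forest_def writes_insert_edge postpone_def)

lemma writes_level:
  "writes level = {''first'', ''next'', ''lo'', ''modulus''} \<union> writes split_block" "rwrites level = {}"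
  by (auto simp: level_def clear_lists_def build_lists_def split_blocks_def set_modulus_def writes_split_block)

definition listed :: "nat \<Rightarrow> (nat \<Rightarrow> nat) \<Rightarrow> (nat \<Rightarrow> nat) \<Rightarrow> (nat \<Rightarrow> nat) \<Rightarrow> nat \<Rightarrow> bool" where
  "listed k \<phi> nxt first lo \<longleftrightarrow> (\<exists>ps. chain nxt (first lo) ps \<and> distinct ps \<and> set ps = {p. p < k \<and> \<phi> p = lo})"

lemma listed_Suc:
  assumes "listed k \<phi> nxt first lo"
  shows "listed (Suc k) \<phi> (nxt(k := first (\<phi> k))) (first(\<phi> k := Suc k)) lo"
proof -
  obtain ps where ps: "chain nxt (first lo) ps" "distinct ps" "set ps = {p. p < k \<and> \<phi> p = lo}"
    using assms by (auto simp: listed_def)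
  have ch: "chain (nxt(k := first (\<phi> k))) (first lo) ps" by (rule chain_cong[OF ps(1)]) (use ps(3) in auto)
  show ?thesis
  proof (cases "\<phi> k = lo")
    case True
    then have "chain (nxt(k := first (\<phi> k))) ((first(\<phi> k := Suc k)) lo) (k # ps)" using ch by simp
    moreover have "distinct (k # ps)" "set (k # ps) = {p. p < Suc k \<and> \<phi> p = lo}" using ps True by (simp, auto simp: less_Suc_eq)
    ultimately show ?thesis unfolding listed_def by blast
  next
    case False
    then have "chain (nxt(k := first (\<phi> k))) ((first(\<phi> k := Suc k)) lo) ps" using ch by simp
    moreover have "set ps = {p. p < Suc k \<and> \<phi> p = lo}" using ps(3) False by (auto simp: less_Suc_eq)
    ultimately show ?thesis unfolding listed_def using ps(2) by blast
  qed
qed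

lemma wp_clear_lists:
  assumes "nmem s ''rounds'' 0 = D"
  shows "wp clear_lists s (\<lambda>t r. t \<le> 3 * D + 2 \<and> (\<forall>lo<D. nmem r ''first'' lo = 0))"
  unfolding clear_lists_def
proof (rule wp_For[where J = "\<lambda>k r. \<forall>lo<k. nmem r ''first'' lo = 0" and T = "\<lambda>_. 1" and N = D], goal_cases)
  case (2 k r)
  then show ?case by (simp add: less_Suc_eq)
next
  case (4 k r)
  then show ?case using assms by (simp add: unchanged_def)
qed auto

lemma wp_build_lists:
  assumes m: "nmem s ''m'' 0 = m" and first: "\<forall>lo<D. nmem s ''first'' lo = 0"
  shows "wp build_lists s (\<lambda>t r. t \<le> 4 * m + 2 \<and>
    (\<forall>lo<D. listed m (nmem s ''schedule'') (nmem r ''next'') (nmem r ''first'') lo))"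
  unfolding build_lists_def
proof (rule wp_For[where N = m and T = "\<lambda>_. 2" and
    J = "\<lambda>k r. \<forall>lo<D. listed k (nmem s ''schedule'') (nmem r ''next'') (nmem r ''first'') lo"], goal_cases)
  case 1
  then show ?case using first by (auto simp: listed_def intro!: exI[of _ "[]"])
next
  case (2 k r)
  have "nmem r ''schedule'' = nmem s ''schedule''" using 2(2) by (simp add: unchanged_def)
  then show ?case using 2(3,4) listed_Suc by simp
next
  case (4 k r)
  then show ?case using m by (simp add: unchanged_def)
qed auto

definition network_stored :: "nat \<Rightarrow> nat \<Rightarrow> (nat \<Rightarrow> nat) \<Rightarrow> (nat \<Rightarrow> nat) \<Rightarrow> state \<Rightarrow> bool" where
  "network_stored n m src snk s \<longleftrightarrow>
     nmem s ''n'' 0 = n \<and> nmem s ''m'' 0 = m \<and> nmem s ''base'' 0 = 1 + 3 * n \<and>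
     (\<forall>w<n. nmem s ''tail'' (1 + w) = 1 + w \<and> nmem s ''head'' (1 + w) = 0 \<and>
        nmem s ''tail'' (1 + n + w) = 1 + w \<and> nmem s ''head'' (1 + n + w) = 1 + n + w \<and>
        nmem s ''tail'' (1 + 2 * n + w) = 1 + 2 * n + w \<and> nmem s ''head'' (1 + 2 * n + w) = 1 + w) \<and>
     (\<forall>p<m. nmem s ''tail'' (1 + 3 * n + p) = 1 + n + src p \<and>
        nmem s ''head'' (1 + 3 * n + p) = 1 + 2 * n + snk p)"

lemma network_stored_unchanged:
  assumes "network_stored n m src snk s" "unchanged c s s'"
    and "writes c \<inter> {''n'', ''m'', ''base'', ''tail'', ''head''} = {}"
  shows "network_stored n m src snk s'"
proof -
  have "nmem s' a = nmem s a" if "a \<in> {''n'', ''m'', ''base'', ''tail'', ''head''}" for a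
    using assms(2,3) that by (auto simp: unchanged_def)
  then show ?thesis using assms(1) by (simp add: network_stored_def)
qed

lemma warehouse_networkI:
  assumes "network_stored n m src snk s" and "\<forall>p<m. src p < n \<and> snk p < n" and S: "S \<subseteq> {..<m}"
    and "0 < h" "h < M"
  shows "warehouse_network n M h S src snk (nmem s ''tail'') (nmem s ''head'')"
proof
  show "finite S" using S finite_subset by blast
  fix p assume "p \<in> S"
  then have "p < m" using S by auto
  then show "src p < n" "snk p < n"
    "nmem s ''tail'' (1 + 3 * n + p) = 1 + n + src p \<and> nmem s ''head'' (1 + 3 * n + p) = 1 + 2 * n + snk p"
    using assms unfolding network_stored_def by blast+
qed (use assms in \<open>unfold network_stored_def, blast+\<close>)

text \<open>All blocks refer to the schedule at the start of the level: the lists stay as they are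
  when products are postponed, and the products of blocks still ahead have not been touched.\<close>

lemma wp_split_blocks:
  assumes net: "network_stored n m src snk s" and src: "\<forall>p<m. src p < n \<and> snk p < n"
    and h: "nmem s ''h'' 0 = h" "0 < h" and D: "nmem s ''rounds'' 0 = D"
    and lists: "\<forall>lo<D. listed m (nmem s ''schedule'') (nmem s ''next'') (nmem s ''first'') lo"
    and bal: "balanced n m src snk kout kin D (2 * h) (nmem s ''schedule'')"
  shows "wp split_blocks s (\<lambda>t r. t \<le> m * (57 * n + 52) + D * (27 * n + 23) + 2 \<and>
    balanced n m src snk kout kin D h (nmem r ''schedule''))"
proof -
  let ?\<phi> = "nmem s ''schedule''"
  let ?b = "Less (NAdd (var ''lo'') (var ''h'')) (var ''rounds'')"
  define body where "body = set_modulus ;; split_block ;; ''lo'' ::= NAdd (NAdd (var ''lo'') (var ''h'')) (var ''h'')"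
  let ?S = "\<lambda>i. {p. p < m \<and> ?\<phi> p = 2 * h * i}"
  \<comment> \<open>The number of blocks longer than \<open>h\<close>. That it is at most
    \<open>D\<close> pays for the fixed cost of each block.\<close>
  define N where "N = (LEAST i. D \<le> 2 * h * i + h)"
  have DN: "D \<le> 2 * h * D + h"
  proof -
    have "1 * D \<le> 2 * h * D" using h(2) by (intro mult_le_mono1) simp
    then show ?thesis by linarith
  qed
  have N: "D \<le> 2 * h * N + h" "N \<le> D"
    unfolding N_def by (rule LeastI[of _ D], rule DN) (rule Least_le, rule DN)
  have lt: "2 * h * i + h < D" if "i < N" for i
    using not_less_Least[of i "\<lambda>i. D \<le> 2 * h * i + h"] that unfolding N_def by simp
  let ?J = "\<lambda>i r. nmem r ''lo'' 0 = 2 * h * i \<and>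
    (\<forall>p. p < m \<longrightarrow> 2 * h * i \<le> ?\<phi> p \<longrightarrow> nmem r ''schedule'' p = ?\<phi> p) \<and>
    (\<forall>p. nmem r ''schedule'' p = ?\<phi> p \<or> nmem r ''schedule'' p = ?\<phi> p + h) \<and>
    (\<forall>j<i. rounded n src snk (min (2 * h) (D - 2 * h * j)) h (?S j)
       {p. p < m \<and> ?\<phi> p = 2 * h * j \<and> nmem r ''schedule'' p = ?\<phi> p})"
  let ?T = "\<lambda>i. card (?S i) * (57 * n + 52) + (27 * n + 22)"
  let ?s = "nupdate ''lo'' 0 0 s"
  have fr: "nmem r a = nmem s a" if "unchanged body ?s r" "a \<in> {''n'', ''m'', ''base'', ''tail'', ''head'', ''h'', ''rounds'', ''first'', ''next''}" for r a
  proof -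
    have "a \<notin> writes body \<and> a \<noteq> ''lo''"
      using that(2) by (elim insertE emptyE) (simp_all add: body_def set_modulus_def writes_split_block)
    then show ?thesis using that(1) by (simp add: unchanged_def)
  qed
  have "wp (While ?b body) ?s (\<lambda>t r. t \<le> (\<Sum>i<N. ?T i + 1) + 1 \<and> ?J N r)"
  proof (rule wp_While_count[where J = ?J])
    show "?J 0 ?s" by simp
  next
    fix i r assume i: "i < N" and un: "unchanged body ?s r" and J: "?J i r"
    let ?M = "min (2 * h) (D - 2 * h * i)"
    have hr: "nmem r ''h'' 0 = h" "nmem r ''rounds'' 0 = D" "nmem r ''lo'' 0 = 2 * h * i"
      using fr[OF un, of "''h''"] fr[OF un, of "''rounds''"] h D J by simp_all
    have st: "network_stored n m src snk r"
      using net fr[OF un] by (simp add: network_stored_def)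
    have M: "h < ?M" using lt[OF i] h by auto
    \<comment> \<open>The stored ends of the edges serve all blocks; a block merely selects its
      product edges and sets the modulus.\<close>
    interpret warehouse_network n ?M h "?S i" src snk "nmem r ''tail''" "nmem r ''head''"
      by (rule warehouse_networkI[OF st src]) (use M h in auto)
    let ?r = "nupdate ''modulus'' 0 ?M r"
    have rd: "ready ?r" using st hr by (simp add: ready_def loaded_def network_stored_def)
    have "2 * h * i < D" using lt[OF i] by simp
    then obtain ps where ps: "chain (nmem s ''next'') (nmem s ''first'' (2 * h * i)) ps" "distinct ps" "set ps = ?S i"
      using lists unfolding listed_def by blast
    have ch: "chain (nmem ?r ''next'') (nmem ?r ''first'' (nmem ?r ''lo'' 0)) ps"
      using ps(1) fr[OF un, of "''next''"] fr[OF un, of "''first''"] hr by simp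
    have len: "length ps = card (?S i)" using ps distinct_card by metis
    have "wp split_block ?r (\<lambda>t r'. t + 3 \<le> ?T i \<and> ?J (Suc i) (nupdate ''lo'' 0 (nmem r' ''lo'' 0 + nmem r' ''h'' 0 + nmem r' ''h'' 0) r'))"
    proof (rule wp_mono[OF wp_split_block[OF rd ch ps(2,3)]], goal_cases)
      case (1 t r')
      note u = 1(1) and a = 1(2)
      have lo: "nmem r' ''lo'' 0 + nmem r' ''h'' 0 + nmem r' ''h'' 0 = 2 * h * Suc i"
        using u hr by (simp add: unchanged_def writes_split_block)
      have old: "nmem r ''schedule'' p = ?\<phi> p" if "p < m" "2 * h * i \<le> ?\<phi> p" for p using J that by blast
      have keep: "nmem r' ''schedule'' p = nmem r ''schedule'' p" if "p \<notin> ?S i" for p using a that by simp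
      have either: "nmem r' ''schedule'' p = nmem r ''schedule'' p \<or> nmem r' ''schedule'' p = nmem r ''schedule'' p + h" for p
        using a by simp
      have 1: "nmem r' ''schedule'' p = ?\<phi> p" if "p < m" "2 * h * Suc i \<le> ?\<phi> p" for p
        using keep[of p] old[of p] that h by simp
      have 2: "nmem r' ''schedule'' p = ?\<phi> p \<or> nmem r' ''schedule'' p = ?\<phi> p + h" for p
      proof (cases "p \<in> ?S i")
        case True
        then have "nmem r ''schedule'' p = ?\<phi> p" using old by simp
        then show ?thesis using either[of p] by simp
      next
        case False
        then show ?thesis using keep J by simp
      qed
      have 3: "rounded n src snk (min (2 * h) (D - 2 * h * j)) h (?S j)
        {p. p < m \<and> ?\<phi> p = 2 * h * j \<and> nmem r' ''schedule'' p = ?\<phi> p}" if j: "j < Suc i" for j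
      proof (cases "j = i")
        case True
        have "{p. p < m \<and> ?\<phi> p = 2 * h * i \<and> nmem r' ''schedule'' p = ?\<phi> p} =
          {p \<in> ?S i. nmem r' ''schedule'' p = nmem ?r ''schedule'' p}"
          using old by auto
        then show ?thesis using a True by simp
      next
        case False
        then have "{p. p < m \<and> ?\<phi> p = 2 * h * j \<and> nmem r' ''schedule'' p = ?\<phi> p} =
          {p. p < m \<and> ?\<phi> p = 2 * h * j \<and> nmem r ''schedule'' p = ?\<phi> p}"
          using keep h by auto
        then show ?thesis using J j False by simp
      qed
      show ?case
        unfolding lo using a len 1 2 3 by simp
    qed
    then have split: "wp split_block ?r (\<lambda>t' r'. wp (''lo'' ::= NAdd (NAdd (var ''lo'') (var ''h'')) (var ''h'')) r'
        (\<lambda>t'' r''. 2 + (t' + t'') \<le> ?T i \<and> ?J (Suc i) r''))"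
      by (rule wp_mono) (simp only: wp_simps nval.simps, simp)
    have M_eq: "?M = (if 2 * h * i + h + h \<le> D then h + h else D - 2 * h * i)"
      using lt[OF i] by (auto simp: min_def)
    have "wp set_modulus r (\<lambda>t r'. t = 2 \<and> r' = ?r)"
      unfolding M_eq by (simp add: set_modulus_def hr)
    then have "wp body r (\<lambda>t r'. t \<le> ?T i \<and> ?J (Suc i) r')"
      unfolding body_def wp_Seq by (rule wp_mono) (use split in simp)
    then show "bval ?b r \<and> wp body r (\<lambda>t r'. t \<le> ?T i \<and> ?J (Suc i) r')"
      using hr lt[OF i] by simp
  next
    fix r assume "unchanged body ?s r" "?J N r"
    then show "\<not> bval ?b r"
      using fr[of r "''h''"] fr[of r "''rounds''"] h D N by simp
  qed
  then have "wp (While ?b body) ?s (\<lambda>t r. 1 + t \<le> m * (57 * n + 52) + D * (27 * n + 23) + 2 \<and>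
    balanced n m src snk kout kin D h (nmem r ''schedule''))"
  proof (rule wp_mono, goal_cases)
    case (1 t r)
    note a = 1(2)
    have div: "2 * h dvd ?\<phi> p" if "p < m" for p using bal that by (simp add: balanced_def)
    \<comment> \<open>The blocks are disjoint, so each product is charged for at most one block of
      the level.\<close>
    have "(\<Sum>i<N. card (?S i)) = card (\<Union>i<N. ?S i)"
      using h by (intro card_UN_disjoint[symmetric]) auto
    also have "\<dots> \<le> card {..<m}" by (intro card_mono) auto
    finally have c: "(\<Sum>i<N. card (?S i)) \<le> m" by simp
    have "(\<Sum>i<N. ?T i + 1) = (\<Sum>i<N. card (?S i) * (57 * n + 52)) + (\<Sum>i<N. 27 * n + 23)"
      unfolding sum.distrib[symmetric] by (rule sum.cong) auto
    also have "\<dots> = (\<Sum>i<N. card (?S i)) * (57 * n + 52) + N * (27 * n + 23)"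
      unfolding sum_distrib_right[symmetric] by simp
    also have "\<dots> \<le> m * (57 * n + 52) + D * (27 * n + 23)"
      using c N by (intro add_mono mult_le_mono1)
    finally have t: "1 + t \<le> m * (57 * n + 52) + D * (27 * n + 23) + 2" using a by linarith
    have "balanced n m src snk kout kin D h (nmem r ''schedule'')"
    proof (rule balanced_refine[OF bal h(2)])
      show "\<forall>p<m. nmem r ''schedule'' p = ?\<phi> p \<or> nmem r ''schedule'' p = ?\<phi> p + h" using a by blast
      show "\<forall>p<m. D \<le> ?\<phi> p + h \<longrightarrow> nmem r ''schedule'' p = ?\<phi> p"
      proof (intro allI impI)
        fix p assume p: "p < m" "D \<le> ?\<phi> p + h"
        obtain i where i: "?\<phi> p = 2 * h * i" using div[OF p(1)] by (auto elim: dvdE)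
        have "\<not> i < N" using lt[of i] p(2) i by auto
        then have "2 * h * N \<le> ?\<phi> p" using i by simp
        then show "nmem r ''schedule'' p = ?\<phi> p" using a p(1) by blast
      qed
      fix lo assume lo: "2 * h dvd lo" "lo + h < D"
      then obtain i where i: "lo = 2 * h * i" by (auto elim: dvdE)
      have "i < N"
      proof (rule ccontr)
        assume "\<not> i < N"
        then have "2 * h * N \<le> 2 * h * i" by simp
        then show False using N(1) lo(2) i by linarith
      qed
      then show "rounded n src snk (min (2 * h) (D - lo)) h {p. p < m \<and> ?\<phi> p = lo}
        {p. p < m \<and> ?\<phi> p = lo \<and> nmem r ''schedule'' p = ?\<phi> p}"
        using a unfolding i by blast
    qed
    then show ?case using t by blast
  qed
  then show ?thesis unfolding split_blocks_def body_def by simp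
qed

lemma wp_level:
  assumes net: "network_stored n m src snk s" and src: "\<forall>p<m. src p < n \<and> snk p < n"
    and h: "nmem s ''h'' 0 = h" "0 < h" and D: "nmem s ''rounds'' 0 = D"
    and bal: "balanced n m src snk kout kin D (2 * h) (nmem s ''schedule'')"
  shows "wp level s (\<lambda>t r. t \<le> m * (57 * n + 56) + D * (27 * n + 26) + 6 \<and>
    balanced n m src snk kout kin D h (nmem r ''schedule''))"
  unfolding level_def wp_Seq
proof (rule wp_mono[OF wp_clear_lists[OF D]], goal_cases)
  case (1 t1 s1)
  note u1 = 1(1) and a1 = 1(2)
  have m: "nmem s1 ''m'' 0 = m" using net u1 by (simp add: unchanged_def clear_lists_def network_stored_def)
  show ?case
  proof (rule wp_mono[OF wp_build_lists[OF m conjunct2[OF a1]]], goal_cases)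
    case (1 t2 s2)
    note u2 = 1(1) and a2 = 1(2)
    have eq: "nmem s2 ''schedule'' = nmem s ''schedule''" "nmem s1 ''schedule'' = nmem s ''schedule''"
      "nmem s2 ''h'' = nmem s ''h''" "nmem s2 ''rounds'' = nmem s ''rounds''"
      using u1 u2 by (simp_all add: unchanged_def clear_lists_def build_lists_def)
    have "network_stored n m src snk s1"
      by (rule network_stored_unchanged[OF net u1]) (simp add: clear_lists_def)
    then have net2: "network_stored n m src snk s2"
      by (rule network_stored_unchanged[OF _ u2]) (simp add: build_lists_def)
    show ?case
      by (rule wp_mono[OF wp_split_blocks[OF net2 src, of h D kout kin]])
        (use h D bal a1 a2 eq in \<open>auto simp: algebra_simps\<close>)
  qed
qed


section \<open>The algorithm\<close>

definition count_degrees :: com where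
  "count_degrees = For ''i'' (var ''m'')
     (NAssign ''outdeg'' (NCell ''source'' (var ''i'')) (NAdd (NCell ''outdeg'' (NCell ''source'' (var ''i''))) (NLit 1)) ;;
      NAssign ''indeg'' (NCell ''sink'' (var ''i'')) (NAdd (NCell ''indeg'' (NCell ''sink'' (var ''i''))) (NLit 1)))"

definition fits_more :: "array_name \<Rightarrow> array_name \<Rightarrow> bexp" where
  "fits_more cnt cap = Conj (Less (var ''k'') (NCell cnt (var ''i'')))
     (RLe (RAdd (RCell ''acc'' (NLit 0)) (RCell ''size'' (NLit 0))) (RCell cap (var ''i'')))"

text \<open>Division by repeated addition: the first loop finds how many products fit into one
  round, the second how many such rounds are required. Stopping the first loop at the number of
  products copes with size 0 and with infinite limits. The array \<open>zero\<close> is never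
  written and supplies the constant 0, as real expressions have no literals.\<close>

definition fit_rounds :: "array_name \<Rightarrow> array_name \<Rightarrow> com" where
  "fit_rounds cnt cap =
     ''k'' ::= NLit 0 ;;
     RAssign ''acc'' (NLit 0) (RCell ''zero'' (NLit 0)) ;;
     While (fits_more cnt cap)
       (RAssign ''acc'' (NLit 0) (RAdd (RCell ''acc'' (NLit 0)) (RCell ''size'' (NLit 0))) ;;
        ''k'' ::= NAdd (var ''k'') (NLit 1)) ;;
     ''r'' ::= NLit 0 ;;
     ''cov'' ::= NLit 0 ;;
     While (Less (var ''cov'') (NCell cnt (var ''i'')))
       (''cov'' ::= NAdd (var ''cov'') (var ''k'') ;;
        ''r'' ::= NAdd (var ''r'') (NLit 1)) ;;
     Cond (NLe (var ''r'') (var ''rounds'')) Skip (''rounds'' ::= var ''r'')"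

definition compute_rounds :: com where
  "compute_rounds = For ''i'' (var ''n'')
     (fit_rounds ''outdeg'' ''carry_out'' ;; fit_rounds ''indeg'' ''carry_in'')"

definition star_edges :: com where
  "star_edges = For ''i'' (var ''n'')
     (''x'' ::= NAdd (NLit 1) (var ''i'') ;;
      NAssign ''tail'' (var ''x'') (var ''x'') ;;
      NAssign ''head'' (var ''x'') (NLit 0) ;;
      ''y'' ::= NAdd (var ''x'') (var ''n'') ;;
      NAssign ''tail'' (var ''y'') (var ''x'') ;;
      NAssign ''head'' (var ''y'') (var ''y'') ;;
      ''z'' ::= NAdd (var ''y'') (var ''n'') ;;
      NAssign ''tail'' (var ''z'') (var ''z'') ;;
      NAssign ''head'' (var ''z'') (var ''x''))"

definition product_edges_body :: com where
  "product_edges_body =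
     ''e'' ::= NAdd (var ''base'') (var ''i'') ;;
     NAssign ''tail'' (var ''e'') (NAdd (NAdd (NLit 1) (var ''n'')) (NCell ''source'' (var ''i''))) ;;
     NAssign ''head'' (var ''e'') (NAdd (NAdd (NLit 1) (NAdd (var ''n'') (var ''n''))) (NCell ''sink'' (var ''i'')))"

definition product_edges :: com where
  "product_edges =
     ''base'' ::= NAdd (NLit 1) (NAdd (var ''n'') (NAdd (var ''n'') (var ''n''))) ;;
     For ''i'' (var ''m'') product_edges_body"

text \<open>One block of length \<open>2 * h\<close> is to contain all rounds, while
  \<open>h\<close> stays below \<open>D\<close> unless it is 1; so the number of levels is
  logarithmic in \<open>D\<close>.\<close>

definition largest_step :: com where
  "largest_step = ''h'' ::= NLit 1 ;;
     While (Less (NAdd (var ''h'') (var ''h'')) (var ''rounds'')) (''h'' ::= NAdd (var ''h'') (var ''h''))"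

definition all_levels :: com where
  "all_levels = While (Neg (NLe (var ''h'') (NLit 0))) (level ;; ''h'' ::= NHalf (var ''h''))"

definition reallocate :: com where
  "reallocate = count_degrees ;; compute_rounds ;; star_edges ;; product_edges ;; largest_step ;; all_levels"

lemma writes_main:
  "writes count_degrees = {''i'', ''outdeg'', ''indeg''}" "rwrites count_degrees = {}"
  "writes (fit_rounds cnt cap) = {''k'', ''r'', ''cov'', ''rounds''}" "rwrites (fit_rounds cnt cap) = {''acc''}"
  "writes compute_rounds = {''i'', ''k'', ''r'', ''cov'', ''rounds''}" "rwrites compute_rounds = {''acc''}"
  "writes star_edges = {''i'', ''x'', ''y'', ''z'', ''tail'', ''head''}"
  "writes product_edges = {''base'', ''i'', ''e'', ''tail'', ''head''}"
  "writes largest_step = {''h''}"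
  by (auto simp: count_degrees_def fit_rounds_def compute_rounds_def star_edges_def product_edges_def product_edges_body_def largest_step_def)

lemma wp_count_degrees:
  assumes "nmem s ''m'' 0 = m" and "\<forall>p<m. nmem s ''source'' p = src p \<and> nmem s ''sink'' p = snk p"
    and "\<forall>w. nmem s ''outdeg'' w = 0 \<and> nmem s ''indeg'' w = 0"
  shows "wp count_degrees s (\<lambda>t r. t \<le> 4 * m + 2 \<and>
    (\<forall>w. nmem r ''outdeg'' w = fibre src {..<m} w \<and> nmem r ''indeg'' w = fibre snk {..<m} w))"
  unfolding count_degrees_def
proof (rule wp_For[where N = m and T = "\<lambda>_. 2" and
    J = "\<lambda>k r. \<forall>w. nmem r ''outdeg'' w = fibre src {..<k} w \<and> nmem r ''indeg'' w = fibre snk {..<k} w"], goal_cases)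
  case 1
  then show ?case using assms(3) by (simp add: fibre_def)
next
  case (2 k r)
  have "nmem r ''source'' k = src k" "nmem r ''sink'' k = snk k"
    using 2(1,2) assms(2) by (simp_all add: unchanged_def)
  then show ?case using 2(3,4) by (simp add: lessThan_Suc fibre_insert)
next
  case (4 k r)
  then show ?case using assms(1) by (simp add: unchanged_def)
qed auto

definition least_fit :: "real \<Rightarrow> ereal \<Rightarrow> nat \<Rightarrow> nat \<Rightarrow> bool" where
  "least_fit \<sigma> d a r \<longleftrightarrow> fits \<sigma> d a r \<and> (\<forall>r'. fits \<sigma> d a r' \<longrightarrow> r \<le> r')"

text \<open>As the size is nonnegative, the admissible loads are closed downwards, so counting up
  finds the largest. A larger load never takes more rounds; hence the result is least over all
  choices of \<open>k\<close> in \<open>fits\<close>.\<close>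

lemma wp_fit_rounds:
  assumes cnt: "cnt \<notin> {''k'', ''r'', ''cov'', ''rounds'', ''i''}" and cap: "cap \<noteq> ''acc''"
    and a: "nmem s cnt (nmem s ''i'' 0) = a" and d: "rmem s cap (nmem s ''i'' 0) = d"
    and size: "rmem s ''size'' 0 = ereal \<sigma>" "0 \<le> \<sigma>" and zero: "rmem s ''zero'' 0 = 0"
    and d0: "0 \<le> d" and fit: "0 < a \<Longrightarrow> ereal \<sigma> \<le> d"
  shows "wp (fit_rounds cnt cap) s (\<lambda>t s'. t \<le> 6 * a + 8 \<and>
    (\<exists>r. nmem s' ''rounds'' 0 = max (nmem s ''rounds'' 0) r \<and> least_fit \<sigma> d a r))"
    (is "wp _ _ (\<lambda>t s'. t \<le> _ \<and> ?P s')")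
proof -
  let ?s1 = "rupdate ''acc'' 0 0 (nupdate ''k'' 0 0 s)"
  let ?b1 = "fits_more cnt cap"
  define c1 where "c1 = RAssign ''acc'' (NLit 0) (RAdd (RCell ''acc'' (NLit 0)) (RCell ''size'' (NLit 0))) ;;
        ''k'' ::= NAdd (var ''k'') (NLit 1)"
  define b2 where "b2 = Less (var ''cov'') (NCell cnt (var ''i''))"
  define c2 where "c2 = ''cov'' ::= NAdd (var ''cov'') (var ''k'') ;; ''r'' ::= NAdd (var ''r'') (NLit 1)"
  define last where "last = Cond (NLe (var ''r'') (var ''rounds'')) Skip (''rounds'' ::= var ''r'')"
  let ?J1 = "\<lambda>q. nmem q ''k'' 0 \<le> a \<and> rmem q ''acc'' 0 = ereal (real (nmem q ''k'' 0) * \<sigma>) \<and>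
    ereal (real (nmem q ''k'' 0) * \<sigma>) \<le> d"
  have eqs: "nmem q cnt (nmem q ''i'' 0) = a \<and> rmem q cap (nmem q ''i'' 0) = d \<and> rmem q ''size'' 0 = ereal \<sigma> \<and>
      nmem q ''rounds'' = nmem s ''rounds''"
    if "\<forall>x. x \<notin> {''k'', ''r'', ''cov''} \<longrightarrow> nmem q x = nmem s x" "\<forall>x. x \<noteq> ''acc'' \<longrightarrow> rmem q x = rmem s x" for q
    using that cnt cap a d size by simp
  have loop1: "wp (While ?b1 c1) ?s1 (\<lambda>t q. t \<le> (2 + 1) * a + 1 \<and> ?J1 q \<and> \<not> bval ?b1 q)"
  proof -
    have "wp (While ?b1 c1) ?s1 (\<lambda>t q. t \<le> (2 + 1) * (a - nmem ?s1 ''k'' 0) + 1 \<and> ?J1 q \<and> \<not> bval ?b1 q)"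
    proof (rule wp_While_measure)
      show "?J1 ?s1" using d0 by (simp add: zero_ereal_def[symmetric])
      fix q assume u: "unchanged c1 ?s1 q" and J: "?J1 q" and b: "bval ?b1 q"
      have e: "nmem q cnt (nmem q ''i'' 0) = a \<and> rmem q cap (nmem q ''i'' 0) = d \<and> rmem q ''size'' 0 = ereal \<sigma> \<and>
        nmem q ''rounds'' = nmem s ''rounds''"
        by (rule eqs) (use u in \<open>auto simp: unchanged_def c1_def\<close>)
      have "ereal (real (nmem q ''k'' 0) * \<sigma>) + ereal \<sigma> \<le> d" "nmem q ''k'' 0 < a"
        using b J e by (simp_all add: fits_more_def)
      moreover have "ereal (real (nmem q ''k'' 0) * \<sigma>) + ereal \<sigma> = ereal (real (Suc (nmem q ''k'' 0)) * \<sigma>)"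
        by (simp add: algebra_simps)
      ultimately show "wp c1 q (\<lambda>t q'. t \<le> 2 \<and> ?J1 q' \<and> a - nmem q' ''k'' 0 < a - nmem q ''k'' 0)"
        using J e by (simp add: c1_def)
    qed
    then show ?thesis by simp
  qed
  have loop2: "wp (While b2 c2) q2 (\<lambda>t q. t \<le> (2 + 1) * a + 1 \<and> nmem q ''r'' 0 = r \<and> nmem q ''rounds'' = nmem s ''rounds'')"
    if q2: "nmem q2 ''cov'' 0 = 0" "nmem q2 ''r'' 0 = 0" "nmem q2 ''k'' 0 = k" "0 < a \<Longrightarrow> 0 < k"
      and fr: "\<forall>x. x \<notin> {''k'', ''r'', ''cov''} \<longrightarrow> nmem q2 x = nmem s x" "\<forall>x. x \<noteq> ''acc'' \<longrightarrow> rmem q2 x = rmem s x"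
      and r: "a \<le> r * k" "\<And>r'. a \<le> r' * k \<Longrightarrow> r \<le> r'" for q2 k r
  proof -
    let ?J2 = "\<lambda>q. nmem q ''cov'' 0 = nmem q ''r'' 0 * k \<and> nmem q ''r'' 0 \<le> r"
    have e: "nmem q cnt (nmem q ''i'' 0) = a \<and> rmem q cap (nmem q ''i'' 0) = d \<and> rmem q ''size'' 0 = ereal \<sigma> \<and>
        nmem q ''rounds'' = nmem s ''rounds''" "nmem q ''k'' 0 = k"
      if u: "unchanged c2 q2 q" for q
      by (rule eqs) (use u fr q2 in \<open>auto simp: unchanged_def c2_def\<close>)
    have "wp (While b2 c2) q2 (\<lambda>t q. t \<le> (2 + 1) * (a - nmem q2 ''cov'' 0) + 1 \<and> ?J2 q \<and> \<not> bval b2 q)"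
    proof (rule wp_While_measure)
      show "?J2 q2" using q2 by simp
      fix q assume u: "unchanged c2 q2 q" and J: "?J2 q" and b: "bval b2 q"
      have lt: "nmem q ''r'' 0 * k < a" using b J e[OF u] by (simp add: b2_def)
      then have "0 < k" using q2(4) by simp
      moreover have "nmem q ''r'' 0 < r"
      proof (rule ccontr)
        assume "\<not> nmem q ''r'' 0 < r"
        then have "r * k \<le> nmem q ''r'' 0 * k" by (intro mult_le_mono1) simp
        then show False using lt r(1) by linarith
      qed
      ultimately show "wp c2 q (\<lambda>t q'. t \<le> 2 \<and> ?J2 q' \<and> a - nmem q' ''cov'' 0 < a - nmem q ''cov'' 0)"
        using J lt e[OF u] by (simp add: c2_def)
    qed
    then show ?thesis
    proof (rule wp_mono, goal_cases)
      case (1 t q)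
      note u = 1(1) and A = 1(2)
      have u': "unchanged c2 q2 q" using u by (simp add: unchanged_def)
      have "a \<le> nmem q ''r'' 0 * k" using A e[OF u'] by (simp add: b2_def)
      then have "nmem q ''r'' 0 = r" using r(2) A by (simp add: le_antisym)
      then show ?case
        using A q2 e[OF u'] by simp
    qed
  qed
  have "wp (While ?b1 c1) ?s1 (\<lambda>t1 q1. wp (''r'' ::= NLit 0 ;; ''cov'' ::= NLit 0 ;; While b2 c2 ;; last) q1
    (\<lambda>t s'. 2 + (t1 + t) \<le> 6 * a + 8 \<and>
      ?P s'))"
  proof (rule wp_mono[OF loop1], goal_cases)
    case (1 t1 q1)
    note u1 = 1(1) and A1 = 1(2)
    define k where "k = nmem q1 ''k'' 0"
    have fr1: "\<forall>x. x \<notin> {''k'', ''r'', ''cov''} \<longrightarrow> nmem q1 x = nmem s x" "\<forall>x. x \<noteq> ''acc'' \<longrightarrow> rmem q1 x = rmem s x"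
      using u1 by (auto simp: unchanged_def c1_def)
    have ex: "k = a \<or> \<not> ereal (real (Suc k) * \<sigma>) \<le> d"
      using A1 eqs[OF fr1] unfolding fits_more_def k_def by (auto simp: algebra_simps)
    have k: "k \<le> a" "ereal (real k * \<sigma>) \<le> d" using A1 unfolding k_def by auto
    have kmax: "j \<le> k" if "j \<le> a" "ereal (real j * \<sigma>) \<le> d" for j
    proof (rule ccontr)
      assume "\<not> j \<le> k"
      then have "Suc k \<le> j" by simp
      then have "real (Suc k) * \<sigma> \<le> real j * \<sigma>" using size(2) by (intro mult_right_mono) auto
      then have "ereal (real (Suc k) * \<sigma>) \<le> ereal (real j * \<sigma>)" by (simp only: ereal_less_eq)
      then have "ereal (real (Suc k) * \<sigma>) \<le> d" using that(2) by (rule order_trans)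
      then show False using ex that(1) \<open>\<not> j \<le> k\<close> by auto
    qed
    \<comment> \<open>A single product fits by assumption, so the second loop makes progress
      whenever there is something to cover.\<close>
    have kpos: "0 < k" if "0 < a" using kmax[of 1] fit[OF that] that by simp
    define r where "r = (LEAST r. a \<le> r * k)"
    have "a \<le> a * k" using kpos by (cases "a = 0") auto
    then have r: "a \<le> r * k" "\<And>r'. a \<le> r' * k \<Longrightarrow> r \<le> r'"
      unfolding r_def by (rule LeastI) (rule Least_le)
    have fits: "fits \<sigma> d a r" "\<forall>r'. fits \<sigma> d a r' \<longrightarrow> r \<le> r'"
    proof -
      show "fits \<sigma> d a r" unfolding fits_def using k r(1) by blast
      show "\<forall>r'. fits \<sigma> d a r' \<longrightarrow> r \<le> r'"
      proof (intro allI impI)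
        fix r' assume "fits \<sigma> d a r'"
        then obtain j where j: "j \<le> a" "ereal (real j * \<sigma>) \<le> d" "a \<le> r' * j" unfolding fits_def by blast
        have "r' * j \<le> r' * k" using kmax[OF j(1,2)] by (rule mult_le_mono2)
        then show "r \<le> r'" using r(2) j(3) by (meson order_trans)
      qed
    qed
    let ?q2 = "nupdate ''cov'' 0 0 (nupdate ''r'' 0 0 q1)"
    have "wp (While b2 c2) ?q2 (\<lambda>t q. t \<le> (2 + 1) * a + 1 \<and> nmem q ''r'' 0 = r \<and> nmem q ''rounds'' = nmem s ''rounds'')"
      by (rule loop2[of _ k]) (use fr1 kpos r in \<open>auto simp: k_def\<close>)
    then have "wp (While b2 c2) ?q2 (\<lambda>t2 q. wp last q (\<lambda>t3 s'. 2 + (t1 + (1 + (1 + (t2 + t3)))) \<le> 6 * a + 8 \<and>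
      ?P s'))"
    proof (rule wp_mono, goal_cases)
      case (1 t2 q)
      note A2 = 1(2)
      have "wp last q (\<lambda>t3 s'. t3 \<le> 2 \<and> nmem s' ''rounds'' 0 = max (nmem s ''rounds'' 0) r)"
        using A2 by (simp add: last_def max_def)
      then show ?case
        by (rule wp_mono) (use A1 A2 fits in \<open>auto simp: least_fit_def intro!: exI[of _ r]\<close>)
    qed
    then show ?case
      unfolding wp_Seq wp_simps(2) nval.simps .
  qed
  moreover have "rupdate ''acc'' (nval (NLit 0) (nupdate ''k'' 0 0 s)) (rval (RCell ''zero'' (NLit 0)) (nupdate ''k'' 0 0 s)) (nupdate ''k'' 0 0 s) = ?s1"
    using zero by simp
  ultimately show ?thesis
    unfolding fit_rounds_def c1_def[symmetric] b2_def[symmetric] c2_def[symmetric] last_def[symmetric]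
      wp_Seq[of "_ ::= _"] wp_Seq[of "RAssign _ _ _"] wp_Seq[of "While ?b1 c1"] wp_simps(2,3)
    by simp
qed

text \<open>\<open>fits\<close> is monotone in the number of rounds, so the maximum of the local
  minima is the least number that suits every warehouse.\<close>

lemma wp_compute_rounds:
  assumes n: "nmem s ''n'' 0 = n" and deg: "\<forall>w. nmem s ''outdeg'' w = a w \<and> nmem s ''indeg'' w = b w"
    and am: "\<forall>w<n. a w \<le> m \<and> b w \<le> m" and size: "rmem s ''size'' 0 = ereal \<sigma>" "0 \<le> \<sigma>"
    and zero: "rmem s ''zero'' 0 = 0" and r0: "nmem s ''rounds'' 0 = 0"
    and cap: "\<forall>w<n. rmem s ''carry_out'' w = dout w \<and> rmem s ''carry_in'' w = din w"
    and d0: "\<forall>w<n. 0 \<le> dout w \<and> 0 \<le> din w \<and> (0 < a w \<longrightarrow> ereal \<sigma> \<le> dout w) \<and> (0 < b w \<longrightarrow> ereal \<sigma> \<le> din w)"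
  shows "wp compute_rounds s (\<lambda>t r. t \<le> n * (12 * m + 18) + 2 \<and>
    (\<forall>w<n. fits \<sigma> (dout w) (a w) (nmem r ''rounds'' 0) \<and> fits \<sigma> (din w) (b w) (nmem r ''rounds'' 0)) \<and>
    (\<forall>r'. (\<forall>w<n. fits \<sigma> (dout w) (a w) r' \<and> fits \<sigma> (din w) (b w) r') \<longrightarrow> nmem r ''rounds'' 0 \<le> r'))"
  unfolding compute_rounds_def
proof (rule wp_For[where N = n and T = "\<lambda>_. 12 * m + 16" and
    J = "\<lambda>k r. (\<forall>w<k. fits \<sigma> (dout w) (a w) (nmem r ''rounds'' 0) \<and> fits \<sigma> (din w) (b w) (nmem r ''rounds'' 0)) \<and>
      (\<forall>r'. (\<forall>w<k. fits \<sigma> (dout w) (a w) r' \<and> fits \<sigma> (din w) (b w) r') \<longrightarrow> nmem r ''rounds'' 0 \<le> r')"], goal_cases)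
  case 1
  then show ?case using r0 by simp
next
  case (2 k r)
  have un: "nmem r x = nmem s x" if "x \<in> {''outdeg'', ''indeg'', ''n''}" for x
    using 2(2) that by (elim insertE emptyE) (simp_all add: unchanged_def writes_main)
  have ur: "rmem r x = rmem s x" if "x \<noteq> ''acc''" for x
    using 2(2) that by (simp add: unchanged_def writes_main)
  let ?R = "nmem r ''rounds'' 0"
  let ?I = "\<lambda>k D. (\<forall>w<k. fits \<sigma> (dout w) (a w) D \<and> fits \<sigma> (din w) (b w) D) \<and>
      (\<forall>r'. (\<forall>w<k. fits \<sigma> (dout w) (a w) r' \<and> fits \<sigma> (din w) (b w) r') \<longrightarrow> D \<le> r')"
  have f1: "wp (fit_rounds ''outdeg'' ''carry_out'') r (\<lambda>t s'. t \<le> 6 * a k + 8 \<and>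
    (\<exists>x. nmem s' ''rounds'' 0 = max ?R x \<and> least_fit \<sigma> (dout k) (a k) x))"
    by (rule wp_fit_rounds) (use 2(1,4) un ur deg size zero cap d0 in auto)
  show ?case unfolding wp_Seq
  proof (rule wp_mono[OF f1], goal_cases)
    case (1 t1 s1)
    note u1 = 1(1) and A1 = 1(2)
    then obtain x where x: "nmem s1 ''rounds'' 0 = max ?R x" "fits \<sigma> (dout k) (a k) x"
      "\<And>r'. fits \<sigma> (dout k) (a k) r' \<Longrightarrow> x \<le> r'"
      unfolding least_fit_def by blast
    have e: "nmem s1 ''i'' 0 = k" "nmem s1 ''indeg'' = nmem s ''indeg''" "rmem s1 ''size'' = rmem s ''size''"
      "rmem s1 ''zero'' = rmem s ''zero''" "rmem s1 ''carry_in'' = rmem s ''carry_in''"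
      using u1 un[of "''indeg''"] ur 2(4) by (simp_all add: unchanged_def writes_main)
    have f2: "wp (fit_rounds ''indeg'' ''carry_in'') s1 (\<lambda>t s'. t \<le> 6 * b k + 8 \<and>
      (\<exists>y. nmem s' ''rounds'' 0 = max (nmem s1 ''rounds'' 0) y \<and> least_fit \<sigma> (din k) (b k) y))"
      by (rule wp_fit_rounds) (use 2(1) e deg size zero cap d0 in auto)
    show ?case
    proof (rule wp_mono[OF f2], goal_cases)
      case (1 t2 s2)
      note A2 = 1(2)
      then obtain y where y: "nmem s2 ''rounds'' 0 = max (nmem s1 ''rounds'' 0) y" "fits \<sigma> (din k) (b k) y"
        "\<And>r'. fits \<sigma> (din k) (b k) r' \<Longrightarrow> y \<le> r'"
        unfolding least_fit_def by blast
      let ?D = "nmem s2 ''rounds'' 0"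
      have le: "?R \<le> ?D" "x \<le> ?D" "y \<le> ?D" "?D = max (max ?R x) y" using x y by simp_all
      have "fits \<sigma> (dout w) (a w) ?D \<and> fits \<sigma> (din w) (b w) ?D" if "w < Suc k" for w
      proof (cases "w = k")
        case True
        then show ?thesis using fits_mono x(2) y(2) le by blast
      next
        case False
        then have "fits \<sigma> (dout w) (a w) ?R \<and> fits \<sigma> (din w) (b w) ?R" using 2(3) that by simp
        then show ?thesis using fits_mono le(1) by blast
      qed
      moreover have "?D \<le> r'" if "\<forall>w<Suc k. fits \<sigma> (dout w) (a w) r' \<and> fits \<sigma> (din w) (b w) r'" for r'
      proof -
        have "?R \<le> r'" using 2(3) that by auto
        moreover have "x \<le> r'" "y \<le> r'" using x(3) y(3) that by auto
        ultimately show ?thesis using le(4) by simp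
      qed
      moreover have "t1 + t2 \<le> 12 * m + 16"
      proof -
        have "a k \<le> m" "b k \<le> m" using am 2(1) by auto
        then show ?thesis using A1 A2 by linarith
      qed
      ultimately show ?case
        by simp
    qed
  qed
next
  case (4 k r)
  then show ?case using n by (simp add: unchanged_def writes_main)
qed (auto simp: writes_main algebra_simps)

definition stars_stored :: "nat \<Rightarrow> nat \<Rightarrow> state \<Rightarrow> bool" where
  "stars_stored n k s \<longleftrightarrow> (\<forall>w<k. nmem s ''tail'' (1 + w) = 1 + w \<and> nmem s ''head'' (1 + w) = 0 \<and>
        nmem s ''tail'' (1 + n + w) = 1 + w \<and> nmem s ''head'' (1 + n + w) = 1 + n + w \<and>
        nmem s ''tail'' (1 + 2 * n + w) = 1 + 2 * n + w \<and> nmem s ''head'' (1 + 2 * n + w) = 1 + w)"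

lemma wp_star_edges:
  assumes n: "nmem s ''n'' 0 = n"
  shows "wp star_edges s (\<lambda>t r. t \<le> 11 * n + 2 \<and> stars_stored n n r)"
  unfolding star_edges_def
proof (rule wp_For[where N = n and T = "\<lambda>_. 9" and J = "stars_stored n"], goal_cases)
  case (2 k r)
  have "nmem r ''n'' 0 = n" using 2(2) n by (simp add: unchanged_def)
  moreover have "Suc (k + n + n) = Suc (2 * n + k)" by simp
  ultimately show ?case using 2 by (auto simp: stars_stored_def less_Suc_eq add_ac)
next
  case (4 k r)
  then show ?case using n by (simp add: unchanged_def)
qed (auto simp: stars_stored_def)

lemma wp_product_edges:
  assumes n: "nmem s ''n'' 0 = n" and m: "nmem s ''m'' 0 = m" and st: "stars_stored n n s"
    and sr: "\<forall>p<m. nmem s ''source'' p = src p \<and> nmem s ''sink'' p = snk p"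
  shows "wp product_edges s (\<lambda>t r. t \<le> 5 * m + 3 \<and> network_stored n m src snk r)"
proof -
  let ?s = "nupdate ''base'' 0 (1 + 3 * n) s"
  have "wp (For ''i'' (var ''m'') product_edges_body) ?s (\<lambda>t r. 1 + t \<le> 5 * m + 3 \<and> network_stored n m src snk r)"
  proof (rule wp_For[where N = m and T = "\<lambda>_. 3" and
      J = "\<lambda>k r. stars_stored n n r \<and> (\<forall>p<k. nmem r ''tail'' (1 + 3 * n + p) = 1 + n + src p \<and>
        nmem r ''head'' (1 + 3 * n + p) = 1 + 2 * n + snk p)"], goal_cases)
    case 1
    then show ?case using st by (simp add: stars_stored_def)
  next
    case (2 k r)
    have e: "nmem r ''n'' 0 = n" "nmem r ''base'' 0 = 1 + 3 * n" "nmem r ''source'' k = src k" "nmem r ''sink'' k = snk k"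
      using 2(1,2) n sr by (simp_all add: unchanged_def product_edges_body_def)
    have lt: "1 + w < 1 + 3 * n + k" "1 + n + w < 1 + 3 * n + k" "1 + 2 * n + w < 1 + 3 * n + k" if "w < n" for w
      using that by auto
    show ?case using 2(3,4) e lt by (simp add: product_edges_body_def stars_stored_def less_Suc_eq)
  next
    case (4 k r)
    then show ?case using m by (simp add: unchanged_def product_edges_body_def)
  next
    case (5 t r)
    have "nmem r ''n'' 0 = n" "nmem r ''m'' 0 = m" "nmem r ''base'' 0 = 1 + 3 * n"
      using 5(2) n m by (simp_all add: unchanged_def product_edges_body_def)
    then show ?case using 5(1,3) by (simp add: network_stored_def stars_stored_def)
  qed (simp add: product_edges_body_def)
  moreover have eq: "1 + (n + (n + n)) = 1 + 3 * n" by simp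
  ultimately show ?thesis
    unfolding product_edges_def wp_Seq wp_simps nval.simps n eq by blast
qed

lemma wp_largest_step:
  assumes D: "nmem s ''rounds'' 0 = D"
  shows "wp largest_step s (\<lambda>t r. t \<le> 2 * D + 2 \<and>
    (\<exists>j. nmem r ''h'' 0 = 2 ^ j \<and> D \<le> 2 * 2 ^ j \<and> (j = 0 \<or> 2 ^ j < D)))"
proof -
  let ?b = "Less (NAdd (var ''h'') (var ''h'')) (var ''rounds'')" and ?c = "''h'' ::= NAdd (var ''h'') (var ''h'')"
  let ?J = "\<lambda>r. \<exists>j. nmem r ''h'' 0 = 2 ^ j \<and> (j = 0 \<or> 2 ^ j < D)"
  have "wp (While ?b ?c) (nupdate ''h'' 0 1 s)
    (\<lambda>t r. t \<le> (1 + 1) * (D - nmem (nupdate ''h'' 0 1 s) ''h'' 0) + 1 \<and> ?J r \<and> \<not> bval ?b r)"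
  proof (rule wp_While_measure)
    show "?J (nupdate ''h'' 0 1 s)" by (auto intro: exI[of _ 0])
    fix r assume u: "unchanged ?c (nupdate ''h'' 0 1 s) r" and J: "?J r" and b: "bval ?b r"
    obtain j where j: "nmem r ''h'' 0 = 2 ^ j" using J by blast
    have "2 ^ Suc j < D" using b j u D by (simp add: unchanged_def)
    moreover from this have "D - (2 ^ j + 2 ^ j) < D - 2 ^ j"
      using zero_less_power[of "2::nat" j] by (simp only: power_Suc) linarith
    ultimately show "wp ?c r (\<lambda>t r'. t \<le> 1 \<and> ?J r' \<and> D - nmem r' ''h'' 0 < D - nmem r ''h'' 0)"
      using j by (auto intro!: exI[of _ "Suc j"])
  qed
  then have "wp (While ?b ?c) (nupdate ''h'' 0 1 s) (\<lambda>t r. 1 + t \<le> 2 * D + 2 \<and>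
    (\<exists>j. nmem r ''h'' 0 = 2 ^ j \<and> D \<le> 2 * 2 ^ j \<and> (j = 0 \<or> 2 ^ j < D)))"
  proof (rule wp_mono, goal_cases)
    case (1 t r)
    note u = 1(1) and A = 1(2)
    then have "D \<le> 2 * nmem r ''h'' 0" using D by (simp add: unchanged_def)
    moreover obtain j where "nmem r ''h'' 0 = 2 ^ j" "j = 0 \<or> 2 ^ j < D" using A by blast
    ultimately show ?case
      using A by auto
  qed
  then show ?thesis unfolding largest_step_def wp_Seq wp_simps nval.simps .
qed

lemma wp_all_levels:
  assumes net: "network_stored n m src snk s" and src: "\<forall>p<m. src p < n \<and> snk p < n"
    and h: "nmem s ''h'' 0 = 2 ^ j" and D: "nmem s ''rounds'' 0 = D"
    and bal: "balanced n m src snk kout kin D (2 * 2 ^ j) (nmem s ''schedule'')"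
  shows "wp all_levels s (\<lambda>t r. t \<le> Suc j * (m * (57 * n + 56) + D * (27 * n + 26) + 8) + 1 \<and>
    balanced n m src snk kout kin D 1 (nmem r ''schedule''))"
proof -
  let ?c = "level ;; ''h'' ::= NHalf (var ''h'')" and ?b = "Neg (NLe (var ''h'') (NLit 0))"
  let ?T = "m * (57 * n + 56) + D * (27 * n + 26) + 7"
  \<comment> \<open>After the last level, halving 1 gives 0, whereas \<open>2 ^ (j - Suc j)\<close>
    is 1 by truncation; hence the case distinction.\<close>
  let ?J = "\<lambda>k r. if k \<le> j then nmem r ''h'' 0 = 2 ^ (j - k) \<and> balanced n m src snk kout kin D (2 * 2 ^ (j - k)) (nmem r ''schedule'')
    else nmem r ''h'' 0 = 0 \<and> balanced n m src snk kout kin D 1 (nmem r ''schedule'')"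
  have "wp (While ?b ?c) s (\<lambda>t r. t \<le> (\<Sum>k<Suc j. ?T + 1) + 1 \<and> ?J (Suc j) r)"
  proof (rule wp_While_count[where J = ?J])
    show "?J 0 s" using h bal by simp
  next
    fix k r assume k: "k < Suc j" and u: "unchanged ?c s r" and J: "?J k r"
    let ?h = "2 ^ (j - k) :: nat"
    have h: "nmem r ''h'' 0 = ?h" "balanced n m src snk kout kin D (2 * ?h) (nmem r ''schedule'')"
      using J k by auto
    have netr: "network_stored n m src snk r"
      by (rule network_stored_unchanged[OF net u]) (auto simp: writes_level writes_split_block)
    have Dr: "nmem r ''rounds'' 0 = D" using u D by (simp add: unchanged_def writes_level writes_split_block)
    have "wp level r (\<lambda>t r'. t + 1 \<le> ?T \<and> ?J (Suc k) (nupdate ''h'' 0 (nmem r' ''h'' 0 div 2) r'))"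
    proof (rule wp_mono[OF wp_level[OF netr src h(1) _ Dr h(2)]])
      show "0 < ?h" by simp
      fix t r' assume u': "unchanged level r r'"
        and A: "t \<le> m * (57 * n + 56) + D * (27 * n + 26) + 6 \<and> balanced n m src snk kout kin D ?h (nmem r' ''schedule'')"
      have hr: "nmem r' ''h'' 0 = ?h" using u' h by (simp add: unchanged_def writes_level writes_split_block)
      show "t + 1 \<le> ?T \<and> ?J (Suc k) (nupdate ''h'' 0 (nmem r' ''h'' 0 div 2) r')"
      proof (cases "k = j")
        case True
        then show ?thesis using A hr by simp
      next
        case False
        then have "j - k = Suc (j - Suc k)" using k by simp
        then have "?h = 2 * 2 ^ (j - Suc k)" by simp
        then show ?thesis using A hr False k by simp
      qed
    qed
    then have "wp ?c r (\<lambda>t r'. t \<le> ?T \<and> ?J (Suc k) r')"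
      unfolding wp_Seq wp_simps nval.simps .
    moreover have "bval ?b r" using h by simp
    ultimately show "bval ?b r \<and> wp ?c r (\<lambda>t r'. t \<le> ?T \<and> ?J (Suc k) r')" by blast
  next
    fix r :: state assume "?J (Suc j) r"
    then show "\<not> bval ?b r" by simp
  qed
  then show ?thesis unfolding all_levels_def by (rule wp_mono) (simp add: algebra_simps)
qed

text \<open>Since \<open>m * n\<close> bounds \<open>m\<close>, \<open>n\<close>, \<open>D\<close>
  and 1, a level costs at most 180 times \<open>m * n\<close>; everything outside the levels fits
  into 70 times \<open>m * n\<close>.\<close>

lemma running_time_bound:
  fixes n m D j :: nat
  assumes "0 < n" "0 < m" "D \<le> m"
    and "t1 \<le> 4 * m + 2" "t2 \<le> n * (12 * m + 18) + 2" "t3 \<le> 11 * n + 2" "t4 \<le> 5 * m + 3" "t5 \<le> 2 * D + 2"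
    and "t6 \<le> Suc j * (m * (57 * n + 56) + D * (27 * n + 26) + 8) + 1"
  shows "t1 + (t2 + (t3 + (t4 + (t5 + t6)))) \<le> 250 * (m * n) * Suc j"
proof -
  let ?x = "m * n"
  have x: "m \<le> ?x" "n \<le> ?x" "1 \<le> ?x" using assms(1,2) by simp_all
  have "D * (27 * n + 26) \<le> m * (27 * n + 26)" using assms(3) by (rule mult_le_mono1)
  then have "m * (57 * n + 56) + D * (27 * n + 26) + 8 \<le> 84 * ?x + 82 * m + 8" by (simp add: algebra_simps)
  also have "\<dots> \<le> 180 * ?x" using x by linarith
  finally have "t6 \<le> Suc j * (180 * ?x) + 1" using assms(9) mult_le_mono2 order_trans by (meson add_le_mono1)
  moreover have "n * (12 * m + 18) = 12 * ?x + 18 * n" by (simp add: algebra_simps)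
  moreover have "70 * ?x \<le> 70 * ?x * Suc j" by simp
  moreover have "Suc j * (180 * ?x) + 70 * ?x * Suc j = 250 * ?x * Suc j" by (simp add: algebra_simps)
  ultimately show ?thesis using assms(3-8) x by linarith
qed

lemma wp_reallocate:
  assumes inst: "indexed_instance n m I" and us: "uniform_size I" and ut: "uniform_transit I"
  shows "wp reallocate (input_state n m I) (\<lambda>t s. optimal_schedule I (output_schedule s) \<and>
    (2 \<le> m \<longrightarrow> real t \<le> 500 * real m * real n * log 2 (real m)))" (is "wp _ ?s0 ?Q")
proof -
  have p: "products I = {..<m}" "warehouses I = {..<n}" and ri: "reallocation_instance I"
    using inst by (auto simp: indexed_instance_def)
  \<comment> \<open>Without products the value 0 agrees with the masked cell 0 of the input array
    \<open>size\<close>.\<close>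
  define \<sigma> where "\<sigma> = (if 0 < m then psize I 0 else 0)"
  have size: "psize I q = \<sigma>" if "q < m" for q
    using us that unfolding uniform_size_def p \<sigma>_def by (metis lessThan_iff less_nat_zero_code neq0_conv)
  obtain \<tau> where transit: "transit I q = \<tau>" if "q < m" for q
    using ut unfolding uniform_transit_def p by blast
  have src: "\<forall>q<m. source I q < n \<and> sink I q < n" and \<sigma>: "0 \<le> \<sigma>"
    using ri unfolding reallocation_instance_def p \<sigma>_def by auto
  let ?a = "fibre (source I) {..<m}" and ?b = "fibre (sink I) {..<m}"
  have am: "?a w \<le> m" "?b w \<le> m" for w
    unfolding fibre_def using card_mono[of "{..<m}" "{q \<in> {..<m}. _ q = w}"] by auto
  have d0: "0 \<le> carry_out I w \<and> 0 \<le> carry_in I w \<and> (0 < ?a w \<longrightarrow> ereal \<sigma> \<le> carry_out I w) \<and> (0 < ?b w \<longrightarrow> ereal \<sigma> \<le> carry_in I w)"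
    if w: "w < n" for w
  proof (intro conjI impI)
    show "0 \<le> carry_out I w" "0 \<le> carry_in I w" using ri w unfolding reallocation_instance_def p by auto
    assume "0 < ?a w"
    then obtain q where "q < m" "source I q = w" unfolding fibre_def card_gt_0_iff by auto
    then show "ereal \<sigma> \<le> carry_out I w"
      using ri w size[of q] unfolding reallocation_instance_def out_products_def p by auto
  next
    assume "0 < ?b w"
    then obtain q where "q < m" "sink I q = w" unfolding fibre_def card_gt_0_iff by auto
    then show "ereal \<sigma> \<le> carry_in I w"
      using ri w size[of q] unfolding reallocation_instance_def in_products_def p by auto
  qed
  have input: "nmem ?s0 ''n'' 0 = n" "nmem ?s0 ''m'' 0 = m" "\<forall>q<m. nmem ?s0 ''source'' q = source I q \<and> nmem ?s0 ''sink'' q = sink I q"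
    "\<forall>w. nmem ?s0 ''outdeg'' w = 0 \<and> nmem ?s0 ''indeg'' w = 0" "nmem ?s0 ''rounds'' 0 = 0" "nmem ?s0 ''schedule'' = (\<lambda>_. 0)"
    "rmem ?s0 ''size'' 0 = ereal \<sigma>" "rmem ?s0 ''zero'' 0 = 0"
    "\<forall>w<n. rmem ?s0 ''carry_out'' w = carry_out I w \<and> rmem ?s0 ''carry_in'' w = carry_in I w"
    by (auto simp: input_state_def \<sigma>_def zero_ereal_def)
  have "wp count_degrees ?s0 (\<lambda>t1 s1. wp compute_rounds s1 (\<lambda>t2 s2. wp star_edges s2 (\<lambda>t3 s3.
     wp product_edges s3 (\<lambda>t4 s4. wp largest_step s4 (\<lambda>t5 s5. wp all_levels s5
       (\<lambda>t6. ?Q (t1 + (t2 + (t3 + (t4 + (t5 + t6)))))))))))"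
  proof (rule wp_mono[OF wp_count_degrees[OF input(2-4)]], goal_cases)
    case (1 t1 s1)
    note u1 = 1(1) and A1 = 1(2)
    have e1: "nmem s1 x = nmem ?s0 x" if "x \<in> {''n'', ''m'', ''source'', ''sink'', ''rounds'', ''schedule''}" for x
      using u1 that by (elim insertE emptyE) (simp_all add: unchanged_def writes_main)
    have r1: "rmem s1 x = rmem ?s0 x" for x using u1 by (simp add: unchanged_def writes_main)
    have cr: "wp compute_rounds s1 (\<lambda>t r. t \<le> n * (12 * m + 18) + 2 \<and>
      (\<forall>w<n. fits \<sigma> (carry_out I w) (?a w) (nmem r ''rounds'' 0) \<and> fits \<sigma> (carry_in I w) (?b w) (nmem r ''rounds'' 0)) \<and>
      (\<forall>r'. (\<forall>w<n. fits \<sigma> (carry_out I w) (?a w) r' \<and> fits \<sigma> (carry_in I w) (?b w) r') \<longrightarrow> nmem r ''rounds'' 0 \<le> r'))"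
      by (rule wp_compute_rounds) (use A1 am e1 r1 input \<sigma> d0 in simp_all)
    show ?case
    proof (rule wp_mono[OF cr], goal_cases)
      case (1 t2 s2)
      note u2 = 1(1) and A2 = 1(2)
      let ?D = "nmem s2 ''rounds'' 0"
      have e2: "nmem s2 x = nmem ?s0 x" if "x \<in> {''n'', ''m'', ''source'', ''sink'', ''schedule''}" for x
        using u2 that e1 by (elim insertE emptyE) (simp_all add: unchanged_def writes_main)
      have least: "\<And>r. \<forall>w<n. fits \<sigma> (carry_out I w) (?a w) r \<and> fits \<sigma> (carry_in I w) (?b w) r \<Longrightarrow> ?D \<le> r"
        using A2 by blast
      \<comment> \<open>One product per round is always admissible, which yields
        \<open>D \<le> m\<close>.\<close>
      have one: "fits \<sigma> d c m" if "c \<le> m" "0 \<le> d" "0 < c \<longrightarrow> ereal \<sigma> \<le> d" for c d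
      proof (cases "c = 0")
        case True
        then show ?thesis using that by (simp add: fits_def zero_ereal_def[symmetric])
      next
        case False
        then show ?thesis unfolding fits_def using that by (intro exI[of _ 1]) auto
      qed
      have Dm: "?D \<le> m" by (rule least) (use one am d0 in blast)
      \<comment> \<open>The quotas per round live only in the proof: the halving never looks at
        capacities, and the program keeps nothing but their effect on \<open>D\<close>.\<close>
      have "\<forall>w\<in>{..<n}. \<exists>k. ereal (real k * \<sigma>) \<le> carry_out I w \<and> ?a w \<le> ?D * k"
        using A2 unfolding fits_def by blast
      from bchoice[OF this] obtain kout where
        kout: "\<forall>w\<in>{..<n}. ereal (real (kout w) * \<sigma>) \<le> carry_out I w \<and> ?a w \<le> ?D * kout w" by blast
      have "\<forall>w\<in>{..<n}. \<exists>k. ereal (real k * \<sigma>) \<le> carry_in I w \<and> ?b w \<le> ?D * k"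
        using A2 unfolding fits_def by blast
      from bchoice[OF this] obtain kin where
        kin: "\<forall>w\<in>{..<n}. ereal (real (kin w) * \<sigma>) \<le> carry_in I w \<and> ?b w \<le> ?D * kin w" by blast
      \<comment> \<open>The source of product 0 has something to send, which takes at least one
        round.\<close>
      have D0: "m = 0 \<or> 0 < ?D"
      proof (rule disjCI)
        assume "\<not> 0 < ?D"
        then have "?a w = 0" if "w < n" for w using kout that by auto
        then have "card {q \<in> {..<m}. source I q = source I 0} = 0" if "0 < m" using src that by (simp add: fibre_def)
        then show "m = 0" by (cases "m = 0") auto
      qed
      have n2: "nmem s2 ''n'' 0 = n" using e2 input by simp
      show ?case
      proof (rule wp_mono[OF wp_star_edges[OF n2]], goal_cases)
        case (1 t3 s3)
        note u3 = 1(1) and A3 = 1(2)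
        have e3: "nmem s3 x = nmem ?s0 x" if "x \<in> {''n'', ''m'', ''source'', ''sink'', ''schedule''}" for x
          using u3 that e2 by (elim insertE emptyE) (simp_all add: unchanged_def writes_main)
        have pe: "wp product_edges s3 (\<lambda>t r. t \<le> 5 * m + 3 \<and> network_stored n m (source I) (sink I) r)"
          by (rule wp_product_edges) (use A3 e3 input in simp_all)
        show ?case
        proof (rule wp_mono[OF pe], goal_cases)
          case (1 t4 s4)
          note u4 = 1(1) and A4 = 1(2)
          have D4: "nmem s4 ''rounds'' 0 = ?D" using u3 u4 by (simp add: unchanged_def writes_main)
          show ?case
          proof (rule wp_mono[OF wp_largest_step[OF D4]], goal_cases)
            case (1 t5 s5)
            note u5 = 1(1) and A5 = 1(2)
            then obtain j where j: "nmem s5 ''h'' 0 = 2 ^ j" "?D \<le> 2 * 2 ^ j" "j = 0 \<or> 2 ^ j < ?D" by blast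
            have D5: "nmem s5 ''rounds'' 0 = ?D" and sch: "nmem s5 ''schedule'' = (\<lambda>_. 0)"
              using u4 u5 D4 e3 input(6) by (simp_all add: unchanged_def writes_main)
            have net: "network_stored n m (source I) (sink I) s5"
              using A4 by (intro network_stored_unchanged[OF _ u5]) (simp_all add: writes_main)
            have bal: "balanced n m (source I) (sink I) kout kin ?D (2 * 2 ^ j) (nmem s5 ''schedule'')"
              unfolding sch by (rule balanced_init) (use kout kin D0 j in auto)
            show ?case
            proof (rule wp_mono[OF wp_all_levels[OF net src j(1) D5 bal]], goal_cases)
              case (1 t6 s6)
              note A6 = 1(2)
              have "optimal_schedule I (output_schedule s6)"
                unfolding output_schedule_def
                by (rule balanced_optimal[OF inst size transit conjunct2[OF A6] _ least]) (use kout kin in auto)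
              moreover have "real (t1 + (t2 + (t3 + (t4 + (t5 + t6))))) \<le> 500 * real m * real n * log 2 (real m)"
                if m2: "2 \<le> m"
              proof -
                have "source I 0 < n" using src m2 by simp
                then have n0: "0 < n" by simp
                have l1: "1 \<le> log 2 (real m)" using m2 by (simp add: le_log_iff)
                have "real j \<le> log 2 (real m)"
                proof (cases "j = 0")
                  case False
                  then have "2 ^ j \<le> m" using j(3) Dm by simp
                  then have "real (2 ^ j) \<le> real m" by (rule of_nat_mono)
                  then show ?thesis using m2 by (simp add: le_log_iff powr_realpow)
                qed (use l1 in simp)
                \<comment> \<open>For \<open>2 \<le> m\<close> the logarithm is at least 1 and so
                  absorbs the one additional level; this doubles 250 to 500.\<close>
                then have lj: "real (Suc j) \<le> 2 * log 2 (real m)" using l1 by simp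
                have "t1 + (t2 + (t3 + (t4 + (t5 + t6)))) \<le> 250 * (m * n) * Suc j"
                  by (rule running_time_bound[OF n0 _ Dm]) (use m2 A1 A2 A3 A4 A5 A6 in auto)
                then have "real (t1 + (t2 + (t3 + (t4 + (t5 + t6))))) \<le> real (250 * (m * n) * Suc j)" by (rule of_nat_mono)
                also have "\<dots> = 250 * (real m * real n) * real (Suc j)" by (simp only: of_nat_mult of_nat_numeral)
                also have "\<dots> \<le> 250 * (real m * real n) * (2 * log 2 (real m))"
                  using lj by (intro mult_left_mono) auto
                finally show ?thesis by (simp add: algebra_simps)
              qed
              ultimately show ?case by blast
            qed
          qed
        qed
      qed
    qed
  qed
  then show ?thesis unfolding reallocate_def wp_Seq .
qed

theorem theorem2:
  "\<exists>(alg :: com) (C :: real). \<forall>(n :: nat) (m :: nat) (I :: (nat, nat) reallocation).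
     indexed_instance n m I \<and> uniform_size I \<and> uniform_transit I \<longrightarrow>
     (\<exists>t s. exec alg (input_state n m I) t s \<and>
            optimal_schedule I (output_schedule s) \<and>
            (2 \<le> m \<longrightarrow> real t \<le> C * real m * real n * log 2 (real m)))"
  using wp_reallocate unfolding wp_def by blast

end
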